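(* Fix $R>0$ and $\lambda>0$. Let $\Pi$ be the compound Poisson process (CPP) prior, i.e. the law on $D[0,1]$ of $$X_t=\sum_{i=0}^{N_t}\Delta_i,\quad t\in[0,1],$$ with $(N_t)_{t\ge0}$ a Poisson process of intensity $\lambda$, $\Delta_0\sim H$, $(\Delta_i)_{i\ge1}$ i.i.d. with distribution $G$, all independent, where $H$ has a positive and continuous Lebesgue density $h$ on $\mathbb{R}$ and $G$ has a Lebesgue density $g$. Suppose there are constants $\gamma,L>0$ such that $\mathbb{P}(|\Delta_i|\ge s)\le L^{-1}e^{-Ls^\gamma}$ for all $s\ge 0$ and all $i\ge 0$. Then there exist positive constants $M$ and $c$ such that, for all sufficiently large $n$: (i) if $g$ is positive and continuous on $\mathbb{R}^+=[0,\infty)$, $$\sup_{f_0\in\mathcal{M}(R)}E_{f_0}\Big[\Pi\Big(f:\|f-f_0\|_1\ge M\sqrt{\tfrac{\log n}{n}}\,\Big|\,N\Big)\Big]\le e^{-c\sqrt{n\log n}};$$ (ii) if $g$ is positive and continuous on $\mathbb{R}$ and $0<\beta\le 1$, $$\sup_{f_0\in\mathcal{C}^\beta(R)}E_{f_0}\Big[\Pi\Big(f:\|f-f_0\|_1\ge M\big(\tfrac{\log n}{n}\big)^{\beta/(1+\beta)}\,\Big|\,N\Big)\Big]\le e^{-cn(\log n/n)^{\beta/(1+\beta)}};$$ (iii) if $g$ is positive and continuous on $\mathbb{R}$ and $(K_n)$ is a sequence of positive integers with $n^\rho\lesssim K_n=o(n/\log n)$ for some $\rho>0$, $$\sup_{f_0\in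 \mathrm{PC}(K_n,R)}E_{f_0}\Big[\Pi\Big(f:\|f-f_0\|_1\ge M\tfrac{K_n}{n}\log n\,\Big|\,N\Big)\Big]\le n^{-cK_n}.$$
   Context: Model: for $f\in L^1([0,1])$, $P_f$ (expectation $E_f$) is the law of a Poisson point process $N=\sum_i\delta_{(X_i,Y_i)}$ on $[0,1]\times\mathbb{R}$ with intensity $\lambda_f(x,y)=n\mathbf{1}(f(x)\le y)$ with respect to Lebesgue measure. $D[0,1]$ is the space of càdlàg functions with the Skorokhod topology. For a prior $\Pi$ on $D[0,1]$ the posterior is $$\Pi(B\mid N)=\frac{\int_B e^{n\int_0^1 f}\mathbf{1}(\forall i:f(X_i)\le Y_i)\,d\Pi(f)}{\int e^{n\int_0^1 f}\mathbf{1}(\forall i:f(X_i)\le Y_i)\,d\Pi(f)}.$$ $\|\cdot\|_1$ is the $L^1([0,1])$-norm. Function classes on $[0,1]$: $\mathcal{M}(R)$ is the set of monotone increasing $f$ with $-R\le f(0)\le f(1)\le R$. $\mathcal{C}^\beta(R)$ is the ball of $\beta$-Hölder functions $f:[0,1]\to\mathbb{R}$ with Hölder norm $\|f\|_{C^\beta}\le R$. $\mathrm{PC}(K,R)$ is the set of $f=\sum_{j=1}^K b_j\mathbf{1}_{[t_{j-1},t_j)}$ with $0=t_0<t_1<\dots<t_K=1$ and $|b_j|\le R$. $a_n\lesssim b_n$ means $a_n\le Cb_n$ for a constant $C$ independent of $n$. *)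

theory Defs
  imports "HOL-Probability.Probability" "HOL-Library.Landau_Symbols"
begin

subsection \<open>The space D[0,1]\<close>

text \<open>Elements of D[0,1] are represented by functions that are undefined outside [0,1], so that
  equality of elements is equality on [0,1].\<close>

definition cadlag01 :: "(real \<Rightarrow> real) set" where
  "cadlag01 = {f \<in> extensional {0..1}.
     (\<forall>t\<in>{0..<1}. (f \<longlongrightarrow> f t) (at_right t)) \<and>
     (\<forall>t\<in>{0<..1}. \<exists>l. (f \<longlongrightarrow> l) (at_left t))}"

text \<open>An increasing bijection of [0,1] is automatically a homeomorphism.\<close>

definition time_changes :: "(real \<Rightarrow> real) set" where
  "time_changes = {\<tau>. strict_mono_on {0..1} \<tau> \<and> \<tau> ` {0..1} = {0..1}}"

text \<open>Both suprema are over bounded sets of reals, since cadlag functions on [0,1] are bounded.\<close>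

definition skorokhod_dist :: "(real \<Rightarrow> real) \<Rightarrow> (real \<Rightarrow> real) \<Rightarrow> real" where
  "skorokhod_dist f g = (INF \<tau>\<in>time_changes.
     max (SUP t\<in>{0..1}. \<bar>\<tau> t - t\<bar>) (SUP t\<in>{0..1}. \<bar>f t - g (\<tau> t)\<bar>))"

definition skorokhod_open :: "(real \<Rightarrow> real) set \<Rightarrow> bool" where
  "skorokhod_open U \<longleftrightarrow> U \<subseteq> cadlag01 \<and>
     (\<forall>f\<in>U. \<exists>r>0. \<forall>g\<in>cadlag01. skorokhod_dist f g < r \<longrightarrow> g \<in> U)"

definition skorokhod_borel :: "(real \<Rightarrow> real) measure" where
  "skorokhod_borel = sigma cadlag01 {U. skorokhod_open U}"


subsection \<open>Compound Poisson process prior\<close>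

text \<open>All paths (not just almost all) are required to be increasing and right-continuous;
  \<^term>\<open>at_right t\<close> convergence in the discrete type \<^typ>\<open>nat\<close> means local constancy to the
  right. In particular the truncated subtraction in the increments is harmless.\<close>

definition poisson_process :: "'w measure \<Rightarrow> real \<Rightarrow> (real \<Rightarrow> 'w \<Rightarrow> nat) \<Rightarrow> bool" where
  "poisson_process \<Omega> lam N \<longleftrightarrow> prob_space \<Omega> \<and>
     (\<forall>t\<ge>0. N t \<in> measurable \<Omega> (count_space UNIV)) \<and>
     (\<forall>\<omega>\<in>space \<Omega>. N 0 \<omega> = 0) \<and>
     (\<forall>\<omega>\<in>space \<Omega>. mono_on {0..} (\<lambda>t. N t \<omega>)) \<and>
     (\<forall>\<omega>\<in>space \<Omega>. \<forall>t\<ge>0. ((\<lambda>s. N s \<omega>) \<longlongrightarrow> N t \<omega>) (at_right t)) \<and>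
     (\<forall>s\<ge>0. \<forall>t>s. distr \<Omega> (count_space UNIV) (\<lambda>\<omega>. N t \<omega> - N s \<omega>)
                    = measure_pmf (poisson_pmf (lam * (t - s)))) \<and>
     (\<forall>t. incseq t \<and> t 0 \<ge> 0 \<longrightarrow>
        prob_space.indep_vars \<Omega> (\<lambda>_::nat. count_space UNIV)
          (\<lambda>j \<omega>. N (t (Suc j)) \<omega> - N (t j) \<omega>) UNIV)"

text \<open>\<^term>\<open>N\<close> as a process is independent of the sequence \<^term>\<open>\<Delta>\<close>, whose members are independent.\<close>

definition cpp_independent ::
    "'w measure \<Rightarrow> (real \<Rightarrow> 'w \<Rightarrow> nat) \<Rightarrow> (nat \<Rightarrow> 'w \<Rightarrow> real) \<Rightarrow> bool" where
  "cpp_independent \<Omega> N \<Delta> \<longleftrightarrow>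
     prob_space.indep_vars \<Omega> (\<lambda>_. borel) \<Delta> UNIV \<and>
     prob_space.indep_set \<Omega>
       (sets (vimage_algebra (space \<Omega>) (\<lambda>\<omega>. \<lambda>t\<in>{0..}. N t \<omega>)
                (Pi\<^sub>M {0..} (\<lambda>_. count_space UNIV))))
       (sets (vimage_algebra (space \<Omega>) (\<lambda>\<omega> i. \<Delta> i \<omega>) (Pi\<^sub>M UNIV (\<lambda>_. borel))))"

definition cpp_path ::
    "(real \<Rightarrow> 'w \<Rightarrow> nat) \<Rightarrow> (nat \<Rightarrow> 'w \<Rightarrow> real) \<Rightarrow> 'w \<Rightarrow> real \<Rightarrow> real" where
  "cpp_path N \<Delta> \<omega> = (\<lambda>t\<in>{0..1}. \<Sum>i=0..N t \<omega>. \<Delta> i \<omega>)"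

definition cpp_law ::
    "'w measure \<Rightarrow> (real \<Rightarrow> 'w \<Rightarrow> nat) \<Rightarrow> (nat \<Rightarrow> 'w \<Rightarrow> real) \<Rightarrow> (real \<Rightarrow> real) measure" where
  "cpp_law \<Omega> N \<Delta> = distr \<Omega> skorokhod_borel (cpp_path N \<Delta>)"


subsection \<open>Observation model\<close>

text \<open>A point configuration \<open>\<Sum>\<^sub>i \<delta>(p i)\<close> of infinite total mass is given by a sequence \<open>p\<close> of
  its points, with multiplicities; \<open>point_count p A\<close> is its mass on \<open>A\<close>.\<close>

definition point_count :: "(nat \<Rightarrow> 'b) \<Rightarrow> 'b set \<Rightarrow> ennreal" where
  "point_count p A = emeasure (count_space UNIV) {i. p i \<in> A}"

text \<open>\<open>P\<close> is the joint law of random points \<open>p 0, p 1, \<dots>\<close> such that \<open>\<Sum>\<^sub>i \<delta>(p i)\<close> is a Poisson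
  point process with intensity measure \<open>\<nu>\<close>, where \<open>\<nu>\<close> has infinite total mass. The law of
  the point process is determined by \<open>\<nu>\<close>; only the enumeration of its points is not.\<close>

definition poisson_points_law :: "'b measure \<Rightarrow> (nat \<Rightarrow> 'b) measure \<Rightarrow> bool" where
  "poisson_points_law \<nu> P \<longleftrightarrow> prob_space P \<and>
     sets P = sets (Pi\<^sub>M UNIV (\<lambda>_. \<nu>)) \<and>
     (\<forall>A\<in>sets \<nu>. emeasure \<nu> A < \<infinity> \<longrightarrow>
        (\<forall>k::nat. measure P {p \<in> space P. point_count p A = of_nat k}
                  = measure \<nu> A ^ k / fact k * exp (- measure \<nu> A))) \<and>
     (\<forall>A\<in>sets \<nu>. emeasure \<nu> A = \<infinity> \<longrightarrow> (AE p in P. point_count p A = \<infinity>)) \<and>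
     (\<forall>A. (\<forall>j. A j \<in> sets \<nu>) \<and> disjoint_family A \<longrightarrow>
        prob_space.indep_vars P (\<lambda>_::nat. borel) (\<lambda>j p. point_count p (A j)) UNIV)"

definition intensity :: "nat \<Rightarrow> (real \<Rightarrow> real) \<Rightarrow> (real \<times> real) measure" where
  "intensity n f = density (restrict_space lborel ({0..1} \<times> UNIV))
     (\<lambda>(x, y). of_nat n * indicator {(x, y). f x \<le> y} (x, y))"


subsection \<open>Posterior\<close>

definition likelihood :: "nat \<Rightarrow> (nat \<Rightarrow> real \<times> real) \<Rightarrow> (real \<Rightarrow> real) \<Rightarrow> ennreal" where
  "likelihood n p f = ennreal (exp (real n * (LINT x:{0..1}|lborel. f x)))
     * indicator {f. \<forall>i. f (fst (p i)) \<le> snd (p i)} f"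

text \<open>Under every law used below, the denominator is almost surely positive and finite.\<close>

definition posterior ::
    "(real \<Rightarrow> real) measure \<Rightarrow> nat \<Rightarrow> (nat \<Rightarrow> real \<times> real) \<Rightarrow> (real \<Rightarrow> real) set \<Rightarrow> ennreal" where
  "posterior prior n p B =
     (\<integral>\<^sup>+f\<in>B. likelihood n p f \<partial>prior) / (\<integral>\<^sup>+f. likelihood n p f \<partial>prior)"

text \<open>The posterior depends on \<open>p\<close> only through \<open>\<Sum>\<^sub>i \<delta>(p i)\<close>, so its integral is the same for
  all laws \<open>P\<close> of enumerations of the Poisson point process; the supremum just picks this value.\<close>

definition expected_posterior ::
    "(real \<Rightarrow> real) measure \<Rightarrow> nat \<Rightarrow> (real \<Rightarrow> real) \<Rightarrow> (real \<Rightarrow> real) set \<Rightarrow> ennreal" where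
  "expected_posterior prior n f0 B =
     (SUP P\<in>{P. poisson_points_law (intensity n f0) P}. \<integral>\<^sup>+p. posterior prior n p B \<partial>P)"

definition L1_norm :: "(real \<Rightarrow> real) \<Rightarrow> real" where
  "L1_norm f = (LINT x:{0..1}|lborel. \<bar>f x\<bar>)"

definition L1_far :: "(real \<Rightarrow> real) \<Rightarrow> real \<Rightarrow> (real \<Rightarrow> real) set" where
  "L1_far f0 r = {f \<in> cadlag01. L1_norm (\<lambda>x. f x - f0 x) \<ge> r}"


subsection \<open>Function classes\<close>

text \<open>These consist of functions on the real line, constrained on [0,1] only; everything above
  depends on \<open>f0\<close> only through its values on [0,1].\<close>

definition monotone_class :: "real \<Rightarrow> (real \<Rightarrow> real) set" where
  "monotone_class R = {f. mono_on {0..1} f \<and> - R \<le> f 0 \<and> f 0 \<le> f 1 \<and> f 1 \<le> R}"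

definition holder_norm :: "real \<Rightarrow> (real \<Rightarrow> real) \<Rightarrow> ennreal" where
  "holder_norm \<beta> f = (SUP x\<in>{0..1}. ennreal \<bar>f x\<bar>) +
     (SUP x\<in>{0..1}. SUP y\<in>{0..1} - {x}. ennreal (\<bar>f x - f y\<bar> / \<bar>x - y\<bar> powr \<beta>))"

definition holder_ball :: "real \<Rightarrow> real \<Rightarrow> (real \<Rightarrow> real) set" where
  "holder_ball \<beta> R = {f. holder_norm \<beta> f \<le> ennreal R}"

definition piecewise_constant :: "nat \<Rightarrow> real \<Rightarrow> (real \<Rightarrow> real) set" where
  "piecewise_constant K R = {f. \<exists>(t :: nat \<Rightarrow> real) (b :: nat \<Rightarrow> real).
     t 0 = 0 \<and> t K = 1 \<and> (\<forall>j\<in>{1..K}. t (j - 1) < t j) \<and> (\<forall>j\<in>{1..K}. \<bar>b j\<bar> \<le> R) \<and>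
     (\<forall>x\<in>{0..1}. f x = (\<Sum>j=1..K. b j * indicator {t (j - 1)..<t j} x))}"

end

theory Submission
  imports Defs
begin

text \<open>For a function \<open>f\<close>, the likelihood ratio \<open>exp (n * \<integral>(f - f0))\<close> times the indicator that \<open>f\<close> lies below all
  points has expectation \<open>exp (- n * \<integral>(f0 - f)\<^sub>+)\<close> under the law of \<open>f0\<close>, since no point falls between \<open>f0\<close>
  and \<open>f\<close> with probability \<open>exp (- n * \<integral>(f - f0)\<^sub>+)\<close>. Hence, almost surely, the denominator of the
  posterior is at least the prior mass of the functions slightly below \<open>f0\<close>, up to a factor. By
  Fubini, functions far below \<open>f0\<close> contribute little to the numerator. Functions far above \<open>f0\<close> are
  excluded by the points, unless the region below one of the finitely many lower brackets of a sieve
  contains no point.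

  All three rates have the form \<open>\<epsilon> = \<kappa> * ln n / n\<close>, where \<open>\<kappa>\<close> is \<open>(n / ln n)\<^bsup>1/2\<^esup>\<close>,
  \<open>(n / ln n)\<^bsup>1/(1+\<beta>)\<^esup>\<close> or \<open>K n\<close>. A staircase with \<open>O(\<kappa>)\<close> jumps fits below \<open>f0\<close> with loss
  \<open>O(\<epsilon>)\<close>, and the paths close to it have prior mass \<open>exp (- O(\<kappa> * ln n))\<close>. Paths with at most
  \<open>A * \<kappa>\<close> jumps have \<open>exp (O(A * \<kappa> * ln n))\<close> brackets, and more jumps have prior probability
  \<open>exp (- c * A * \<kappa> * ln n)\<close>, because \<open>\<kappa>\<close> grows like a power of \<open>n\<close>.\<close>

section \<open>The Skorokhod space\<close>

text \<open>The obstacle is measurability. The prior lives on the Borel sets of the Skorokhod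
  topology, where neither the likelihood nor \<open>L1_far\<close> is shown to be measurable. The
  estimates are therefore pulled back to \<open>\<Omega>\<close>, where joint measurability in time
  and chance is available: the numerator is bounded by an integral over \<open>\<Omega>\<close>, an
  inequality valid for arbitrary integrands, and the denominator is bounded below through a
  Skorokhod-open set of functions below \<open>f0\<close>.

  The approximation of \<open>f0\<close> is one-sided, since a function exceeding \<open>f0\<close>
  is ruled out as soon as one point falls below it. In part (i) positivity of \<open>g\<close> is
  granted only for nonnegative jumps, so the staircase has to be nondecreasing and all errors in its
  jumps have to point upwards; the starting value is lowered to make room for them.

  The factor \<open>ln n\<close> is the price of one jump, whose time and size are prescribed up to
  powers of \<open>1 / n\<close>. Jump sizes can be truncated at a power of \<open>n\<close> for
  every \<gamma>, which affects only constants in the exponents.\<close>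

lemma cadlag01D:
  assumes "f \<in> cadlag01"
  shows "f \<in> extensional {0..1}"
    and "\<And>t. 0 \<le> t \<Longrightarrow> t < 1 \<Longrightarrow> (f \<longlongrightarrow> f t) (at_right t)"
    and "\<And>t. 0 < t \<Longrightarrow> t \<le> 1 \<Longrightarrow> \<exists>l. (f \<longlongrightarrow> l) (at_left t)"
  using assms by (auto simp: cadlag01_def)

section \<open>Boundedness of cadlag functions\<close>

lemma tendsto_at_right_locally_bounded:
  fixes f :: "real \<Rightarrow> real"
  assumes "(f \<longlongrightarrow> l) (at_right t)"
  obtains b where "b > t" "\<And>x. t < x \<Longrightarrow> x < b \<Longrightarrow> \<bar>f x\<bar> \<le> \<bar>l\<bar> + 1"
proof -
  have "\<forall>\<^sub>F x in at_right t. dist (f x) l < 1"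
    using assms by (auto simp: tendsto_iff)
  then obtain b where b: "b > t" "\<forall>y>t. y < b \<longrightarrow> dist (f y) l < 1"
    by (auto simp: eventually_at_right_field)
  show ?thesis
    using b by (intro that[of b]) (auto simp: dist_real_def)
qed

lemma tendsto_at_left_locally_bounded:
  fixes f :: "real \<Rightarrow> real"
  assumes "(f \<longlongrightarrow> l) (at_left t)"
  obtains b where "b < t" "\<And>x. b < x \<Longrightarrow> x < t \<Longrightarrow> \<bar>f x\<bar> \<le> \<bar>l\<bar> + 1"
proof -
  have "\<forall>\<^sub>F x in at_left t. dist (f x) l < 1"
    using assms by (auto simp: tendsto_iff)
  then obtain b where b: "b < t" "\<forall>y>b. y < t \<longrightarrow> dist (f y) l < 1"
    by (auto simp: eventually_at_left_field)
  show ?thesis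
    using b by (intro that[of b]) (auto simp: dist_real_def)
qed

text \<open>One-sided limits bound \<open>f\<close> on a punctured neighbourhood of each point, and
  the value at the point itself is a third bound; bisection turns these local bounds into a global
  one.\<close>

lemma cadlag01_bounded:
  assumes f: "f \<in> cadlag01"
  obtains B where "\<And>t. t \<in> {0..1} \<Longrightarrow> \<bar>f t\<bar> \<le> B"
proof -
  define P where "P a b \<longleftrightarrow> (\<exists>B. \<forall>t\<in>{0..1}. a \<le> t \<and> t \<le> b \<longrightarrow> \<bar>f t\<bar> \<le> B)" for a b
  have "(0::real) \<le> 1" by simp
  then have "P 0 1"
  proof (induction rule: Bolzano)
    case (trans a b c)
    then obtain B C where BC: "\<forall>t\<in>{0..1}. a \<le> t \<and> t \<le> b \<longrightarrow> \<bar>f t\<bar> \<le> B"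
        "\<forall>t\<in>{0..1}. b \<le> t \<and> t \<le> c \<longrightarrow> \<bar>f t\<bar> \<le> C"
      unfolding P_def by blast
    have "\<bar>f t\<bar> \<le> max B C" if "t \<in> {0..1}" "a \<le> t" "t \<le> c" for t
      using BC that by (metis max.coboundedI1 max.coboundedI2 linear)
    then show ?case
      unfolding P_def by blast
  next
    case (local x)
    have "\<exists>b>x. \<exists>B. \<forall>t\<in>{0..1}. x < t \<and> t < b \<longrightarrow> \<bar>f t\<bar> \<le> B"
    proof (cases "x < 1")
      case True
      with cadlag01D(2)[OF f, of x] local obtain b where
        "b > x" "\<And>t. x < t \<Longrightarrow> t < b \<Longrightarrow> \<bar>f t\<bar> \<le> \<bar>f x\<bar> + 1"
        by (metis tendsto_at_right_locally_bounded)
      then show ?thesis by blast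
    next
      case False
      then show ?thesis by (intro exI[of _ "x + 1"]) auto
    qed
    then obtain b B where b: "b > x" "\<And>t. t \<in> {0..1} \<Longrightarrow> x < t \<Longrightarrow> t < b \<Longrightarrow> \<bar>f t\<bar> \<le> B"
      by blast
    have "\<exists>a<x. \<exists>B. \<forall>t\<in>{0..1}. a < t \<and> t < x \<longrightarrow> \<bar>f t\<bar> \<le> B"
    proof (cases "0 < x")
      case True
      with cadlag01D(3)[OF f, of x] local obtain l where "(f \<longlongrightarrow> l) (at_left x)"
        by auto
      then obtain a where "a < x" "\<And>t. a < t \<Longrightarrow> t < x \<Longrightarrow> \<bar>f t\<bar> \<le> \<bar>l\<bar> + 1"
        by (metis tendsto_at_left_locally_bounded)
      then show ?thesis by blast
    next
      case False
      then show ?thesis by (intro exI[of _ "x - 1"]) auto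
    qed
    then obtain a A where a: "a < x" "\<And>t. t \<in> {0..1} \<Longrightarrow> a < t \<Longrightarrow> t < x \<Longrightarrow> \<bar>f t\<bar> \<le> A"
      by blast
    define d where "d = min (x - a) (b - x)"
    have "P u v" if "u \<le> x" "x \<le> v" "v - u < d" for u v
      unfolding P_def
    proof (intro exI ballI impI)
      fix t :: real assume "t \<in> {0..1}" "u \<le> t \<and> t \<le> v"
      with that have t: "t \<in> {0..1}" "a < t" "t < b"
        by (auto simp: d_def min_def split: if_splits)
      then show "\<bar>f t\<bar> \<le> max (max A B) \<bar>f x\<bar>"
        using a(2)[OF t(1)] b(2)[OF t(1)] by (cases t x rule: linorder_cases) auto
    qed
    moreover have "d > 0" using a b by (simp add: d_def)
    ultimately show ?case
      by (intro exI[of _ d]) auto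
  qed
  then show ?thesis
    using that unfolding P_def by (metis atLeastAtMost_iff)
qed

section \<open>Time changes and neighbourhoods in the Skorokhod distance\<close>

lemma time_changesD:
  assumes "\<tau> \<in> time_changes"
  shows "strict_mono_on {0..1} \<tau>" "\<tau> ` {0..1} = {0..1}" "bij_betw \<tau> {0..1} {0..1}"
    "\<And>t. t \<in> {0..1} \<Longrightarrow> \<tau> t \<in> {0..1}"
  using assms by (auto simp: time_changes_def bij_betw_def dest: strict_mono_on_imp_inj_on)

lemma id_time_change: "(\<lambda>t. t) \<in> time_changes"
  by (auto simp: time_changes_def strict_mono_on_def)

lemma time_changes_comp:
  assumes "\<sigma> \<in> time_changes" "\<tau> \<in> time_changes"
  shows "\<sigma> \<circ> \<tau> \<in> time_changes"
proof -
  have "(\<sigma> \<circ> \<tau>) ` {0..1} = {0..1}"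
    using assms by (simp only: image_comp[symmetric] time_changesD)
  moreover have "strict_mono_on {0..1} (\<sigma> \<circ> \<tau>)"
    by (intro strict_mono_onI)
      (simp add: strict_mono_onD[OF time_changesD(1)] time_changesD(4) assms del: atLeastAtMost_iff)
  ultimately show ?thesis by (simp add: time_changes_def)
qed

lemma time_changes_inv:
  assumes \<tau>: "\<tau> \<in> time_changes"
  shows "inv_into {0..1} \<tau> \<in> time_changes"
proof -
  note D = time_changesD[OF \<tau>]
  have b: "bij_betw (inv_into {0..1} \<tau>) {0..1} {0..1}"
    by (rule bij_betw_inv_into[OF D(3)])
  have "inv_into {0..1} \<tau> s < inv_into {0..1} \<tau> t" if "s \<in> {0..1}" "t \<in> {0..1}" "s < t" for s t
  proof (rule ccontr)
    assume "\<not> inv_into {0..1} \<tau> s < inv_into {0..1} \<tau> t"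
    then have "\<tau> (inv_into {0..1} \<tau> t) \<le> \<tau> (inv_into {0..1} \<tau> s)"
      using that b by (intro strict_mono_on_leD[OF D(1)]) (auto dest: bij_betwE)
    then show False
      using that bij_betw_inv_into_right[OF D(3)] by auto
  qed
  then show ?thesis
    using b by (auto simp: time_changes_def strict_mono_on_def bij_betw_def)
qed

text \<open>Boundedness of cadlag functions makes both suprema genuine least upper bounds. From here
  on the distance is handled through a time change and a uniform bound \<open>q < r\<close>, never
  through the infimum itself.\<close>

lemma skorokhod_dist_less_iff:
  assumes f: "f \<in> cadlag01" and g: "g \<in> cadlag01"
  shows "skorokhod_dist f g < r \<longleftrightarrow>
    (\<exists>\<tau>\<in>time_changes. \<exists>q<r. \<forall>t\<in>{0..1}. \<bar>\<tau> t - t\<bar> \<le> q \<and> \<bar>f t - g (\<tau> t)\<bar> \<le> q)"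
proof -
  define D where "D \<tau> = max (SUP t\<in>{0..1}. \<bar>\<tau> t - t\<bar>) (SUP t\<in>{0..1}. \<bar>f t - g (\<tau> t)\<bar>)"
    for \<tau> :: "real \<Rightarrow> real"
  obtain A B where AB: "\<And>t. t \<in> {0..1} \<Longrightarrow> \<bar>f t\<bar> \<le> A" "\<And>t. t \<in> {0..1} \<Longrightarrow> \<bar>g t\<bar> \<le> B"
    using cadlag01_bounded f g by metis
  have le: "\<bar>\<tau> t - t\<bar> \<le> D \<tau>" "\<bar>f t - g (\<tau> t)\<bar> \<le> D \<tau>" if \<tau>: "\<tau> \<in> time_changes" and t: "t \<in> {0..1}" for \<tau> t
  proof -
    have b: "bdd_above ((\<lambda>t. \<bar>\<tau> t - t\<bar>) ` {0..1})"
      by (rule bdd_aboveI2[of _ _ 1]) (use time_changesD(4)[OF \<tau>] in fastforce)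
    have c: "bdd_above ((\<lambda>t. \<bar>f t - g (\<tau> t)\<bar>) ` {0..1})"
      by (rule bdd_aboveI2[of _ _ "A + B"]) (use time_changesD(4)[OF \<tau>] AB in \<open>smt (verit)\<close>)
    show "\<bar>\<tau> t - t\<bar> \<le> D \<tau>"
      unfolding D_def using cSUP_upper[OF t b] by simp
    show "\<bar>f t - g (\<tau> t)\<bar> \<le> D \<tau>"
      unfolding D_def using cSUP_upper[OF t c] by simp
  qed
  have "0 \<le> D \<tau>" if "\<tau> \<in> time_changes" for \<tau>
    using le(1)[OF that, of 0] by simp
  then have "bdd_below (D ` time_changes)"
    by (rule bdd_belowI2)
  moreover have "skorokhod_dist f g = (INF \<tau>\<in>time_changes. D \<tau>)"
    by (simp add: skorokhod_dist_def D_def)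
  moreover have "time_changes \<noteq> {}" using id_time_change by blast
  ultimately have "skorokhod_dist f g < r \<longleftrightarrow> (\<exists>\<tau>\<in>time_changes. D \<tau> < r)"
    by (metis cINF_less_iff)
  also have "\<dots> \<longleftrightarrow> (\<exists>\<tau>\<in>time_changes. \<exists>q<r. \<forall>t\<in>{0..1}. \<bar>\<tau> t - t\<bar> \<le> q \<and> \<bar>f t - g (\<tau> t)\<bar> \<le> q)"
  proof (intro bex_cong refl iffI)
    fix \<tau> assume "\<tau> \<in> time_changes" "D \<tau> < r"
    then show "\<exists>q<r. \<forall>t\<in>{0..1}. \<bar>\<tau> t - t\<bar> \<le> q \<and> \<bar>f t - g (\<tau> t)\<bar> \<le> q"
      using le by (intro exI[of _ "D \<tau>"]) auto
  next
    fix \<tau> assume "\<exists>q<r. \<forall>t\<in>{0..1}. \<bar>\<tau> t - t\<bar> \<le> q \<and> \<bar>f t - g (\<tau> t)\<bar> \<le> q"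
    then obtain q where "q < r" "\<forall>t\<in>{0..1}. \<bar>\<tau> t - t\<bar> \<le> q \<and> \<bar>f t - g (\<tau> t)\<bar> \<le> q" by blast
    then have "D \<tau> \<le> q"
      unfolding D_def by (intro max.boundedI cSUP_least) auto
    with \<open>q < r\<close> show "D \<tau> < r" by simp
  qed
  finally show ?thesis .
qed

text \<open>The inverse time change exchanges the roles of the two functions. Symmetry and the
  triangle inequality serve to compare open balls, so strict bounds take the place of statements
  about infima.\<close>

lemma skorokhod_dist_commute_less:
  assumes f: "f \<in> cadlag01" and g: "g \<in> cadlag01" and "skorokhod_dist f g < r"
  shows "skorokhod_dist g f < r"
proof -
  obtain \<tau> q where \<tau>: "\<tau> \<in> time_changes" and q: "q < r"
    "\<And>t. t \<in> {0..1} \<Longrightarrow> \<bar>\<tau> t - t\<bar> \<le> q \<and> \<bar>f t - g (\<tau> t)\<bar> \<le> q"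
    using assms by (auto simp: skorokhod_dist_less_iff)
  let ?s = "inv_into {0..1} \<tau>"
  have "\<bar>?s t - t\<bar> \<le> q \<and> \<bar>g t - f (?s t)\<bar> \<le> q" if "t \<in> {0..1}" for t
    using q(2)[of "?s t"] that time_changesD(4)[OF time_changes_inv[OF \<tau>] that]
      bij_betw_inv_into_right[OF time_changesD(3)[OF \<tau>] that] by (auto simp: abs_minus_commute)
  then show ?thesis
    unfolding skorokhod_dist_less_iff[OF g f] using time_changes_inv[OF \<tau>] q(1) by blast
qed

lemma skorokhod_dist_triangle_less:
  assumes f: "f \<in> cadlag01" and g: "g \<in> cadlag01" and h: "h \<in> cadlag01"
    and "skorokhod_dist f g < r" "skorokhod_dist g h < s"
  shows "skorokhod_dist f h < r + s"
proof -
  obtain \<tau> q where \<tau>: "\<tau> \<in> time_changes" and q: "q < r"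
    "\<And>t. t \<in> {0..1} \<Longrightarrow> \<bar>\<tau> t - t\<bar> \<le> q \<and> \<bar>f t - g (\<tau> t)\<bar> \<le> q"
    using assms by (auto simp: skorokhod_dist_less_iff)
  obtain \<sigma> p where \<sigma>: "\<sigma> \<in> time_changes" and p: "p < s"
    "\<And>t. t \<in> {0..1} \<Longrightarrow> \<bar>\<sigma> t - t\<bar> \<le> p \<and> \<bar>g t - h (\<sigma> t)\<bar> \<le> p"
    using assms by (auto simp: skorokhod_dist_less_iff)
  have "\<bar>(\<sigma> \<circ> \<tau>) t - t\<bar> \<le> q + p \<and> \<bar>f t - h ((\<sigma> \<circ> \<tau>) t)\<bar> \<le> q + p" if "t \<in> {0..1}" for t
    using q(2)[OF that] p(2)[OF time_changesD(4)[OF \<tau> that]] by auto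
  moreover have "q + p < r + s" using p q by simp
  ultimately show ?thesis
    unfolding skorokhod_dist_less_iff[OF f h]
    by (intro bexI[OF _ time_changes_comp[OF \<sigma> \<tau>]] exI[of _ "q + p"] conjI ballI) blast+
qed

text \<open>Neighbourhoods of this form replace \<open>{f. f \<le> up}\<close>, for which measurability would require
  measurability of the evaluation maps.\<close>

lemma skorokhod_open_between:
  fixes lo up :: "real \<Rightarrow> real"
  defines "G \<equiv> {f \<in> cadlag01. \<exists>r>0. \<forall>t\<in>{0..1}. \<forall>s\<in>{0..1}. \<bar>s - t\<bar> < r \<longrightarrow>
    lo s + r \<le> f t \<and> f t \<le> up s - r}"
  shows "skorokhod_open G"
  unfolding skorokhod_open_def
proof (intro conjI ballI)
  show "G \<subseteq> cadlag01" by (auto simp: G_def)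
next
  fix f assume "f \<in> G"
  then obtain r where f: "f \<in> cadlag01" and r: "r > 0"
    "\<And>t s. t \<in> {0..1} \<Longrightarrow> s \<in> {0..1} \<Longrightarrow> \<bar>s - t\<bar> < r \<Longrightarrow> lo s + r \<le> f t \<and> f t \<le> up s - r"
    unfolding G_def by blast
  \<comment> \<open>Half of the slack of \<open>f\<close> pays for the time change and for the
    change of values; the other half is the slack left to \<open>g\<close>.\<close>
  have "g \<in> G" if g: "g \<in> cadlag01" and d: "skorokhod_dist f g < r / 2" for g
  proof -
    obtain \<tau> q where \<tau>: "\<tau> \<in> time_changes" and q: "q < r / 2"
      "\<And>t. t \<in> {0..1} \<Longrightarrow> \<bar>\<tau> t - t\<bar> \<le> q \<and> \<bar>f t - g (\<tau> t)\<bar> \<le> q"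
      using d unfolding skorokhod_dist_less_iff[OF f g] by blast
    have "lo s + r / 2 \<le> g u \<and> g u \<le> up s - r / 2"
      if u: "u \<in> {0..1}" and s: "s \<in> {0..1}" and su: "\<bar>s - u\<bar> < r / 2" for u s
    proof -
      obtain t where t: "t \<in> {0..1}" "u = \<tau> t"
        using u time_changesD(2)[OF \<tau>] by blast
      have le: "\<bar>\<tau> t - t\<bar> \<le> q" "\<bar>f t - g (\<tau> t)\<bar> \<le> q"
        using q(2)[OF t(1)] by auto
      then have "\<bar>s - t\<bar> < r"
        using su q(1) t(2) by linarith
      then have "lo s + r \<le> f t" "f t \<le> up s - r"
        using r(2)[OF t(1) s] by auto
      then show ?thesis
        using le q(1) t(2) by auto
    qed
    then show ?thesis
      using g r(1) unfolding G_def by (intro CollectI conjI exI[of _ "r / 2"]) auto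
  qed
  then show "\<exists>r>0. \<forall>g\<in>cadlag01. skorokhod_dist f g < r \<longrightarrow> g \<in> G"
    using r(1) by (intro exI[of _ "r / 2"]) auto
qed

text \<open>The nodes \<open>(a i, b i)\<close> are joined by line segments, one more in each
  induction step. On a segment the deviation from the identity is a convex combination of the
  deviations at its two ends, which are at most \<open>q\<close>.\<close>

lemma linear_interpolation_time_change:
  fixes a b :: "nat \<Rightarrow> real"
  assumes a: "a 0 = 0" "\<And>i. i < m \<Longrightarrow> a i < a (Suc i)"
    and b: "b 0 = 0" "\<And>i. i < m \<Longrightarrow> b i < b (Suc i)"
    and q: "\<And>i. i \<le> m \<Longrightarrow> \<bar>a i - b i\<bar> \<le> q"
  shows "\<exists>\<tau>. strict_mono_on {0..a m} \<tau> \<and> \<tau> ` {0..a m} = {0..b m} \<and> (\<forall>i\<le>m. \<tau> (a i) = b i) \<and>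
    (\<forall>t\<in>{0..a m}. \<bar>\<tau> t - t\<bar> \<le> q)"
  using a(2) b(2) q
proof (induction m)
  case 0
  then show ?case using a(1) b(1)
    by (intro exI[of _ "\<lambda>t. t"]) (auto simp: strict_mono_on_def)
next
  case (Suc m)
  have "\<exists>\<tau>. strict_mono_on {0..a m} \<tau> \<and> \<tau> ` {0..a m} = {0..b m} \<and> (\<forall>i\<le>m. \<tau> (a i) = b i) \<and>
      (\<forall>t\<in>{0..a m}. \<bar>\<tau> t - t\<bar> \<le> q)"
    using Suc.prems by (intro Suc.IH) auto
  then obtain \<tau> where \<tau>: "strict_mono_on {0..a m} \<tau>" "\<tau> ` {0..a m} = {0..b m}"
    "\<And>i. i \<le> m \<Longrightarrow> \<tau> (a i) = b i" "\<And>t. t \<in> {0..a m} \<Longrightarrow> \<bar>\<tau> t - t\<bar> \<le> q"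
    by blast
  have am: "a m < a (Suc m)" "b m < b (Suc m)" using Suc by auto
  have "i \<le> j \<Longrightarrow> j \<le> m \<Longrightarrow> a i \<le> a j" for i j
  proof (induction j rule: dec_induct)
    case (step k)
    then show ?case using Suc.prems(1)[of k] by simp
  qed simp
  then have ai: "a i \<le> a m" if "i \<le> m" for i
    using that by blast
  define L where "L t = b m + (t - a m) * ((b (Suc m) - b m) / (a (Suc m) - a m))" for t
  define \<sigma> where "\<sigma> t = (if t \<le> a m then \<tau> t else L t)" for t
  define k where "k = (b (Suc m) - b m) / (a (Suc m) - a m)"
  have k: "k > 0" using am by (simp add: k_def)
  have L: "L t = b m + (t - a m) * k" for t by (simp add: L_def k_def)
  have Lm: "L (a m) = b m" and LS: "L (a (Suc m)) = b (Suc m)"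
    using am by (auto simp: L_def)
  have a0: "0 \<le> a m" using ai[of 0] a(1) by simp
  have \<tau>m: "\<tau> (a m) = b m" using \<tau>(3) by simp
  have b0: "0 \<le> b m" using \<tau>(2) a0 \<tau>m by (metis atLeastAtMost_iff image_eqI order_refl)
  have \<tau>le: "\<tau> s \<le> b m" if "0 \<le> s" "s \<le> a m" for s
    using \<tau>(2) that by (metis atLeastAtMost_iff image_eqI)
  have mono: "strict_mono_on {0..a (Suc m)} \<sigma>"
  proof (rule strict_mono_onI)
    fix s t assume st: "s \<in> {0..a (Suc m)}" "t \<in> {0..a (Suc m)}" "s < t"
    consider "t \<le> a m" | "s \<le> a m" "a m < t" | "a m < s" using st by linarith
    then show "\<sigma> s < \<sigma> t"
    proof cases
      case 1
      then show ?thesis using st strict_mono_onD[OF \<tau>(1), of s t] by (auto simp: \<sigma>_def)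
    next
      case 2
      then have "b m < L t" using k by (simp add: L)
      with 2 show ?thesis using \<tau>le[of s] st by (auto simp: \<sigma>_def)
    next
      case 3
      then show ?thesis using st k by (auto simp: \<sigma>_def L)
    qed
  qed
  have img: "\<sigma> ` {0..a (Suc m)} = {0..b (Suc m)}"
  proof -
    have "\<sigma> ` {0..a m} = {0..b m}" using \<tau>(2) by (auto simp: \<sigma>_def image_iff)
    moreover have "\<sigma> ` {a m..a (Suc m)} = {b m..b (Suc m)}"
    proof -
      have "\<sigma> ` {a m..a (Suc m)} = L ` {a m..a (Suc m)}"
        using Lm \<tau>m by (intro image_cong) (auto simp: \<sigma>_def)
      also have "L ` {a m..a (Suc m)} = {b m..b (Suc m)}"
      proof (intro equalityI subsetI)
        fix y assume "y \<in> L ` {a m..a (Suc m)}"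
        then obtain t where t: "a m \<le> t" "t \<le> a (Suc m)" "y = L t" by auto
        have "(t - a m) * k \<le> (a (Suc m) - a m) * k" "0 \<le> (t - a m) * k"
            using t k by simp_all
          then show "y \<in> {b m..b (Suc m)}"
            using t(3) LS unfolding L atLeastAtMost_iff by linarith
      next
        fix y assume y: "y \<in> {b m..b (Suc m)}"
        have kk: "(a (Suc m) - a m) * k = b (Suc m) - b m" using LS by (simp add: L)
        then have "(y - b m) / k \<le> a (Suc m) - a m" using k y by (simp add: divide_le_eq)
        then have "y = L (a m + (y - b m) / k)" "a m + (y - b m) / k \<in> {a m..a (Suc m)}"
          using k y by (auto simp: L)
        then show "y \<in> L ` {a m..a (Suc m)}" by blast
      qed
      finally show ?thesis .
    qed
    ultimately have "\<sigma> ` ({0..a m} \<union> {a m..a (Suc m)}) = {0..b m} \<union> {b m..b (Suc m)}"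
      by (simp add: image_Un)
    then show ?thesis
      using am a0 b0 by (simp add: ivl_disj_un_two_touch)
  qed
  have val: "\<sigma> (a i) = b i" if "i \<le> Suc m" for i
    using that ai \<tau>(3) am LS by (auto simp: \<sigma>_def le_Suc_eq)
  have close: "\<bar>\<sigma> t - t\<bar> \<le> q" if t: "t \<in> {0..a (Suc m)}" for t
  proof (cases "t \<le> a m")
    case True
    then show ?thesis using \<tau>(4) t by (auto simp: \<sigma>_def)
  next
    case False
    define x where "x = (t - a m) / (a (Suc m) - a m)"
    have x: "0 \<le> x" "x \<le> 1" using False t am by (auto simp: x_def)
    have tx: "t - a m = x * (a (Suc m) - a m)" using am by (simp add: x_def)
    have "L t - t = (b m - a m) + x * ((b (Suc m) - b m) - (a (Suc m) - a m))"
      using tx am by (simp add: L_def) (simp add: algebra_simps)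
    then have "L t - t = (1 - x) * (b m - a m) + x * (b (Suc m) - a (Suc m))"
      by (simp add: algebra_simps)
    moreover have "\<bar>(1 - x) * (b m - a m)\<bar> \<le> (1 - x) * q"
      using x Suc.prems(3)[of m] by (simp add: abs_mult abs_minus_commute mult_left_mono)
    moreover have "\<bar>x * (b (Suc m) - a (Suc m))\<bar> \<le> x * q"
      using x Suc.prems(3)[of "Suc m"] by (simp add: abs_mult abs_minus_commute mult_left_mono)
    ultimately have "\<bar>L t - t\<bar> \<le> (1 - x) * q + x * q" by linarith
    then show ?thesis using False by (simp add: \<sigma>_def algebra_simps)
  qed
  show ?case
    using mono img val close by blast
qed

text \<open>This is the first grid point strictly to the right of \<open>t\<close>. Adding one to
  the floor, instead of rounding up, keeps the sequence off \<open>t\<close> itself, as the filter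
  \<open>at_right t\<close> demands.\<close>

lemma grid_tendsto_at_right:
  fixes t :: real
  shows "filterlim (\<lambda>i. (real_of_int \<lfloor>real (Suc i) * t\<rfloor> + 1) / real (Suc i)) (at_right t) sequentially"
proof -
  define s where "s i = (real_of_int \<lfloor>real (Suc i) * t\<rfloor> + 1) / real (Suc i)" for i
  have s: "t < s i" "s i \<le> t + 1 / real (Suc i)" for i
  proof -
    have "real (Suc i) * t < real_of_int \<lfloor>real (Suc i) * t\<rfloor> + 1"
      "real_of_int \<lfloor>real (Suc i) * t\<rfloor> \<le> real (Suc i) * t" by linarith+
    then show "t < s i" "s i \<le> t + 1 / real (Suc i)"
      by (auto simp: s_def field_simps simp del: of_nat_Suc)
  qed
  have "s \<longlonglongrightarrow> t"
  proof (rule tendsto_sandwich[of "\<lambda>_. t" _ _ "\<lambda>i. t + 1 / real (Suc i)"])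
    show "(\<lambda>i. t + 1 / real (Suc i)) \<longlonglongrightarrow> t"
      using tendsto_add[OF tendsto_const LIMSEQ_inverse_real_of_nat, of t] by (simp add: inverse_eq_divide)
  qed (use s in \<open>auto intro!: always_eventually less_imp_le\<close>)
  then have "filterlim s (at_right t) sequentially"
    using s(1) by (auto simp: filterlim_at less_imp_neq[symmetric] intro!: always_eventually)
  then show ?thesis unfolding s_def[abs_def] .
qed

text \<open>Evaluating \<open>f\<close> at the next grid point to the right gives functions of an
  integer-valued floor, hence measurable ones, and right continuity makes them converge
  pointwise.\<close>

lemma right_continuous_borel_measurable:
  fixes f :: "real \<Rightarrow> real"
  assumes "\<And>t. (f \<longlongrightarrow> f t) (at_right t)"
  shows "f \<in> borel_measurable borel"
proof (rule borel_measurable_LIMSEQ_real)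
  fix t
  show "(\<lambda>i. f ((real_of_int \<lfloor>real (Suc i) * t\<rfloor> + 1) / real (Suc i))) \<longlonglongrightarrow> f t"
    by (rule filterlim_compose[OF assms grid_tendsto_at_right])
next
  fix i
  have "(\<lambda>t. \<lfloor>real (Suc i) * t\<rfloor>) \<in> measurable borel (count_space UNIV)"
    by measurable
  then show "(\<lambda>t. f ((real_of_int \<lfloor>real (Suc i) * t\<rfloor> + 1) / real (Suc i))) \<in> borel_measurable borel"
    by (rule measurable_compose) simp
qed

text \<open>Elements of D[0,1] are undefined outside the interval, and the function classes say
  nothing about \<open>f0\<close> there. Composition with this retraction extends a function to the
  line by its boundary values, so that Borel measurability on the line makes sense.\<close>

definition clamp01 :: "real \<Rightarrow> real" where
  "clamp01 x = max 0 (min 1 x)"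

lemma clamp01_simps [simp]: "0 \<le> clamp01 x" "clamp01 x \<le> 1" "0 \<le> x \<Longrightarrow> x \<le> 1 \<Longrightarrow> clamp01 x = x"
  by (auto simp: clamp01_def)

lemma cadlag01_clamp01_measurable:
  assumes f: "f \<in> cadlag01"
  shows "(\<lambda>x. f (clamp01 x)) \<in> borel_measurable borel"
proof (rule right_continuous_borel_measurable)
  fix t :: real
  consider "t < 0" | "0 \<le> t" "t < 1" | "1 \<le> t" by linarith
  then show "((\<lambda>x. f (clamp01 x)) \<longlongrightarrow> f (clamp01 t)) (at_right t)"
  proof cases
    case 1
    then have "\<forall>\<^sub>F x in at_right t. f (clamp01 x) = f (clamp01 t)"
      by (auto simp: eventually_at_right_field clamp01_def intro!: exI[of _ 0])
    then show ?thesis by (rule tendsto_eventually)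
  next
    case 2
    then have "\<forall>\<^sub>F x in at_right t. f x = f (clamp01 x)"
      by (auto simp: eventually_at_right_field intro!: exI[of _ 1])
    from tendsto_cong[OF this] cadlag01D(2)[OF f 2] show ?thesis
      using 2 by simp
  next
    case 3
    then have "\<forall>\<^sub>F x in at_right t. f (clamp01 x) = f (clamp01 t)"
      by (auto simp: eventually_at_right_field clamp01_def intro!: exI[of _ "t + 1"])
    then show ?thesis by (rule tendsto_eventually)
  qed
qed

section \<open>Measurability of compound Poisson paths\<close>

text \<open>Right continuity of a counting function means local constancy to the right. To the left
  of \<open>t\<close> it is bounded by \<open>m t\<close>, so it attains its largest value there at
  some \<open>s < t\<close> and is constant from \<open>s\<close> to \<open>t\<close>; applying
  \<open>\<phi>\<close> preserves both.\<close>

lemma cadlag01_step: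
  fixes m :: "real \<Rightarrow> nat" and \<phi> :: "nat \<Rightarrow> real"
  assumes mono: "mono_on {0..} m"
    and right: "\<And>t. 0 \<le> t \<Longrightarrow> (m \<longlongrightarrow> m t) (at_right t)"
  shows "(\<lambda>t\<in>{0..1}. \<phi> (m t)) \<in> cadlag01"
proof -
  let ?f = "\<lambda>t\<in>{0..1}. \<phi> (m t)"
  have 1: "(?f \<longlongrightarrow> ?f t) (at_right t)" if "t \<in> {0..<1}" for t :: real
  proof -
    have "\<forall>\<^sub>F s in at_right t. m s = m t"
      using right[of t] that by (auto simp: tendsto_discrete)
    moreover have "\<forall>\<^sub>F s in at_right t. t < s \<and> s < 1"
      using that by (auto simp: eventually_at_right_field)
    ultimately have "\<forall>\<^sub>F s in at_right t. ?f s = ?f t"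
      by eventually_elim (use that in auto)
    then show ?thesis by (rule tendsto_eventually)
  qed
  have 2: "\<exists>l. (?f \<longlongrightarrow> l) (at_left t)" if "t \<in> {0<..1}" for t :: real
  proof -
    have mt: "m u < Suc (m t)" if "0 \<le> u" "u < t" for u
      using mono_onD[OF mono, of u t] that by simp
    have "\<exists>s. (0 \<le> s \<and> s < t) \<and> (\<forall>u. 0 \<le> u \<and> u < t \<longrightarrow> m u \<le> m s)"
      by (rule ex_has_greatest_nat[of _ 0 _ "Suc (m t)"])
        (use that mt in auto)
    then obtain s where s: "0 \<le> s" "s < t" "\<And>u. 0 \<le> u \<Longrightarrow> u < t \<Longrightarrow> m u \<le> m s"
      by blast
    have "m u = m s" if "s < u" "u < t" for u
      using that s(1) s(3)[of u] mono_onD[OF mono, of s u] by simp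
    then have "\<forall>\<^sub>F u in at_left t. ?f u = \<phi> (m s)"
      using s that by (auto simp: eventually_at_left_field intro!: exI[of _ s])
    then show ?thesis by (blast intro: tendsto_eventually)
  qed
  show ?thesis using 1 2 by (simp add: cadlag01_def)
qed

text \<open>The nodes are 0, 1 and the jump times in (0,1]. The counting function is injective on
  the jump times, with values at most \<open>N 1\<close>, so there are finitely many of
  them.\<close>

lemma step_function_grid_constant:
  fixes N :: "real \<Rightarrow> nat"
  assumes mono: "mono_on {0..} N"
    and right: "\<And>t. 0 \<le> t \<Longrightarrow> (N \<longlongrightarrow> N t) (at_right t)"
  obtains a :: "nat \<Rightarrow> real" and m where "a 0 = 0" "a m = 1" "\<And>i. i < m \<Longrightarrow> a i < a (Suc i)"
    "\<And>i u. i < m \<Longrightarrow> a i \<le> u \<Longrightarrow> u < a (Suc i) \<Longrightarrow> N u = N (a i)"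
proof -
  define A where "A = {T. 0 < T \<and> T \<le> 1 \<and> (\<forall>s. 0 \<le> s \<and> s < T \<longrightarrow> N s < N T)}"
  have "inj_on N A"
  proof (rule linorder_inj_onI')
    fix i j assume "i \<in> A" "j \<in> A" "i < j"
    then have "N i < N j" by (auto simp: A_def)
    then show "N i \<noteq> N j" by simp
  qed
  moreover have "N ` A \<subseteq> {..N 1}"
    by (auto simp: A_def intro!: mono_onD[OF mono])
  ultimately have fin: "finite A"
    by (meson finite_atMost inj_on_finite)
  define as where "as = sorted_list_of_set (insert 0 (insert 1 A))"
  define m where "m = length as - 1"
  have set: "set as = insert 0 (insert 1 A)" and sorted: "sorted_wrt (<) as"
    using fin unfolding as_def by (simp_all only: set_sorted_list_of_set strict_sorted_list_of_set finite_insert)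
  have len: "length as = Suc m"
    using set by (cases as) (auto simp: m_def)
  have lt: "as ! i < as ! j" if "i < j" "j \<le> m" for i j
    using sorted_wrt_nth_less[OF sorted, of i j] that len by simp
  have le: "as ! i \<le> as ! j" if "i \<le> j" "j \<le> m" for i j
    using lt[of i j] that by (cases "i = j") auto
  have ex: "\<exists>i\<le>m. as ! i = x" if "x \<in> set as" for x
    using that len by (auto simp: in_set_conv_nth less_Suc_eq_le)
  have "as ! 0 \<in> set as" "as ! m \<in> set as"
    using len by (auto intro!: nth_mem)
  then have b: "0 \<le> as ! 0" "as ! m \<le> 1"
    using set by (auto simp: A_def)
  have 0: "as ! 0 = 0" using ex[of 0] set b le[of 0] by force
  have 1: "as ! m = 1" using ex[of 1] set b le[of _ m] by force
  have const: "N u = N (as ! i)" if i: "i < m" and u: "as ! i \<le> u" "u < as ! Suc i" for i u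
  proof -
    have ge0: "0 \<le> as ! i" "0 \<le> u" using le[of 0 i] i 0 u by auto
    have u1: "u \<le> 1" using le[of "Suc i" m] i 1 u by auto
    \<comment> \<open>\<open>T\<close> is the first time at which the value \<open>N u\<close> is
      taken. Right continuity shows that the infimum is attained, so \<open>T\<close> is 0 or a jump
      time, in either case a node, and the node \<open>as ! i\<close> lies between \<open>T\<close>
      and \<open>u\<close>.\<close>
    define T where "T = Inf {s. 0 \<le> s \<and> N s = N u}"
    have bdd: "bdd_below {s. 0 \<le> s \<and> N s = N u}" by (auto intro: bdd_belowI)
    have Tu: "T \<le> u" unfolding T_def using ge0 bdd by (intro cInf_lower) auto
    have T0: "0 \<le> T" unfolding T_def using ge0 by (intro cInf_greatest) auto
    have "\<forall>\<^sub>F s in at_right T. N s = N T"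
      using right[OF T0] by (auto simp: tendsto_discrete)
    then obtain b where b: "b > T" "\<And>s. T < s \<Longrightarrow> s < b \<Longrightarrow> N s = N T"
      by (auto simp: eventually_at_right_field)
    have "\<exists>s\<in>{s. 0 \<le> s \<and> N s = N u}. s < b"
      using b(1) ge0 bdd unfolding T_def by (subst (asm) cInf_less_iff) auto
    then obtain s where s: "0 \<le> s" "N s = N u" "s < b" by blast
    have "T \<le> s" unfolding T_def using s bdd by (intro cInf_lower) auto
    with s b have NT: "N T = N u" by (cases "T = s") auto
    have below: "N v < N T" if "0 \<le> v" "v < T" for v
    proof -
      have "N v \<noteq> N u"
        using that bdd cInf_lower[of v "{s. 0 \<le> s \<and> N s = N u}"] by (auto simp: T_def)
      moreover have "N v \<le> N T" using mono_onD[OF mono, of v T] that by simp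
      ultimately show ?thesis using NT by simp
    qed
    have "T \<in> set as"
      using set T0 below Tu u1 by (cases "T = 0") (auto simp: A_def)
    then obtain k where k: "k \<le> m" "as ! k = T" using ex by blast
    have "k \<le> i"
      using k u Tu le[of "Suc i" k] i by (cases "k \<le> i") auto
    then have "T \<le> as ! i" using le[of k i] k i by simp
    then have "N T \<le> N (as ! i)" "N (as ! i) \<le> N u"
      using mono_onD[OF mono, of T "as ! i"] mono_onD[OF mono, of "as ! i" u] T0 ge0 u by auto
    then show ?thesis using NT by simp
  qed
  show ?thesis
  proof (rule that[of "\<lambda>i. as ! i" m])
    show "as ! i < as ! Suc i" if "i < m" for i using lt that by simp
  qed (fact 0 1 const)+
qed

lemma real_floor_div_right_tendsto:
  fixes t :: real
  assumes "0 \<le> t"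
  shows "((\<lambda>t. nat \<lfloor>real (Suc j) * t\<rfloor>) \<longlongrightarrow> nat \<lfloor>real (Suc j) * t\<rfloor>) (at_right t)"
proof -
  let ?b = "(real_of_int \<lfloor>real (Suc j) * t\<rfloor> + 1) / real (Suc j)"
  have "real (Suc j) * t < real_of_int \<lfloor>real (Suc j) * t\<rfloor> + 1" by linarith
  then have "t < ?b" by (simp add: field_simps del: of_nat_Suc)
  moreover have "\<lfloor>real (Suc j) * s\<rfloor> = \<lfloor>real (Suc j) * t\<rfloor>" if "t < s" "s < ?b" for s
  proof (rule floor_unique)
    have "real_of_int \<lfloor>real (Suc j) * t\<rfloor> \<le> real (Suc j) * t" by linarith
    also have "\<dots> \<le> real (Suc j) * s" using that by (intro mult_left_mono) auto
    finally show "real_of_int \<lfloor>real (Suc j) * t\<rfloor> \<le> real (Suc j) * s" .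
    show "real (Suc j) * s < real_of_int \<lfloor>real (Suc j) * t\<rfloor> + 1"
      using that by (simp add: field_simps del: of_nat_Suc)
  qed
  ultimately have "\<forall>\<^sub>F s in at_right t. nat \<lfloor>real (Suc j) * s\<rfloor> = nat \<lfloor>real (Suc j) * t\<rfloor>"
    by (auto simp: eventually_at_right_field)
  then show ?thesis by (rule tendsto_eventually)
qed

text \<open>Times and values both lie on a grid of mesh \<open>1 / Suc j\<close>, and the values are
  coded by integers. On [0,1] such a path is determined by finitely many of them, so only countably
  many paths occur at each stage.\<close>

definition grid_path :: "nat \<Rightarrow> (nat \<Rightarrow> int) \<Rightarrow> real \<Rightarrow> real" where
  "grid_path j v = (\<lambda>t\<in>{0..1}. real_of_int (v (nat \<lfloor>real (Suc j) * t\<rfloor>)) / real (Suc j))"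

lemma grid_path_cadlag01: "grid_path j v \<in> cadlag01"
  unfolding grid_path_def
  by (rule cadlag01_step[where \<phi> = "\<lambda>k. real_of_int (v k) / real (Suc j)"])
    (auto intro!: mono_onI nat_mono floor_mono mult_left_mono real_floor_div_right_tendsto simp del: of_nat_Suc)

text \<open>Sampling at the left end of each grid cell delays every jump to the next grid point. A
  piecewise linear time change undoing these delays moves each time by at most the mesh, and
  rounding the values down changes them by at most the mesh as well.\<close>

lemma skorokhod_dist_grid_path_tendsto:
  fixes N :: "real \<Rightarrow> nat" and \<phi> :: "nat \<Rightarrow> real"
  assumes mono: "mono_on {0..} N"
    and right: "\<And>t. 0 \<le> t \<Longrightarrow> (N \<longlongrightarrow> N t) (at_right t)"
    and e: "e > 0"
  shows "\<forall>\<^sub>F j in sequentially.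
    skorokhod_dist (grid_path j (\<lambda>k. \<lfloor>real (Suc j) * \<phi> (N (real k / real (Suc j)))\<rfloor>)) (\<lambda>t\<in>{0..1}. \<phi> (N t)) < e"
proof -
  obtain a m where a: "a 0 = 0" "a m = 1" "\<And>i. i < m \<Longrightarrow> a i < a (Suc i)"
    and const: "\<And>i u. i < m \<Longrightarrow> a i \<le> u \<Longrightarrow> u < a (Suc i) \<Longrightarrow> N u = N (a i)"
    using step_function_grid_constant[OF mono right] by metis
  have inf: "filterlim (\<lambda>j. real (Suc j)) at_top sequentially"
    by (intro filterlim_compose[OF filterlim_real_sequentially filterlim_Suc])
  \<comment> \<open>A mesh no larger than the smallest gap between nodes keeps the rounded nodes
    strictly increasing.\<close>
  have ev1: "\<forall>\<^sub>F j in sequentially. \<forall>i\<in>{..<m}. 1 / (a (Suc i) - a i) \<le> real (Suc j)"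
    using inf by (intro eventually_ball_finite) (auto simp: filterlim_at_top)
  have ev2: "\<forall>\<^sub>F j in sequentially. 1 / e < real (Suc j)"
    using inf by (auto simp: filterlim_at_top_dense)
  from ev1 ev2 show ?thesis
  proof eventually_elim
    case (elim j)
    define r where "r = real (Suc j)"
    have r: "r > 0" by (simp add: r_def)
    define b where "b i = real_of_int \<lceil>r * a i\<rceil> / r" for i
    have rb: "r * b i = real_of_int \<lceil>r * a i\<rceil>" for i using r by (simp add: b_def)
    have ab: "a i \<le> b i" "b i < a i + 1 / r" for i
    proof -
      have "r * a i \<le> r * b i" "r * b i < r * a i + 1" unfolding rb by linarith+
      then show "a i \<le> b i" "b i < a i + 1 / r" using r by (auto simp: field_simps)
    qed
    have gap: "1 / r \<le> a (Suc i) - a i" if "i < m" for i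
    proof -
      have "1 / (a (Suc i) - a i) \<le> r" using elim that by (simp add: r_def)
      then show ?thesis using a(3)[OF that] r by (simp add: field_simps)
    qed
    have b01: "b 0 = 0" "b m = 1"
    proof -
      show "b 0 = 0" by (simp add: b_def a(1))
      have "\<lceil>r\<rceil> = int (Suc j)" unfolding r_def by (rule ceiling_of_nat)
      then show "b m = 1" using r by (simp add: b_def a(2) r_def del: of_nat_Suc)
    qed
    have bS: "b i < b (Suc i)" if "i < m" for i
      using ab[of i] ab[of "Suc i"] gap[OF that] by linarith
    have "\<bar>b i - a i\<bar> \<le> 1 / r" for i using ab[of i] by linarith
    then obtain \<tau> where \<tau>: "strict_mono_on {0..b m} \<tau>" "\<tau> ` {0..b m} = {0..a m}"
        "\<And>i. i \<le> m \<Longrightarrow> \<tau> (b i) = a i" "\<And>t. t \<in> {0..b m} \<Longrightarrow> \<bar>\<tau> t - t\<bar> \<le> 1 / r"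
      using linear_interpolation_time_change[of b m a "1 / r"] b01 bS a(1,3) by metis
    have b_mono: "0 \<le> b i \<and> b i \<le> 1" if "i \<le> m" for i
    proof -
      have "i \<le> k \<Longrightarrow> k \<le> m \<Longrightarrow> b i \<le> b k" for i k
      proof (induction k rule: dec_induct)
        case (step k)
        then show ?case using bS[of k] by simp
      qed simp
      from this[of 0 i] this[of i m] that b01 show ?thesis by simp
    qed
    have \<tau>t: "\<tau> \<in> time_changes"
      using \<tau>(1,2) a b01 by (simp add: time_changes_def)
    let ?v = "\<lambda>k. \<lfloor>r * \<phi> (N (real k / r))\<rfloor>"
    \<comment> \<open>The left grid point of \<open>t\<close> and the shifted time
      \<open>\<tau> t\<close> lie between the same two nodes, where the counting function is
      constant.\<close>
    have main: "N (real (nat \<lfloor>r * t\<rfloor>) / r) = N (\<tau> t)" if t: "t \<in> {0..1}" for t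
    proof -
      define i where "i = (GREATEST i. i \<le> m \<and> b i \<le> t)"
      have i: "i \<le> m \<and> b i \<le> t"
        unfolding i_def by (rule GreatestI_nat[where b = m and k = 0]) (use b01 t in auto)
      have fl: "real (nat \<lfloor>r * t\<rfloor>) = real_of_int \<lfloor>r * t\<rfloor>"
        using t r by simp
      show ?thesis
      proof (cases "i = m")
        case True
        then have "t = 1" using i b01 t by simp
        moreover have "\<lfloor>r\<rfloor> = int (Suc j)" unfolding r_def by (rule floor_of_nat)
        moreover have "\<tau> 1 = 1" using \<tau>(3)[of m] b01 a by simp
        ultimately show ?thesis using r by (simp add: r_def del: of_nat_Suc)
      next
        case False
        then have im: "i < m" using i by simp
        have "\<not> b (Suc i) \<le> t"
          using Greatest_le_nat[of "\<lambda>i. i \<le> m \<and> b i \<le> t" "Suc i" m] im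
          by (auto simp: i_def[symmetric])
        then have tb: "t < b (Suc i)" by simp
        have bi: "b i \<in> {0..b m}" "t \<in> {0..b m}" "b (Suc i) \<in> {0..b m}"
          using b_mono[of i] b_mono[of "Suc i"] im b01 t by auto
        have 1: "a i \<le> \<tau> t"
          using strict_mono_on_leD[OF \<tau>(1) bi(1,2)] i \<tau>(3)[of i] by simp
        have 2: "\<tau> t < a (Suc i)"
          using strict_mono_onD[OF \<tau>(1) bi(2,3) tb] im \<tau>(3)[of "Suc i"] by simp
        have "real_of_int \<lceil>r * a i\<rceil> \<le> r * t"
          using i rb[of i] r by (metis mult_le_cancel_left_pos)
        then have "\<lceil>r * a i\<rceil> \<le> \<lfloor>r * t\<rfloor>" by (simp add: le_floor_iff)
        then have "r * a i \<le> real_of_int \<lfloor>r * t\<rfloor>" by (simp add: ceiling_le_iff)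
        then have 3: "a i \<le> real_of_int \<lfloor>r * t\<rfloor> / r" using r by (simp add: field_simps)
        have "r * t < real_of_int \<lceil>r * a (Suc i)\<rceil>"
          using tb rb[of "Suc i"] r by (metis mult_less_cancel_left_pos)
        then have "\<lfloor>r * t\<rfloor> < \<lceil>r * a (Suc i)\<rceil>" by (simp add: floor_less_iff)
        then have "real_of_int \<lfloor>r * t\<rfloor> < r * a (Suc i)" by (simp add: less_ceiling_iff)
        then have 4: "real_of_int \<lfloor>r * t\<rfloor> / r < a (Suc i)" using r by (simp add: field_simps)
        show ?thesis
          unfolding fl using const[OF im 1 2] const[OF im 3 4] by simp
      qed
    qed
    have "\<bar>\<tau> t - t\<bar> \<le> 1 / r \<and> \<bar>grid_path j ?v t - (\<lambda>t\<in>{0..1}. \<phi> (N t)) (\<tau> t)\<bar> \<le> 1 / r"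
      if t: "t \<in> {0..1}" for t
    proof
      show "\<bar>\<tau> t - t\<bar> \<le> 1 / r" using \<tau>(4) t b01 by simp
      have "grid_path j ?v t = real_of_int \<lfloor>r * \<phi> (N (\<tau> t))\<rfloor> / r"
        using t main[OF t] by (simp add: grid_path_def r_def del: of_nat_Suc)
      moreover have "\<bar>real_of_int \<lfloor>r * x\<rfloor> / r - x\<bar> \<le> 1 / r" for x
      proof -
        have "real_of_int \<lfloor>r * x\<rfloor> \<le> r * x" "r * x \<le> real_of_int \<lfloor>r * x\<rfloor> + 1" by linarith+
        then have "real_of_int \<lfloor>r * x\<rfloor> / r \<le> x" "x \<le> (real_of_int \<lfloor>r * x\<rfloor> + 1) / r"
          using r by (simp_all add: pos_le_divide_eq pos_divide_le_eq mult.commute)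
        then show ?thesis by (simp add: abs_le_iff add_divide_distrib)
      qed
      ultimately show "\<bar>grid_path j ?v t - (\<lambda>t\<in>{0..1}. \<phi> (N t)) (\<tau> t)\<bar> \<le> 1 / r"
        using time_changesD(4)[OF \<tau>t t] by simp
    qed
    moreover have "1 / e < r" using elim by (simp add: r_def)
    then have "1 / r < e" using e r by (simp add: field_simps)
    ultimately have "\<exists>q<e. \<forall>t\<in>{0..1}. \<bar>\<tau> t - t\<bar> \<le> q \<and> \<bar>grid_path j ?v t - (\<lambda>t\<in>{0..1}. \<phi> (N t)) (\<tau> t)\<bar> \<le> q"
      by (intro exI[of _ "1 / r"] conjI ballI) blast+
    then have "skorokhod_dist (grid_path j ?v) (\<lambda>t\<in>{0..1}. \<phi> (N t)) < e"
      using skorokhod_dist_less_iff[OF grid_path_cadlag01 cadlag01_step[OF mono right]] \<tau>t by blast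
    then show ?case by (simp only: r_def)
  qed
qed

text \<open>Applied to approximations \<open>Y j\<close> with countably many values, for which the assumption on all
  sets \<open>U\<close> is harmless.\<close>

lemma skorokhod_measurable_limit:
  assumes X: "\<And>\<omega>. \<omega> \<in> space M \<Longrightarrow> X \<omega> \<in> cadlag01"
    and Y: "\<And>j \<omega>. \<omega> \<in> space M \<Longrightarrow> Y j \<omega> \<in> cadlag01"
    and lim: "\<And>\<omega> e. \<omega> \<in> space M \<Longrightarrow> e > 0 \<Longrightarrow>
      \<forall>\<^sub>F j in sequentially. skorokhod_dist (Y j \<omega>) (X \<omega>) < e"
    and meas: "\<And>j U. {\<omega> \<in> space M. Y j \<omega> \<in> U} \<in> sets M"
  shows "X \<in> measurable M skorokhod_borel"
proof (rule measurable_sigma_sets[where \<Omega> = cadlag01 and A = "{U. skorokhod_open U}"])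
  show "sets skorokhod_borel = sigma_sets cadlag01 {U. skorokhod_open U}"
    unfolding skorokhod_borel_def by (rule sets_measure_of) (unfold skorokhod_open_def, blast)
  show "{U. skorokhod_open U} \<subseteq> Pow cadlag01"
    unfolding skorokhod_open_def by blast
  show "X \<in> space M \<rightarrow> cadlag01" using X by blast
next
  fix U :: "(real \<Rightarrow> real) set" assume "U \<in> {U. skorokhod_open U}"
  then have U: "U \<subseteq> cadlag01"
    "\<And>f. f \<in> U \<Longrightarrow> \<exists>r>0. \<forall>g\<in>cadlag01. skorokhod_dist f g < r \<longrightarrow> g \<in> U"
    unfolding skorokhod_open_def by blast+
  \<comment> \<open>\<open>V k\<close> collects the functions whose whole ball of radius
    \<open>1 / Suc k\<close> lies in \<open>U\<close>. Since \<open>U\<close> is open,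
    \<open>X \<omega>\<close> lies in \<open>U\<close> exactly when, for some \<open>k\<close>, all
    late approximations lie in \<open>V k\<close>, and this is a countable combination of measurable
    events.\<close>
  define V where "V k = {f. \<forall>g\<in>cadlag01. skorokhod_dist f g < 1 / real (Suc k) \<longrightarrow> g \<in> U}" for k
  have "X \<omega> \<in> U \<longleftrightarrow> (\<exists>k l. \<forall>j\<ge>l. Y j \<omega> \<in> V k)" if \<omega>: "\<omega> \<in> space M" for \<omega>
  proof
    assume "X \<omega> \<in> U"
    then obtain r where r: "r > 0" "\<forall>g\<in>cadlag01. skorokhod_dist (X \<omega>) g < r \<longrightarrow> g \<in> U"
      using U(2) by blast
    obtain k where k: "1 / real (Suc k) < r / 2"
      using reals_Archimedean[of "r / 2"] r by (auto simp: inverse_eq_divide)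
    obtain l where l: "\<And>j. j \<ge> l \<Longrightarrow> skorokhod_dist (Y j \<omega>) (X \<omega>) < r / 2"
      using lim[OF \<omega>, of "r / 2"] r by (auto simp: eventually_sequentially)
    have "Y j \<omega> \<in> V k" if "j \<ge> l" for j
      unfolding V_def
    proof (intro CollectI ballI impI)
      fix g assume g: "g \<in> cadlag01" and "skorokhod_dist (Y j \<omega>) g < 1 / real (Suc k)"
      then have "skorokhod_dist (Y j \<omega>) g < r / 2" using k by simp
      from skorokhod_dist_triangle_less[OF X[OF \<omega>] Y[OF \<omega>] g
          skorokhod_dist_commute_less[OF Y[OF \<omega>] X[OF \<omega>] l[OF that]] this]
      show "g \<in> U" using r(2) g by simp
    qed
    then show "\<exists>k l. \<forall>j\<ge>l. Y j \<omega> \<in> V k" by blast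
  next
    assume "\<exists>k l. \<forall>j\<ge>l. Y j \<omega> \<in> V k"
    then obtain k l where kl: "\<And>j. j \<ge> l \<Longrightarrow> Y j \<omega> \<in> V k" by blast
    obtain l' where "\<And>j. j \<ge> l' \<Longrightarrow> skorokhod_dist (Y j \<omega>) (X \<omega>) < 1 / real (Suc k)"
      using lim[OF \<omega>, of "1 / real (Suc k)"] by (auto simp: eventually_sequentially)
    with kl[of "max l l'"] show "X \<omega> \<in> U"
      using X[OF \<omega>] by (auto simp: V_def)
  qed
  then have "X -` U \<inter> space M = {\<omega> \<in> space M. \<exists>k l. \<forall>j. l \<le> j \<longrightarrow> Y j \<omega> \<in> V k}"
    by auto
  also have "\<dots> \<in> sets M"
    by (intro sets.sets_Collect meas)
  finally show "X -` U \<inter> space M \<in> sets M" .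
qed

section \<open>Measurability of the random path\<close>

lemma poisson_processD:
  assumes "poisson_process \<Omega> lam N"
  shows "prob_space \<Omega>" "\<And>t. t \<ge> 0 \<Longrightarrow> N t \<in> measurable \<Omega> (count_space UNIV)"
    "\<And>\<omega>. \<omega> \<in> space \<Omega> \<Longrightarrow> N 0 \<omega> = 0"
    "\<And>\<omega>. \<omega> \<in> space \<Omega> \<Longrightarrow> mono_on {0..} (\<lambda>t. N t \<omega>)"
    "\<And>\<omega> t. \<omega> \<in> space \<Omega> \<Longrightarrow> t \<ge> 0 \<Longrightarrow> ((\<lambda>s. N s \<omega>) \<longlongrightarrow> N t \<omega>) (at_right t)"
    "\<And>s t. 0 \<le> s \<Longrightarrow> s < t \<Longrightarrow> distr \<Omega> (count_space UNIV) (\<lambda>\<omega>. N t \<omega> - N s \<omega>)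
                    = measure_pmf (poisson_pmf (lam * (t - s)))"
    "\<And>t. incseq t \<Longrightarrow> t 0 \<ge> 0 \<Longrightarrow> prob_space.indep_vars \<Omega> (\<lambda>_::nat. count_space UNIV)
          (\<lambda>j \<omega>. N (t (Suc j)) \<omega> - N (t j) \<omega>) UNIV"
  using assms unfolding poisson_process_def by blast+

lemma cpp_path_cadlag01:
  assumes "poisson_process \<Omega> lam N" "\<omega> \<in> space \<Omega>"
  shows "cpp_path N \<Delta> \<omega> \<in> cadlag01"
  unfolding cpp_path_def
  by (rule cadlag01_step[where \<phi> = "\<lambda>k. \<Sum>i=0..k. \<Delta> i \<omega>"]) (use poisson_processD[OF assms(1)] assms(2) in blast)+

lemma measurable_random_sum:
  fixes \<Delta> :: "nat \<Rightarrow> 'a \<Rightarrow> real"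
  assumes [measurable]: "\<And>i. \<Delta> i \<in> borel_measurable M" "f \<in> measurable M (count_space UNIV)"
  shows "(\<lambda>\<omega>. \<Sum>i=0..f \<omega>. \<Delta> i \<omega>) \<in> borel_measurable M"
  by (rule measurable_compose_countable[where f = "\<lambda>k \<omega>. \<Sum>i=0..k. \<Delta> i \<omega>"]) measurable

text \<open>This makes \<open>cpp_law\<close> a genuine image measure. At each stage the
  approximating path is a function of finitely many integer-valued random variables, so its
  preimages of all sets are measurable.\<close>

lemma cpp_path_measurable:
  assumes N: "poisson_process \<Omega> lam N" and \<Delta>: "\<And>i. \<Delta> i \<in> borel_measurable \<Omega>"
  shows "cpp_path N \<Delta> \<in> measurable \<Omega> skorokhod_borel"
proof -
  note D = poisson_processD[OF N]
  define v where "v j \<omega> k = \<lfloor>real (Suc j) * (\<Sum>i=0..N (real k / real (Suc j)) \<omega>. \<Delta> i \<omega>)\<rfloor>" for j \<omega> k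
  have v: "(\<lambda>\<omega>. v j \<omega> k) \<in> measurable \<Omega> (count_space UNIV)" for j k
    unfolding v_def using D(2)[of "real k / real (Suc j)"] \<Delta>
    by (intro measurable_compose[OF _ measurable_real_floor] borel_measurable_times
        measurable_random_sum) auto
  \<comment> \<open>Only the indices 0 to \<open>j + 1\<close> occur, the last one at
    \<open>t = 1\<close>. The samples are collected in a list because lists of integers are
    countable, which makes every function of such a list measurable.\<close>
  have grid: "grid_path j (v j \<omega>) = grid_path j (\<lambda>k. map (v j \<omega>) [0..<j + 2] ! k)" for j \<omega>
  proof -
    have "nat \<lfloor>real (Suc j) * t\<rfloor> < j + 2" if "t \<in> {0..1}" for t
    proof -
      have "real (Suc j) * t \<le> real (Suc j)" using that by (simp add: mult_left_le)
      then have "\<lfloor>real (Suc j) * t\<rfloor> \<le> int (Suc j)" by linarith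
      then show ?thesis by simp
    qed
    then show ?thesis
      unfolding grid_path_def by (intro restrict_ext) (simp del: upt_Suc)
  qed
  show ?thesis
  proof (rule skorokhod_measurable_limit[where Y = "\<lambda>j \<omega>. grid_path j (v j \<omega>)"])
    fix \<omega> assume \<omega>: "\<omega> \<in> space \<Omega>"
    show "cpp_path N \<Delta> \<omega> \<in> cadlag01" by (rule cpp_path_cadlag01[OF N \<omega>])
    fix e :: real assume "e > 0"
    with skorokhod_dist_grid_path_tendsto[OF D(4)[OF \<omega>] D(5)[OF \<omega>], of e "\<lambda>k. \<Sum>i=0..k. \<Delta> i \<omega>"]
    show "\<forall>\<^sub>F j in sequentially. skorokhod_dist (grid_path j (v j \<omega>)) (cpp_path N \<Delta> \<omega>) < e"
      unfolding v_def cpp_path_def by blast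
  next
    fix j and U :: "(real \<Rightarrow> real) set"
    have "(\<lambda>\<omega>. map (v j \<omega>) xs) \<in> measurable \<Omega> (count_space UNIV)" for xs
    proof (induction xs)
      case (Cons k xs)
      show ?case
        using measurable_compose_countable[OF measurable_compose_countable[OF measurable_const Cons],
            of "\<lambda>i l. i # l"]
        by (simp, rule measurable_compose_countable[where f = "\<lambda>i \<omega>. i # map (v j \<omega>) xs" and g = "\<lambda>\<omega>. v j \<omega> k"])
          (auto intro: v measurable_compose[OF Cons])
    qed simp
    then have "(\<lambda>\<omega>. map (v j \<omega>) [0..<j + 2]) -` {l. grid_path j (\<lambda>k. l ! k) \<in> U} \<inter> space \<Omega> \<in> sets \<Omega>"
      by (rule measurable_sets) simp
    then show "{\<omega> \<in> space \<Omega>. grid_path j (v j \<omega>) \<in> U} \<in> sets \<Omega>"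
      unfolding grid[of j] by (simp add: vimage_def Int_def conj_commute del: upt_Suc)
  qed (rule grid_path_cadlag01)
qed

text \<open>The likelihood evaluates a random path at random points and integrates it over time, so
  measurability in both arguments together is required. The path is read off at the next grid point
  to the right, where time takes countably many values; for fixed arguments this is eventually
  exact, since the counting function is locally constant to the right.\<close>

lemma cpp_path_joint_measurable:
  assumes N: "poisson_process \<Omega> lam N" and \<Delta>[measurable]: "\<And>i. \<Delta> i \<in> borel_measurable \<Omega>"
  shows "(\<lambda>(x, \<omega>). cpp_path N \<Delta> \<omega> (clamp01 x)) \<in> borel_measurable (borel \<Otimes>\<^sub>M \<Omega>)"
proof -
  note D = poisson_processD[OF N]
  \<comment> \<open>The point \<open>s i x\<close> can exceed 1. The counting process is defined on
    the whole half-line, so \<open>W\<close> uses \<open>N\<close> directly instead of the path on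
    [0,1].\<close>
  define s where "s i x = (real_of_int \<lfloor>real (Suc i) * clamp01 x\<rfloor> + 1) / real (Suc i)" for i x
  define W where "W i z = (\<Sum>k=0..N (s i (fst z)) (snd z). \<Delta> k (snd z))" for i and z :: "real \<times> 'a"
  have s_tendsto: "filterlim (\<lambda>i. s i x) (at_right (clamp01 x)) sequentially" for x
    unfolding s_def by (rule grid_tendsto_at_right)
  have Nm: "(\<lambda>z. N (s i (fst z)) (snd z)) \<in> measurable (borel \<Otimes>\<^sub>M \<Omega>) (count_space UNIV)" for i
  proof -
    have [measurable]: "clamp01 \<in> borel_measurable borel" unfolding clamp01_def by measurable
    have "(\<lambda>z. \<lfloor>real (Suc i) * clamp01 (fst z)\<rfloor>) \<in> measurable (borel \<Otimes>\<^sub>M \<Omega>) (count_space UNIV)"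
      by measurable
    then have fl: "(\<lambda>z. nat \<lfloor>real (Suc i) * clamp01 (fst z)\<rfloor>) \<in> measurable (borel \<Otimes>\<^sub>M \<Omega>) (count_space UNIV)"
      by (rule measurable_compose) simp
    have "(\<lambda>z. N ((real k + 1) / real (Suc i)) (snd z)) \<in> measurable (borel \<Otimes>\<^sub>M \<Omega>) (count_space UNIV)" for k
      by (rule measurable_compose[OF measurable_snd]) (rule D(2), simp)
    from measurable_compose_countable[OF this fl]
    have "(\<lambda>z. N ((real (nat \<lfloor>real (Suc i) * clamp01 (fst z)\<rfloor>) + 1) / real (Suc i)) (snd z))
      \<in> measurable (borel \<Otimes>\<^sub>M \<Omega>) (count_space UNIV)" .
    moreover have "real (nat \<lfloor>real (Suc i) * clamp01 x\<rfloor>) = real_of_int \<lfloor>real (Suc i) * clamp01 x\<rfloor>" for x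
      by simp
    ultimately show ?thesis by (simp only: s_def)
  qed
  have W: "W i \<in> borel_measurable (borel \<Otimes>\<^sub>M \<Omega>)" for i
    unfolding W_def by (intro measurable_random_sum Nm) measurable
  show ?thesis
  proof (rule borel_measurable_LIMSEQ_real[OF _ W])
    fix z :: "real \<times> 'a" assume "z \<in> space (borel \<Otimes>\<^sub>M \<Omega>)"
    then have \<omega>: "snd z \<in> space \<Omega>" by (auto simp: space_pair_measure)
    have "((\<lambda>t. N t (snd z)) \<longlongrightarrow> N (clamp01 (fst z)) (snd z)) (at_right (clamp01 (fst z)))"
      by (rule D(5)[OF \<omega>]) simp
    from filterlim_compose[OF this s_tendsto]
    have "\<forall>\<^sub>F i in sequentially. N (s i (fst z)) (snd z) = N (clamp01 (fst z)) (snd z)"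
      by (simp add: tendsto_discrete)
    then have "\<forall>\<^sub>F i in sequentially. W i z = (case z of (x, \<omega>) \<Rightarrow> cpp_path N \<Delta> \<omega> (clamp01 x))"
      by eventually_elim (auto simp: W_def cpp_path_def split: prod.splits)
    then show "(\<lambda>i. W i z) \<longlonglongrightarrow> (case z of (x, \<omega>) \<Rightarrow> cpp_path N \<Delta> \<omega> (clamp01 x))"
      by (rule tendsto_eventually)
  qed
qed

section \<open>Likelihoods under the Poisson point process\<close>

lemma bounded_set_integrable01:
  fixes f :: "real \<Rightarrow> real"
  assumes "f \<in> borel_measurable borel" "\<And>x. x \<in> {0..1} \<Longrightarrow> \<bar>f x\<bar> \<le> B"
  shows "set_integrable lborel {0..1} f"
  unfolding set_integrable_def
  by (rule integrableI_bounded_set_indicator[where B = B])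
    (use assms in \<open>auto intro!: AE_I2\<close>)

lemma space_intensity [simp]: "space (intensity n f) = {0..1} \<times> UNIV"
  by (simp add: intensity_def space_restrict_space)

lemma sets_intensity: "sets (intensity n f) = sets (restrict_space lborel ({0..1} \<times> UNIV))"
  by (simp add: intensity_def)

lemma intensity_projections_measurable [measurable]:
  "fst \<in> borel_measurable (intensity n f)" "snd \<in> borel_measurable (intensity n f)"
proof -
  have "fst \<in> borel_measurable (restrict_space lborel ({0..1} \<times> (UNIV :: real set)))"
    "snd \<in> borel_measurable (restrict_space lborel ({0..1 :: real} \<times> (UNIV :: real set)))"
    by (intro measurable_restrict_space1; simp add: lborel_prod[symmetric])+
  then show "fst \<in> borel_measurable (intensity n f)" "snd \<in> borel_measurable (intensity n f)"
    by (simp_all add: measurable_cong_sets[OF sets_intensity refl])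
qed

text \<open>By Fubini the vertical section over \<open>x\<close> is the interval from
  \<open>f0 x\<close> to \<open>f x\<close>, empty where \<open>f\<close> is below
  \<open>f0\<close>: the intensity charges only the part of the region above
  \<open>f0\<close>.\<close>

lemma intensity_below_graph:
  assumes [measurable]: "f0 \<in> borel_measurable borel" "f \<in> borel_measurable borel"
    and bnd: "\<And>x. x \<in> {0..1} \<Longrightarrow> \<bar>f x - f0 x\<bar> \<le> B"
  defines "A \<equiv> {z \<in> {0..1} \<times> UNIV. snd z < f (fst z)}"
  shows "A \<in> sets (intensity n f0)"
    and "emeasure (intensity n f0) A = ennreal (real n * (LINT x:{0..1}|lborel. max 0 (f x - f0 x)))"
proof -
  have A_eq: "A = {z \<in> space (intensity n f0). snd z < f (fst z)}"
    by (auto simp: A_def)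
  show A: "A \<in> sets (intensity n f0)"
    unfolding A_eq by measurable
  let ?D = "{0..1} \<times> UNIV :: (real \<times> real) set"
  let ?h = "\<lambda>z :: real \<times> real. of_nat n * indicator {(x, y). f0 x \<le> y} z :: ennreal"
  have [measurable]: "{(x, y). f0 x \<le> y} \<in> sets (borel \<Otimes>\<^sub>M borel)"
  proof -
    have "{z \<in> space (borel \<Otimes>\<^sub>M borel). f0 (fst z) \<le> snd z} \<in> sets (borel \<Otimes>\<^sub>M borel)"
      by measurable
    then show ?thesis by (simp add: space_pair_measure case_prod_unfold)
  qed
  have D [measurable]: "?D \<in> sets (borel \<Otimes>\<^sub>M borel)"
    by (intro pair_measureI) auto
  have h [measurable]: "?h \<in> borel_measurable (borel \<Otimes>\<^sub>M borel)" by measurable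
  have sets_lborel2: "sets (lborel :: (real \<times> real) measure) = sets (borel \<Otimes>\<^sub>M borel)"
    by (metis borel_prod sets_lborel)
  have hl: "?h \<in> borel_measurable lborel"
    using h by (simp only: measurable_cong_sets[OF sets_lborel2 refl])
  have A2 [measurable]: "A \<in> sets (borel \<Otimes>\<^sub>M borel)"
  proof -
    have "{z \<in> space (borel \<Otimes>\<^sub>M borel). fst z \<in> {0..1} \<and> snd z < f (fst z)} \<in> sets (borel \<Otimes>\<^sub>M borel)"
      by measurable
    then show ?thesis by (simp add: space_pair_measure A_def mem_Times_iff)
  qed
  have "intensity n f0 = density (restrict_space lborel ?D) ?h"
    unfolding intensity_def by (rule arg_cong[where f = "density _"]) auto
  then have "emeasure (intensity n f0) A = (\<integral>\<^sup>+z. ?h z * indicator A z \<partial>restrict_space lborel ?D)"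
    using A by (simp add: emeasure_density measurable_restrict_space1[OF hl] sets_intensity)
  also have "\<dots> = (\<integral>\<^sup>+z. ?h z * indicator A z * indicator ?D z \<partial>lborel)"
    by (rule nn_integral_restrict_space) (use D in \<open>simp only: sets_lborel2 space_lborel space_borel Int_UNIV_right\<close>)
  also have "\<dots> = (\<integral>\<^sup>+z. ?h z * indicator A z * indicator ?D z \<partial>(lborel \<Otimes>\<^sub>M lborel))"
    by (simp only: lborel_prod)
  also have "\<dots> = (\<integral>\<^sup>+x. \<integral>\<^sup>+y. ?h (x, y) * indicator A (x, y) * indicator ?D (x, y) \<partial>lborel \<partial>lborel)"
  proof (rule lborel.nn_integral_fst[symmetric])
    show "(\<lambda>z. ?h z * indicator A z * indicator ?D z) \<in> borel_measurable (lborel \<Otimes>\<^sub>M lborel)"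
      unfolding measurable_cong_sets[OF sets_pair_measure_cong[OF sets_lborel sets_lborel] refl]
      by (intro borel_measurable_times_ennreal h borel_measurable_indicator A2 D)
  qed
  also have "\<dots> = (\<integral>\<^sup>+x. ennreal (indicator {0..1} x * (real n * max 0 (f x - f0 x))) \<partial>lborel)"
  proof (rule nn_integral_cong)
    fix x
    have "(\<integral>\<^sup>+y. ?h (x, y) * indicator A (x, y) * indicator ?D (x, y) \<partial>lborel)
      = (\<integral>\<^sup>+y. (of_nat n * indicator {0..1} x) * indicator {f0 x..<f x} y \<partial>lborel)"
      by (intro nn_integral_cong) (auto simp: A_def indicator_def)
    also have "\<dots> = of_nat n * indicator {0..1} x * emeasure lborel {f0 x..<f x}"
      by (subst nn_integral_cmult_indicator) auto
    also have "\<dots> = ennreal (indicator {0..1} x * (real n * max 0 (f x - f0 x)))"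
      by (cases "f0 x \<le> f x")
        (auto simp: indicator_def ennreal_of_nat_eq_real_of_nat ennreal_mult'[symmetric])
    finally show "(\<integral>\<^sup>+y. ?h (x, y) * indicator A (x, y) * indicator ?D (x, y) \<partial>lborel)
      = ennreal (indicator {0..1} x * (real n * max 0 (f x - f0 x)))" .
  qed
  also have "\<dots> = ennreal (LINT x|lborel. indicator {0..1} x * (real n * max 0 (f x - f0 x)))"
  proof (rule nn_integral_eq_integral)
    have "set_integrable lborel {0..1} (\<lambda>x. real n * max 0 (f x - f0 x))"
    proof (rule bounded_set_integrable01)
      fix x :: real assume "x \<in> {0..1}"
      then have "max 0 (f x - f0 x) \<le> B" using bnd[of x] by linarith
      then show "\<bar>real n * max 0 (f x - f0 x)\<bar> \<le> real n * B"
        by (simp add: abs_mult mult_left_mono)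
    qed measurable
    then show "integrable lborel (\<lambda>x. indicator {0..1} x * (real n * max 0 (f x - f0 x)))"
      by (simp add: set_integrable_def)
  qed auto
  also have "(LINT x|lborel. indicator {0..1} x * (real n * max 0 (f x - f0 x)))
      = real n * (LINT x:{0..1}|lborel. max 0 (f x - f0 x))"
    unfolding set_lebesgue_integral_def by (subst integral_mult_right_zero[symmetric]) (simp add: algebra_simps)
  finally show "emeasure (intensity n f0) A = ennreal (real n * (LINT x:{0..1}|lborel. max 0 (f x - f0 x)))" .
qed

text \<open>The third fact is the void probability, the case of zero points. The expected
  likelihood, the almost sure position of the points above \<open>f0\<close> and the bracket events
  all reduce to it.\<close>

lemma poisson_points_lawD:
  assumes "poisson_points_law \<nu> P"
  shows "prob_space P" "sets P = sets (Pi\<^sub>M UNIV (\<lambda>_. \<nu>))"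
    "\<And>A. A \<in> sets \<nu> \<Longrightarrow> emeasure \<nu> A < \<infinity> \<Longrightarrow> measure P {p \<in> space P. \<forall>i. p i \<notin> A} = exp (- measure \<nu> A)"
proof -
  show "prob_space P" "sets P = sets (Pi\<^sub>M UNIV (\<lambda>_. \<nu>))"
    using assms unfolding poisson_points_law_def by blast+
  fix A assume "A \<in> sets \<nu>" "emeasure \<nu> A < \<infinity>"
  then have "measure P {p \<in> space P. point_count p A = of_nat 0} = measure \<nu> A ^ 0 / fact 0 * exp (- measure \<nu> A)"
    using assms unfolding poisson_points_law_def by blast
  moreover have "point_count p A = of_nat 0 \<longleftrightarrow> (\<forall>i. p i \<notin> A)" for p
    unfolding point_count_def by (subst of_nat_0, subst emeasure_count_space_eq_0) auto
  ultimately show "measure P {p \<in> space P. \<forall>i. p i \<notin> A} = exp (- measure \<nu> A)"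
    by simp
qed

context
  fixes n :: nat and f0 :: "real \<Rightarrow> real" and P :: "(nat \<Rightarrow> real \<times> real) measure"
  assumes P: "poisson_points_law (intensity n f0) P"
begin

lemma points_in_strip: "p \<in> space P \<Longrightarrow> 0 \<le> fst (p i) \<and> fst (p i) \<le> 1"
  using sets_eq_imp_space_eq[OF poisson_points_lawD(2)[OF P]]
  by (auto simp: space_PiM PiE_def Pi_def mem_Times_iff)

lemma points_measurable [measurable]:
  "(\<lambda>p. fst (p i)) \<in> borel_measurable P" "(\<lambda>p. snd (p i)) \<in> borel_measurable P"
proof -
  have "(\<lambda>p. p i) \<in> measurable P (intensity n f0)"
    using measurable_component_singleton[of i UNIV "\<lambda>_. intensity n f0"]
    by (simp add: measurable_cong_sets[OF poisson_points_lawD(2)[OF P] refl])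
  then show "(\<lambda>p. fst (p i)) \<in> borel_measurable P" "(\<lambda>p. snd (p i)) \<in> borel_measurable P"
    by (rule measurable_compose; measurable)+
qed

lemma prob_points_above:
  assumes f0: "f0 \<in> borel_measurable borel" and f [measurable]: "f \<in> borel_measurable borel"
    and bnd: "\<And>x. x \<in> {0..1} \<Longrightarrow> \<bar>f x - f0 x\<bar> \<le> B"
  shows "measure P {p \<in> space P. \<forall>i. f (fst (p i)) \<le> snd (p i)}
      = exp (- real n * (LINT x:{0..1}|lborel. max 0 (f x - f0 x)))"
proof -
  let ?A = "{z \<in> {0..1} \<times> UNIV. snd z < f (fst z)}"
  note A = intensity_below_graph[OF f0 f bnd]
  have nonneg: "0 \<le> (LINT x:{0..1}|lborel. max 0 (f x - f0 x))"
    unfolding set_lebesgue_integral_def by (intro integral_nonneg_AE) auto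
  have "{p \<in> space P. \<forall>i. f (fst (p i)) \<le> snd (p i)} = {p \<in> space P. \<forall>i. p i \<notin> ?A}"
    using points_in_strip by (auto simp: not_less mem_Times_iff)
  then show ?thesis
    using poisson_points_lawD(3)[OF P A(1)] A(2) nonneg by (simp add: measure_def)
qed

end

text \<open>The void probability subtracts the positive part of \<open>f - f0\<close> from
  \<open>f\<close> under the integral, which leaves the minimum of \<open>f\<close> and
  \<open>f0\<close>. An excess over \<open>f0\<close> thus costs nothing in expectation, and Fubini
  controls a function only through its part below \<open>f0\<close>.\<close>

lemma expected_likelihood:
  assumes P: "poisson_points_law (intensity n f0) P"
    and f0: "f0 \<in> borel_measurable borel" "\<And>x. x \<in> {0..1} \<Longrightarrow> \<bar>f0 x\<bar> \<le> A"
    and f: "(\<lambda>x. f (clamp01 x)) \<in> borel_measurable borel" "\<And>x. x \<in> {0..1} \<Longrightarrow> \<bar>f x\<bar> \<le> B"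
  shows "(\<integral>\<^sup>+p. likelihood n p f \<partial>P)
      = ennreal (exp (real n * (LINT x:{0..1}|lborel. f0 x) - real n * (LINT x:{0..1}|lborel. max 0 (f0 x - f x))))"
proof -
  let ?F = "\<lambda>x. f (clamp01 x)"
  interpret prob_space P by (rule poisson_points_lawD(1)[OF P])
  note [measurable] = f(1) points_measurable[OF P]
  have bnd: "\<bar>?F x - f0 x\<bar> \<le> A + B" if "x \<in> {0..1}" for x
    using f0(2)[OF that] f(2)[OF that] that by auto
  have eq: "likelihood n p f = ennreal (exp (real n * (LINT x:{0..1}|lborel. f x)))
      * indicator {p \<in> space P. \<forall>i. ?F (fst (p i)) \<le> snd (p i)} p" if "p \<in> space P" for p
    using points_in_strip[OF P that] that by (auto simp: likelihood_def indicator_def)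
  have "(\<integral>\<^sup>+p. likelihood n p f \<partial>P) = (\<integral>\<^sup>+p. ennreal (exp (real n * (LINT x:{0..1}|lborel. f x)))
      * indicator {p \<in> space P. \<forall>i. ?F (fst (p i)) \<le> snd (p i)} p \<partial>P)"
    by (intro nn_integral_cong eq)
  also have "\<dots> = ennreal (exp (real n * (LINT x:{0..1}|lborel. f x)))
      * emeasure P {p \<in> space P. \<forall>i. ?F (fst (p i)) \<le> snd (p i)}"
    by (intro nn_integral_cmult_indicator sets.sets_Collect_countable_All borel_measurable_le
        measurable_compose[OF points_measurable(1)[OF P] f(1)] points_measurable(2)[OF P])
  also have "\<dots> = ennreal (exp (real n * (LINT x:{0..1}|lborel. f x)
      - real n * (LINT x:{0..1}|lborel. max 0 (?F x - f0 x))))"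
    using prob_points_above[OF P f0(1) f(1) bnd]
    by (simp add: emeasure_eq_measure ennreal_mult'[symmetric] exp_diff exp_minus field_simps)
  also have "(LINT x:{0..1}|lborel. f x) - (LINT x:{0..1}|lborel. max 0 (?F x - f0 x))
      = (LINT x:{0..1}|lborel. f0 x) - (LINT x:{0..1}|lborel. max 0 (f0 x - f x))"
  proof -
    have int: "set_integrable lborel {0..1} ?F" "set_integrable lborel {0..1} f0"
      "set_integrable lborel {0..1} (\<lambda>x. max 0 (?F x - f0 x))"
      "set_integrable lborel {0..1} (\<lambda>x. max 0 (f0 x - ?F x))"
    proof -
      note [measurable] = f0(1)
      show "set_integrable lborel {0..1} ?F" by (rule bounded_set_integrable01[where B = B]) (use f in auto)
      show "set_integrable lborel {0..1} f0" by (rule bounded_set_integrable01[where B = A]) (use f0 in auto)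
      have le: "\<bar>max 0 (?F x - f0 x)\<bar> \<le> A + B" "\<bar>max 0 (f0 x - ?F x)\<bar> \<le> A + B" if "x \<in> {0..1}" for x
        using bnd[OF that] by linarith+
      show "set_integrable lborel {0..1} (\<lambda>x. max 0 (?F x - f0 x))"
        by (rule bounded_set_integrable01[OF _ le(1)]) measurable
      show "set_integrable lborel {0..1} (\<lambda>x. max 0 (f0 x - ?F x))"
        by (rule bounded_set_integrable01[OF _ le(2)]) measurable
    qed
    have "(LINT x:{0..1}|lborel. f x) = (LINT x:{0..1}|lborel. ?F x)"
      "(LINT x:{0..1}|lborel. max 0 (f0 x - f x)) = (LINT x:{0..1}|lborel. max 0 (f0 x - ?F x))"
      by (auto intro!: set_lebesgue_integral_cong)
    moreover have "(LINT x:{0..1}|lborel. ?F x - max 0 (?F x - f0 x)) = (LINT x:{0..1}|lborel. f0 x - max 0 (f0 x - ?F x))"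
      by (intro set_lebesgue_integral_cong) (auto simp: max_def)
    ultimately show ?thesis
      using int by (simp add: set_integral_diff)
  qed
  then have "real n * (LINT x:{0..1}|lborel. f x) - real n * (LINT x:{0..1}|lborel. max 0 (?F x - f0 x))
      = real n * (LINT x:{0..1}|lborel. f0 x) - real n * (LINT x:{0..1}|lborel. max 0 (f0 x - f x))"
    by (simp only: right_diff_distrib[symmetric])
  finally show ?thesis .
qed

text \<open>The nonnegative integral is a supremum over simple functions below the integrand, and
  each of these is measurable and transfers exactly. The inequality has the direction that the
  numerator of the posterior requires, where measurability of the integrand on the Skorokhod space
  is not established.\<close>

lemma nn_integral_distr_le:
  assumes X: "X \<in> measurable M N"
  shows "(\<integral>\<^sup>+y. f y \<partial>distr M N X) \<le> (\<integral>\<^sup>+x. f (X x) \<partial>M)"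
  unfolding nn_integral_def[of "distr M N X"]
proof (rule SUP_least)
  fix g assume "g \<in> {g. simple_function (distr M N X) g \<and> g \<le> f}"
  then have g: "simple_function (distr M N X) g" "g \<le> f" by auto
  have "integral\<^sup>S (distr M N X) g = (\<integral>\<^sup>+y. g y \<partial>distr M N X)"
    by (rule nn_integral_eq_simple_integral[OF g(1), symmetric])
  also have "\<dots> = (\<integral>\<^sup>+x. g (X x) \<partial>M)"
    using borel_measurable_simple_function[OF g(1)] by (intro nn_integral_distr X) simp
  also have "\<dots> \<le> (\<integral>\<^sup>+x. f (X x) \<partial>M)"
    using g(2) by (intro nn_integral_mono) (auto simp: le_fun_def)
  finally show "integral\<^sup>S (distr M N X) g \<le> (\<integral>\<^sup>+x. f (X x) \<partial>M)" .
qed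

section \<open>A non-asymptotic bound on the expected posterior\<close>

lemma set_integral_pos_part_nonneg: "0 \<le> (LINT x:A|M. max 0 (f x :: real))"
  unfolding set_lebesgue_integral_def by (intro integral_nonneg_AE) auto

lemma ennreal_divide_mono:
  fixes a b c :: ennreal
  assumes "a \<le> c" "ennreal d \<le> b" "0 < d"
  shows "a / b \<le> c / ennreal d"
proof -
  have d: "ennreal d \<noteq> 0" "ennreal d \<noteq> \<top>" using assms(3) by auto
  have b: "0 < b" using assms(2,3) by (metis ennreal_less_zero_iff less_le_trans)
  have "a \<le> c" by (rule assms(1))
  also have "c = c / ennreal d * ennreal d"
    using d by (metis divide_eq_1_ennreal ennreal_divide_times mult_1_right)
  also have "\<dots> \<le> c / ennreal d * b"
    using assms(2) by (intro mult_left_mono) auto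
  finally show ?thesis
    using b by (intro divide_le_posI_ennreal) (simp_all add: mult.commute)
qed

lemma posterior_le_one: "posterior prior n p B \<le> 1"
proof -
  have "(\<integral>\<^sup>+f\<in>B. likelihood n p f \<partial>prior) \<le> (\<integral>\<^sup>+f. likelihood n p f \<partial>prior)"
    by (intro nn_integral_mono) (auto simp: indicator_def)
  then have "posterior prior n p B \<le> (\<integral>\<^sup>+f. likelihood n p f \<partial>prior) / (\<integral>\<^sup>+f. likelihood n p f \<partial>prior)"
    unfolding posterior_def by (rule divide_right_mono_ennreal)
  \<comment> \<open>In the degenerate cases the quotients 0/0 and \<infinity>/\<infinity> are both 0
    in \<open>ennreal\<close>.\<close>
  also have "\<dots> \<le> 1"
    by (cases "(\<integral>\<^sup>+f. likelihood n p f \<partial>prior) = 0 \<or> (\<integral>\<^sup>+f. likelihood n p f \<partial>prior) = \<infinity>")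
      (auto simp: ennreal_divide_self less_top[symmetric])
  finally show ?thesis .
qed

context
  fixes \<Omega> :: "'w measure" and X :: "'w \<Rightarrow> real \<Rightarrow> real" and n :: nat and f0 :: "real \<Rightarrow> real"
    and R :: real and P :: "(nat \<Rightarrow> real \<times> real) measure"
  assumes \<Omega>: "prob_space \<Omega>"
    and X: "X \<in> measurable \<Omega> skorokhod_borel"
    and X_cadlag: "\<And>\<omega>. \<omega> \<in> space \<Omega> \<Longrightarrow> X \<omega> \<in> cadlag01"
    and X_joint: "(\<lambda>(x, \<omega>). X \<omega> (clamp01 x)) \<in> borel_measurable (borel \<Otimes>\<^sub>M \<Omega>)"
    and f0: "f0 \<in> borel_measurable borel" "\<And>x. x \<in> {0..1} \<Longrightarrow> \<bar>f0 x\<bar> \<le> R"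
    and P: "poisson_points_law (intensity n f0) P"
begin

interpretation \<Omega>: prob_space \<Omega> by (rule \<Omega>)
interpretation P: prob_space P by (rule poisson_points_lawD(1)[OF P])

lemma path_measurable: "\<omega> \<in> space \<Omega> \<Longrightarrow> (\<lambda>x. X \<omega> (clamp01 x)) \<in> borel_measurable borel"
  by (rule cadlag01_clamp01_measurable[OF X_cadlag])

lemma path_integrable:
  assumes "\<omega> \<in> space \<Omega>" "f \<in> borel_measurable borel" "\<And>x. x \<in> {0..1} \<Longrightarrow> \<bar>f x\<bar> \<le> B"
  shows "set_integrable lborel {0..1} (\<lambda>x. X \<omega> x)"
    "set_integrable lborel {0..1} (\<lambda>x. max 0 (f x - X \<omega> x))"
    "set_integrable lborel {0..1} (\<lambda>x. max 0 (X \<omega> x - f x))"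
proof -
  obtain A where A: "\<And>x. x \<in> {0..1} \<Longrightarrow> \<bar>X \<omega> x\<bar> \<le> A"
    using cadlag01_bounded[OF X_cadlag[OF assms(1)]] by metis
  note [measurable] = path_measurable[OF assms(1)] assms(2)
  have "\<bar>max 0 (f x - X \<omega> x)\<bar> \<le> A + B" "\<bar>max 0 (X \<omega> x - f x)\<bar> \<le> A + B" if "x \<in> {0..1}" for x
    using A[OF that] assms(3)[OF that] by linarith+
  note le = this
  have i: "set_integrable lborel {0..1} (\<lambda>x. X \<omega> (clamp01 x))"
    by (rule bounded_set_integrable01[where B = A]) (use A in auto)
  have j: "set_integrable lborel {0..1} (\<lambda>x. max 0 (f x - X \<omega> (clamp01 x)))"
    by (rule bounded_set_integrable01[where B = "A + B"], measurable) (use le(1) in auto)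
  have k: "set_integrable lborel {0..1} (\<lambda>x. max 0 (X \<omega> (clamp01 x) - f x))"
    by (rule bounded_set_integrable01[where B = "A + B"], measurable) (use le(2) in auto)
  show "set_integrable lborel {0..1} (\<lambda>x. X \<omega> x)"
    by (rule set_integrable_cong[THEN iffD1, OF refl refl _ i]) simp
  show "set_integrable lborel {0..1} (\<lambda>x. max 0 (f x - X \<omega> x))"
    by (rule set_integrable_cong[THEN iffD1, OF refl refl _ j]) simp
  show "set_integrable lborel {0..1} (\<lambda>x. max 0 (X \<omega> x - f x))"
    by (rule set_integrable_cong[THEN iffD1, OF refl refl _ k]) simp
qed

lemma path_integral_measurable:
  fixes f :: "real \<Rightarrow> real \<Rightarrow> real"
  assumes [measurable]: "case_prod f \<in> borel_measurable (borel \<Otimes>\<^sub>M borel)"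
  shows "(\<lambda>\<omega>. LINT x:{0..1}|lborel. f x (X \<omega> x)) \<in> borel_measurable \<Omega>"
proof -
  have "(\<lambda>(\<omega>, x). X \<omega> (clamp01 x)) \<in> borel_measurable (\<Omega> \<Otimes>\<^sub>M borel)"
    using measurable_compose[OF measurable_pair_swap' X_joint] by (simp add: case_prod_unfold)
  then have [measurable]: "(\<lambda>z. X (fst z) (clamp01 (snd z))) \<in> borel_measurable (\<Omega> \<Otimes>\<^sub>M lborel)"
    by (simp add: case_prod_unfold cong: measurable_cong_sets sets_pair_measure_cong)
  have "(\<lambda>\<omega>. LINT x|lborel. indicator {0..1} x *\<^sub>R f x (X \<omega> (clamp01 x))) \<in> borel_measurable \<Omega>"
    by (rule lborel.borel_measurable_lebesgue_integral[where
          f = "\<lambda>\<omega> x. indicator {0..1} x *\<^sub>R f x (X \<omega> (clamp01 x))"]) (simp add: case_prod_unfold)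
  moreover have "(LINT x:{0..1}|lborel. f x (X \<omega> x)) = (LINT x|lborel. indicator {0..1} x *\<^sub>R f x (X \<omega> (clamp01 x)))" for \<omega>
    unfolding set_lebesgue_integral_def by (intro Bochner_Integration.integral_cong) (auto simp: indicator_def)
  ultimately show ?thesis by simp
qed

lemma likelihood_joint_measurable:
  "(\<lambda>(p, \<omega>). likelihood n p (X \<omega>)) \<in> borel_measurable (P \<Otimes>\<^sub>M \<Omega>)"
proof -
  have "(\<lambda>\<omega>. LINT x:{0..1}|lborel. X \<omega> x) \<in> borel_measurable \<Omega>"
    by (rule path_integral_measurable) measurable
  then have [measurable]: "(\<lambda>z. LINT x:{0..1}|lborel. X (snd z) x) \<in> borel_measurable (P \<Otimes>\<^sub>M \<Omega>)"
    by (rule measurable_compose[OF measurable_snd])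
  have ev: "(\<lambda>z. X (snd z) (clamp01 (fst (fst z i)))) \<in> borel_measurable (P \<Otimes>\<^sub>M \<Omega>)" for i
    using measurable_compose[OF measurable_Pair[OF
          measurable_compose[OF measurable_fst points_measurable(1)[OF P, of i]] measurable_snd] X_joint]
    by simp
  have "{z \<in> space (P \<Otimes>\<^sub>M \<Omega>). \<forall>i. X (snd z) (clamp01 (fst (fst z i))) \<le> snd (fst z i)} \<in> sets (P \<Otimes>\<^sub>M \<Omega>)"
    by (intro sets.sets_Collect_countable_All borel_measurable_le ev
        measurable_compose[OF measurable_fst points_measurable(2)[OF P]])
  then have "(\<lambda>z. ennreal (exp (real n * (LINT x:{0..1}|lborel. X (snd z) x))) *
      indicator {z \<in> space (P \<Otimes>\<^sub>M \<Omega>). \<forall>i. X (snd z) (clamp01 (fst (fst z i))) \<le> snd (fst z i)} z)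
      \<in> borel_measurable (P \<Otimes>\<^sub>M \<Omega>)"
    by measurable
  moreover have "likelihood n p (X \<omega>) = ennreal (exp (real n * (LINT x:{0..1}|lborel. X \<omega> x))) *
      indicator {z \<in> space (P \<Otimes>\<^sub>M \<Omega>). \<forall>i. X (snd z) (clamp01 (fst (fst z i))) \<le> snd (fst z i)} (p, \<omega>)"
    if "(p, \<omega>) \<in> space (P \<Otimes>\<^sub>M \<Omega>)" for p \<omega>
    using points_in_strip[OF P, of p] that
    by (auto simp: likelihood_def indicator_def space_pair_measure)
  ultimately show ?thesis
    by (subst measurable_cong[where g = "\<lambda>z. ennreal (exp (real n * (LINT x:{0..1}|lborel. X (snd z) x))) *
      indicator {z \<in> space (P \<Otimes>\<^sub>M \<Omega>). \<forall>i. X (snd z) (clamp01 (fst (fst z i))) \<le> snd (fst z i)} z"])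
      (auto simp: case_prod_unfold)
qed

text \<open>The bound on the denominator holds for every realisation of the point process above \<open>f0\<close>,
  since all functions below \<open>f0\<close> are then compatible with the observations.\<close>

lemma evidence_lower_bound:
  assumes G: "G \<in> sets skorokhod_borel"
    and below: "\<And>f x. f \<in> G \<Longrightarrow> x \<in> {0..1} \<Longrightarrow> f x \<le> f0 x"
    and int: "\<And>f. f \<in> G \<Longrightarrow> (LINT x:{0..1}|lborel. f0 x) - e0 \<le> (LINT x:{0..1}|lborel. f x)"
    and q: "q \<le> \<Omega>.prob {\<omega> \<in> space \<Omega>. X \<omega> \<in> G}"
    and p: "p \<in> space P" "\<forall>i. f0 (fst (p i)) \<le> snd (p i)"
  shows "ennreal (exp (real n * ((LINT x:{0..1}|lborel. f0 x) - e0)) * q)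
    \<le> (\<integral>\<^sup>+f. likelihood n p f \<partial>distr \<Omega> skorokhod_borel X)"
proof -
  let ?c = "exp (real n * ((LINT x:{0..1}|lborel. f0 x) - e0))"
  have "ennreal (?c * q) \<le> ennreal ?c * emeasure (distr \<Omega> skorokhod_borel X) G"
    using q by (subst emeasure_distr[OF X G])
      (auto simp: \<Omega>.emeasure_eq_measure ennreal_mult'[symmetric] vimage_def Int_def conj_commute
        intro!: ennreal_leI)
  also have "\<dots> = (\<integral>\<^sup>+f. ennreal ?c * indicator G f \<partial>distr \<Omega> skorokhod_borel X)"
    using G by (subst nn_integral_cmult_indicator) auto
  also have "\<dots> \<le> (\<integral>\<^sup>+f. likelihood n p f \<partial>distr \<Omega> skorokhod_borel X)"
  proof (rule nn_integral_mono)
    fix f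
    show "ennreal ?c * indicator G f \<le> likelihood n p f"
    proof (cases "f \<in> G")
      case True
      have "f (fst (p i)) \<le> snd (p i)" for i
        using below[OF True, of "fst (p i)"] points_in_strip[OF P p(1), of i] p(2) by (force intro: order_trans)
      then show ?thesis
        using True int[OF True] by (auto simp: likelihood_def intro!: ennreal_leI mult_left_mono)
    qed simp
  qed
  finally show ?thesis .
qed

text \<open>An L1 distance of at least \<open>r\<close> leaves \<open>r / 2\<close> for the part of
  the path below \<open>f0\<close> or for the part above it. In the second case a lower bracket
  within \<open>r / 4\<close> of the path still exceeds \<open>f0\<close> by \<open>r / 4\<close> in
  integral, and it has no point below it with probability at most
  \<open>exp (- real n * r / 4)\<close>; the first summand is the union bound over the brackets. The
  second summand is the expected numerator over the remaining paths divided by the deterministic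
  bound on the evidence, where the exponential of \<open>n\<close> times the integral of
  \<open>f0\<close> cancels.\<close>

lemma expected_posterior_le:
  fixes LL :: "(real \<Rightarrow> real) set"
  assumes S: "S \<in> sets \<Omega>"
    and LL: "finite LL" "\<And>l. l \<in> LL \<Longrightarrow> l \<in> borel_measurable borel"
      "\<And>l x. l \<in> LL \<Longrightarrow> x \<in> {0..1} \<Longrightarrow> \<bar>l x\<bar> \<le> B"
    and bracket: "\<And>\<omega>. \<omega> \<in> S \<Longrightarrow> \<exists>l\<in>LL. (\<forall>x\<in>{0..1}. l x \<le> X \<omega> x) \<and> (LINT x:{0..1}|lborel. X \<omega> x - l x) \<le> r / 4"
    and G: "G \<in> sets skorokhod_borel"
    and below: "\<And>f x. f \<in> G \<Longrightarrow> x \<in> {0..1} \<Longrightarrow> f x \<le> f0 x"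
    and int: "\<And>f. f \<in> G \<Longrightarrow> (LINT x:{0..1}|lborel. f0 x) - e0 \<le> (LINT x:{0..1}|lborel. f x)"
    and q: "0 < q" "q \<le> \<Omega>.prob {\<omega> \<in> space \<Omega>. X \<omega> \<in> G}"
  shows "(\<integral>\<^sup>+p. posterior (distr \<Omega> skorokhod_borel X) n p (L1_far f0 r) \<partial>P)
    \<le> ennreal (real (card LL) * exp (- real n * r / 4)
        + (\<Omega>.prob (space \<Omega> - S) + exp (- real n * r / 2)) * exp (real n * e0) / q)"
proof -
  let ?prior = "distr \<Omega> skorokhod_borel X"
  let ?I0 = "LINT x:{0..1}|lborel. f0 x"
  define d where "d = exp (real n * (?I0 - e0)) * q"
  have d: "d > 0" using q by (simp add: d_def)
  \<comment> \<open>\<open>V\<close> holds the paths left to Fubini: those outside the sieve and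
    those far below \<open>f0\<close>. \<open>T\<close> is the event that some bracket far above
    \<open>f0\<close> has no point below it.\<close>
  define V where "V = {\<omega> \<in> space \<Omega>. \<omega> \<notin> S \<or> r / 2 \<le> (LINT x:{0..1}|lborel. max 0 (f0 x - X \<omega> x))}"
  define T where "T = (\<Union>l\<in>{l \<in> LL. r / 4 \<le> (LINT x:{0..1}|lborel. max 0 (l x - f0 x))}.
      {p \<in> space P. \<forall>i. l (fst (p i)) \<le> snd (p i)})"
  define num where "num p = (\<integral>\<^sup>+\<omega>. likelihood n p (X \<omega>) * indicator V \<omega> \<partial>\<Omega>)" for p
  note [measurable] = f0(1) S
  have [measurable]: "(\<lambda>\<omega>. LINT x:{0..1}|lborel. max 0 (f0 x - X \<omega> x)) \<in> borel_measurable \<Omega>"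
    by (rule path_integral_measurable) measurable
  have V [measurable]: "V \<in> sets \<Omega>" unfolding V_def by measurable
  have above: "{p \<in> space P. \<forall>i. l (fst (p i)) \<le> snd (p i)} \<in> sets P" if "l \<in> borel_measurable borel" for l
    using that by (intro sets.sets_Collect_countable_All borel_measurable_le
        measurable_compose[OF points_measurable(1)[OF P]] points_measurable(2)[OF P])
  have T [measurable]: "T \<in> sets P"
    unfolding T_def using LL(1,2) above by (intro sets.finite_UN) auto
  have num [measurable]: "num \<in> borel_measurable P"
    unfolding num_def
    by (rule \<Omega>.borel_measurable_nn_integral)
      (use likelihood_joint_measurable in \<open>simp add: case_prod_unfold\<close>)
  \<comment> \<open>The void probability for \<open>f0\<close> itself is 1: almost surely no point
    lies below \<open>f0\<close>.\<close>
  have ae: "AE p in P. \<forall>i. f0 (fst (p i)) \<le> snd (p i)"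
  proof -
    have "P.prob {p \<in> space P. \<forall>i. f0 (fst (p i)) \<le> snd (p i)} = 1"
      using prob_points_above[OF P f0(1) f0(1), of 0] by (simp add: set_lebesgue_integral_def)
    from P.AE_prob_1[OF this] show ?thesis by (auto elim: AE_mp)
  qed
  have num_le: "(\<integral>\<^sup>+f\<in>L1_far f0 r. likelihood n p f \<partial>?prior) \<le> num p" if p: "p \<in> space P" "p \<notin> T" for p
  proof -
    have "(\<integral>\<^sup>+f\<in>L1_far f0 r. likelihood n p f \<partial>?prior)
        \<le> (\<integral>\<^sup>+\<omega>. likelihood n p (X \<omega>) * indicator (L1_far f0 r) (X \<omega>) \<partial>\<Omega>)"
      by (rule nn_integral_distr_le[OF X])
    also have "\<dots> \<le> num p"
      unfolding num_def
    proof (rule nn_integral_mono)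
      fix \<omega> assume \<omega>: "\<omega> \<in> space \<Omega>"
      \<comment> \<open>Off \<open>T\<close>, a far path in the sieve that is compatible with the
        points must be far below \<open>f0\<close>: its bracket is compatible as well, so a large
        excess over \<open>f0\<close> would put \<open>p\<close> into \<open>T\<close>.\<close>
      have "\<omega> \<in> V" if far: "X \<omega> \<in> L1_far f0 r" and lik: "\<forall>i. X \<omega> (fst (p i)) \<le> snd (p i)"
      proof (rule ccontr)
        assume "\<omega> \<notin> V"
        then have "\<omega> \<in> S" and small: "(LINT x:{0..1}|lborel. max 0 (f0 x - X \<omega> x)) < r / 2"
          using \<omega> by (auto simp: V_def)
        then obtain l where l: "l \<in> LL" "\<And>x. x \<in> {0..1} \<Longrightarrow> l x \<le> X \<omega> x"
            "(LINT x:{0..1}|lborel. X \<omega> x - l x) \<le> r / 4"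
          using bracket by blast
        note int = path_integrable[OF \<omega> f0]
        have intl: "set_integrable lborel {0..1} l"
          by (rule bounded_set_integrable01[OF LL(2)[OF l(1)] LL(3)[OF l(1)]])
        have intlf: "set_integrable lborel {0..1} (\<lambda>x. max 0 (l x - f0 x))"
        proof (rule bounded_set_integrable01)
          show "\<bar>max 0 (l x - f0 x)\<bar> \<le> B + R" if "x \<in> {0..1}" for x
            using LL(3)[OF l(1) that] f0(2)[OF that] by linarith
        qed (use LL(2)[OF l(1)] in measurable)
        have "r \<le> (LINT x:{0..1}|lborel. \<bar>X \<omega> x - f0 x\<bar>)"
          using far by (simp add: L1_far_def L1_norm_def)
        also have "\<dots> = (LINT x:{0..1}|lborel. max 0 (f0 x - X \<omega> x) + max 0 (X \<omega> x - f0 x))"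
          by (intro set_lebesgue_integral_cong) auto
        also have "\<dots> = (LINT x:{0..1}|lborel. max 0 (f0 x - X \<omega> x)) + (LINT x:{0..1}|lborel. max 0 (X \<omega> x - f0 x))"
          by (intro set_integral_add int)
        finally have "r / 2 \<le> (LINT x:{0..1}|lborel. max 0 (X \<omega> x - f0 x))"
          using small by simp
        also have "\<dots> \<le> (LINT x:{0..1}|lborel. max 0 (l x - f0 x) + (X \<omega> x - l x))"
        proof (intro set_integral_mono set_integral_add set_integral_diff int intl intlf)
          show "max 0 (X \<omega> x - f0 x) \<le> max 0 (l x - f0 x) + (X \<omega> x - l x)" if "x \<in> {0..1}" for x
            using l(2)[OF that] by linarith
        qed
        also have "\<dots> = (LINT x:{0..1}|lborel. max 0 (l x - f0 x)) + (LINT x:{0..1}|lborel. X \<omega> x - l x)"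
          by (intro set_integral_add set_integral_diff int intl intlf)
        finally have "r / 4 \<le> (LINT x:{0..1}|lborel. max 0 (l x - f0 x))"
          using l(3) by simp
        moreover have "l (fst (p i)) \<le> snd (p i)" for i
          using l(2)[of "fst (p i)"] points_in_strip[OF P p(1), of i] lik by (force intro: order_trans)
        ultimately have "p \<in> T"
          using l(1) p(1) unfolding T_def by blast
        then show False using p(2) by simp
      qed
      then show "likelihood n p (X \<omega>) * indicator (L1_far f0 r) (X \<omega>) \<le> likelihood n p (X \<omega>) * indicator V \<omega>"
        by (auto simp: likelihood_def indicator_def)
    qed
    finally show ?thesis .
  qed
  have post: "AE p in P. posterior ?prior n p (L1_far f0 r) \<le> indicator T p + num p / ennreal d"
    using ae AE_space
  proof eventually_elim
    case (elim p)
    show ?case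
    proof (cases "p \<in> T")
      case True
      then show ?thesis using posterior_le_one[of ?prior n p "L1_far f0 r"] by (auto intro: add_increasing2)
    next
      case False
      have "posterior ?prior n p (L1_far f0 r) \<le> num p / ennreal d"
        unfolding posterior_def
      proof (rule ennreal_divide_mono[OF num_le _ d])
        show "ennreal d \<le> (\<integral>\<^sup>+f. likelihood n p f \<partial>?prior)"
          unfolding d_def by (rule evidence_lower_bound[where G = G]) (use elim G below int q in auto)
      qed (use elim False in auto)
      then show ?thesis using False by simp
    qed
  qed
  have T_le: "emeasure P T \<le> ennreal (real (card LL) * exp (- real n * r / 4))"
  proof -
    have "P.prob T \<le> (\<Sum>l\<in>{l \<in> LL. r / 4 \<le> (LINT x:{0..1}|lborel. max 0 (l x - f0 x))}.
        P.prob {p \<in> space P. \<forall>i. l (fst (p i)) \<le> snd (p i)})"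
      unfolding T_def using LL(1,2) above by (intro P.finite_measure_subadditive_finite) auto
    also have "\<dots> \<le> (\<Sum>l\<in>{l \<in> LL. r / 4 \<le> (LINT x:{0..1}|lborel. max 0 (l x - f0 x))}. exp (- real n * r / 4))"
    proof (rule sum_mono)
      fix l assume l: "l \<in> {l \<in> LL. r / 4 \<le> (LINT x:{0..1}|lborel. max 0 (l x - f0 x))}"
      have "\<bar>l x - f0 x\<bar> \<le> B + R" if "x \<in> {0..1}" for x
        using LL(3)[of l x] l f0(2)[OF that] that by auto
      from prob_points_above[OF P f0(1) _ this] LL(2) l
      have "P.prob {p \<in> space P. \<forall>i. l (fst (p i)) \<le> snd (p i)}
          = exp (- real n * (LINT x:{0..1}|lborel. max 0 (l x - f0 x)))" by simp
      also have "\<dots> \<le> exp (- real n * r / 4)"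
        using l mult_left_mono[of "r / 4" "LINT x:{0..1}|lborel. max 0 (l x - f0 x)" "real n"] by simp
      finally show "P.prob {p \<in> space P. \<forall>i. l (fst (p i)) \<le> snd (p i)} \<le> exp (- real n * r / 4)" .
    qed
    also have "\<dots> \<le> real (card LL) * exp (- real n * r / 4)"
      using LL(1) by (simp add: card_mono mult_right_mono)
    finally show ?thesis by (simp add: P.emeasure_eq_measure ennreal_leI)
  qed
  have num_int: "(\<integral>\<^sup>+p. num p \<partial>P) \<le> ennreal (exp (real n * ?I0) * (\<Omega>.prob (space \<Omega> - S) + exp (- real n * r / 2)))"
  proof -
    interpret pair_sigma_finite P \<Omega> ..
    have "(\<integral>\<^sup>+p. num p \<partial>P) = (\<integral>\<^sup>+\<omega>. \<integral>\<^sup>+p. likelihood n p (X \<omega>) * indicator V \<omega> \<partial>P \<partial>\<Omega>)"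
      unfolding num_def
      by (rule Fubini'[symmetric]) (use likelihood_joint_measurable in \<open>simp add: case_prod_unfold\<close>)
    also have "\<dots> \<le> (\<integral>\<^sup>+\<omega>. ennreal (exp (real n * ?I0)) * indicator (space \<Omega> - S) \<omega>
        + ennreal (exp (real n * ?I0) * exp (- real n * r / 2)) \<partial>\<Omega>)"
    proof (rule nn_integral_mono)
      fix \<omega> assume \<omega>: "\<omega> \<in> space \<Omega>"
      obtain A where A: "\<And>x. x \<in> {0..1} \<Longrightarrow> \<bar>X \<omega> x\<bar> \<le> A"
        using cadlag01_bounded[OF X_cadlag[OF \<omega>]] by metis
      let ?J = "LINT x:{0..1}|lborel. max 0 (f0 x - X \<omega> x)"
      have meas: "(\<lambda>p. likelihood n p (X \<omega>)) \<in> borel_measurable P"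
        using measurable_compose[OF measurable_Pair2'[OF \<omega>] likelihood_joint_measurable] by simp
      have "(\<integral>\<^sup>+p. likelihood n p (X \<omega>) * indicator V \<omega> \<partial>P)
          = ennreal (exp (real n * ?I0 - real n * ?J)) * indicator V \<omega>"
        using expected_likelihood[OF P f0 path_measurable[OF \<omega>] A]
        by (simp add: nn_integral_multc[OF meas])
      also have "\<dots> \<le> ennreal (exp (real n * ?I0)) * indicator (space \<Omega> - S) \<omega>
        + ennreal (exp (real n * ?I0) * exp (- real n * r / 2))"
      proof (cases "\<omega> \<in> S")
        case True
        have "exp (real n * ?I0 - real n * ?J) \<le> exp (real n * ?I0) * exp (- real n * r / 2)" if "\<omega> \<in> V"
        proof -
          have "real n * (r / 2) \<le> real n * ?J"
            using True that by (intro mult_left_mono) (auto simp: V_def)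
          then show ?thesis by (simp add: exp_add[symmetric])
        qed
        then show ?thesis using True by (auto simp: indicator_def intro!: ennreal_leI)
      next
        case False
        \<comment> \<open>Outside the sieve nothing is known about the shape of the path. Only the
          sign of \<open>?J\<close> is used, and the smallness comes from the prior probability of
          the complement.\<close>
        have "exp (real n * ?I0 - real n * ?J) \<le> exp (real n * ?I0)"
          using set_integral_pos_part_nonneg[where f = "\<lambda>x. f0 x - X \<omega> x" and A = "{0..1}" and M = lborel] by simp
        then show ?thesis using False \<omega> by (auto simp: indicator_def intro!: ennreal_leI add_increasing2)
      qed
      finally show "(\<integral>\<^sup>+p. likelihood n p (X \<omega>) * indicator V \<omega> \<partial>P)
        \<le> ennreal (exp (real n * ?I0)) * indicator (space \<Omega> - S) \<omega>
          + ennreal (exp (real n * ?I0) * exp (- real n * r / 2))" .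
    qed
    also have "\<dots> = ennreal (exp (real n * ?I0)) * emeasure \<Omega> (space \<Omega> - S)
        + ennreal (exp (real n * ?I0) * exp (- real n * r / 2))"
      by (subst nn_integral_add) (auto simp: nn_integral_cmult_indicator \<Omega>.emeasure_space_1)
    also have "\<dots> = ennreal (exp (real n * ?I0) * (\<Omega>.prob (space \<Omega> - S) + exp (- real n * r / 2)))"
      by (simp add: \<Omega>.emeasure_eq_measure ennreal_mult'[symmetric] ennreal_plus[symmetric] distrib_left
          del: ennreal_plus)
    finally show ?thesis .
  qed
  have "(\<integral>\<^sup>+p. posterior ?prior n p (L1_far f0 r) \<partial>P) \<le> (\<integral>\<^sup>+p. indicator T p + num p / ennreal d \<partial>P)"
    by (rule nn_integral_mono_AE[OF post])
  also have "\<dots> = emeasure P T + (\<integral>\<^sup>+p. num p \<partial>P) / ennreal d"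
    by (subst nn_integral_add) (auto simp: nn_integral_divide)
  also have "\<dots> \<le> ennreal (real (card LL) * exp (- real n * r / 4))
      + ennreal (exp (real n * ?I0) * (\<Omega>.prob (space \<Omega> - S) + exp (- real n * r / 2))) / ennreal d"
    by (intro add_mono T_le divide_right_mono_ennreal num_int)
  also have "\<dots> = ennreal (real (card LL) * exp (- real n * r / 4)
      + exp (real n * ?I0) * (\<Omega>.prob (space \<Omega> - S) + exp (- real n * r / 2)) / d)"
    using d by (simp add: divide_ennreal ennreal_plus[symmetric] del: ennreal_plus)
  also have "exp (real n * ?I0) * (\<Omega>.prob (space \<Omega> - S) + exp (- real n * r / 2)) / d
      = (\<Omega>.prob (space \<Omega> - S) + exp (- real n * r / 2)) * exp (real n * e0) / q"
    using q(1) by (simp add: d_def right_diff_distrib exp_diff)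
  finally show ?thesis .
qed

end

section \<open>Brackets for step functions\<close>

text \<open>One entry per level of the path: the left and right grid point of an interval and a
  height above \<open>- V\<close> in units of \<open>1 / m\<close>. Coding all three by integers
  makes the family finite and its size explicit.\<close>

definition bracket_index :: "nat \<Rightarrow> nat \<Rightarrow> real \<Rightarrow> (nat \<Rightarrow> nat \<times> nat \<times> nat) set" where
  "bracket_index m J V = (\<Pi>\<^sub>E k\<in>{..J}. {..m} \<times> {..m} \<times> {..nat \<lfloor>2 * V * real m\<rfloor>})"

definition bracket_fun :: "nat \<Rightarrow> nat \<Rightarrow> real \<Rightarrow> (nat \<Rightarrow> nat \<times> nat \<times> nat) \<Rightarrow> real \<Rightarrow> real" where
  "bracket_fun m J V \<theta> x = - V + (\<Sum>k\<le>J. case \<theta> k of (a, b, c) \<Rightarrow>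
     real c / real m * indicator {real a / real m..<real b / real m} x)"

lemma finite_bracket_index: "finite (bracket_index m J V)"
  unfolding bracket_index_def by (intro finite_PiE) auto

lemma card_bracket_index:
  "card (bracket_index m J V) = ((m + 1)\<^sup>2 * (nat \<lfloor>2 * V * real m\<rfloor> + 1)) ^ (J + 1)"
  unfolding bracket_index_def
  by (simp only: card_PiE finite_atMost card_cartesian_product card_atMost prod_constant
      power2_eq_square mult.assoc Suc_eq_plus1)

lemma bracket_fun_measurable [measurable]: "bracket_fun m J V \<theta> \<in> borel_measurable borel"
  unfolding bracket_fun_def case_prod_unfold by measurable

text \<open>The intervals of an arbitrary index may overlap, so the heights are simply added up. The
  purpose of this crude bound is integrability.\<close>

lemma bracket_fun_bounded:
  assumes "\<theta> \<in> bracket_index m J V"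
  shows "\<bar>bracket_fun m J V \<theta> x\<bar> \<le> \<bar>V\<bar> + real (J + 1) * (real (nat \<lfloor>2 * V * real m\<rfloor>) / real m)"
proof -
  have "\<bar>case \<theta> k of (a, b, c) \<Rightarrow> real c / real m * indicator {real a / real m..<real b / real m} x\<bar>
      \<le> real (nat \<lfloor>2 * V * real m\<rfloor>) / real m" if "k \<le> J" for k
  proof -
    have "\<theta> k \<in> {..m} \<times> {..m} \<times> {..nat \<lfloor>2 * V * real m\<rfloor>}"
      using assms that unfolding bracket_index_def by (blast dest: PiE_mem)
    then show ?thesis
      by (auto simp: indicator_def divide_right_mono split: prod.splits)
  qed
  then have "(\<Sum>k\<le>J. \<bar>case \<theta> k of (a, b, c) \<Rightarrow> real c / real m * indicator {real a / real m..<real b / real m} x\<bar>)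
      \<le> real (card {..J}) * (real (nat \<lfloor>2 * V * real m\<rfloor>) / real m)"
    by (intro sum_bounded_above) auto
  with sum_abs[of "\<lambda>k. case \<theta> k of (a, b, c) \<Rightarrow> real c / real m * indicator {real a / real m..<real b / real m} x" "{..J}"]
  have "\<bar>\<Sum>k\<le>J. case \<theta> k of (a, b, c) \<Rightarrow> real c / real m * indicator {real a / real m..<real b / real m} x\<bar>
      \<le> real (J + 1) * (real (nat \<lfloor>2 * V * real m\<rfloor>) / real m)"
    by (simp only: card_atMost Suc_eq_plus1)
  then show ?thesis unfolding bracket_fun_def by linarith
qed

lemma set_integral_indicator_Ico:
  fixes a b :: real
  assumes "0 \<le> a" "a \<le> b" "b \<le> 1"
  shows "set_integrable lborel {0..1} (\<lambda>x. indicator {a..<b} x :: real)"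
    "(LINT x:{0..1}|lborel. indicator {a..<b} x :: real) = b - a"
proof -
  have eq: "(\<lambda>x. indicator {0..1} x *\<^sub>R (indicator {a..<b} x :: real)) = indicator {a..<b}"
    using assms by (auto simp: fun_eq_iff indicator_def)
  show "set_integrable lborel {0..1} (\<lambda>x. indicator {a..<b} x :: real)"
    unfolding set_integrable_def eq using assms by (auto simp: integrable_indicator_iff)
  show "(LINT x:{0..1}|lborel. indicator {a..<b} x :: real) = b - a"
    unfolding set_lebesgue_integral_def eq using assms by simp
qed

lemma set_integral_finite_sum:
  fixes f :: "'i \<Rightarrow> 'a \<Rightarrow> real"
  assumes "\<And>i. i \<in> I \<Longrightarrow> set_integrable M A (f i)"
  shows "set_integrable M A (\<lambda>x. \<Sum>i\<in>I. f i x)"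
    "(LINT x:A|M. \<Sum>i\<in>I. f i x) = (\<Sum>i\<in>I. LINT x:A|M. f i x)"
  using assms unfolding set_integrable_def set_lebesgue_integral_def
  by (simp_all add: sum_distrib_left)

text \<open>For each value \<open>k\<close> of the counting function the bracket keeps the largest interval between
  grid points on which the path takes its \<open>k\<close>-th value. The grid cells not covered contain a jump,
  so there are at most \<open>J\<close> of them.\<close>

lemma step_function_bracket:
  fixes N :: "real \<Rightarrow> nat" and \<phi> :: "nat \<Rightarrow> real"
  assumes mono: "mono_on {0..} N" and NJ: "N 1 \<le> J" and V: "\<And>k. k \<le> J \<Longrightarrow> \<bar>\<phi> k\<bar> \<le> V"
    and m: "m > 0" and int: "set_integrable lborel {0..1} (\<lambda>x. \<phi> (N x))"
  shows "\<exists>\<theta>\<in>bracket_index m J V. (\<forall>x\<in>{0..1}. bracket_fun m J V \<theta> x \<le> \<phi> (N x)) \<and>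
    (LINT x:{0..1}|lborel. \<phi> (N x) - bracket_fun m J V \<theta> x) \<le> (1 + 2 * V * real J) / real m"
proof -
  define I where "I k = {i. i \<le> m \<and> N (real i / real m) = k}" for k
  \<comment> \<open>If no grid point has count \<open>k\<close>, then \<open>a k = b k = 0\<close>
    and the interval is empty.\<close>
  define a where "a k = (if I k = {} then 0 else Min (I k))" for k
  define b where "b k = (if I k = {} then 0 else Max (I k))" for k
  define c where "c k = nat \<lfloor>real m * (\<phi> k + V)\<rfloor>" for k
  define \<theta> where "\<theta> = (\<lambda>k\<in>{..J}. (a k, b k, c k))"
  let ?l = "bracket_fun m J V \<theta>"
  have V0: "0 \<le> V" using V[of 0] by simp
  have mr: "0 < real m" using m by simp
  have N_mono: "N x \<le> N y" if "0 \<le> x" "x \<le> y" for x y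
    using mono_onD[OF mono, of x y] that by simp
  have finI: "finite (I k)" for k by (rule finite_subset[of _ "{..m}"]) (auto simp: I_def)
  have ab_m: "a k \<le> m" "b k \<le> m" for k
    using Min_in[OF finI, of k] Max_in[OF finI, of k] by (auto simp: a_def b_def I_def)
  have c_le: "c k \<le> nat \<lfloor>2 * V * real m\<rfloor>" if "k \<le> J" for k
  proof -
    have "real m * (\<phi> k + V) \<le> real m * (2 * V)"
      using V[OF that] by (intro mult_left_mono) auto
    then show ?thesis unfolding c_def by (intro nat_mono floor_mono) (simp add: mult_ac)
  qed
  have c_bounds: "real (c k) / real m \<le> \<phi> k + V" "\<phi> k + V \<le> real (c k) / real m + 1 / real m" if "k \<le> J" for k
  proof -
    have "0 \<le> real m * (\<phi> k + V)" using V[OF that] by (intro mult_nonneg_nonneg) auto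
    then have "real (c k) = real_of_int \<lfloor>real m * (\<phi> k + V)\<rfloor>" by (simp add: c_def)
    then have "real (c k) \<le> real m * (\<phi> k + V)" "real m * (\<phi> k + V) \<le> real (c k) + 1" by linarith+
    then show "real (c k) / real m \<le> \<phi> k + V" "\<phi> k + V \<le> real (c k) / real m + 1 / real m"
      using mr by (simp_all add: field_simps)
  qed
  have \<theta>: "\<theta> \<in> bracket_index m J V"
    unfolding \<theta>_def bracket_index_def using ab_m c_le by (auto simp: restrict_PiE_iff)
  have unique: "N x = k" if x: "real (a k) / real m \<le> x" "x < real (b k) / real m" for k x
  proof -
    have ne: "I k \<noteq> {}" using x by (auto simp: a_def b_def)
    have "N (real (a k) / real m) = k" "N (real (b k) / real m) = k"
      using Min_in[OF finI ne] Max_in[OF finI ne] ne by (auto simp: a_def b_def I_def)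
    moreover have "N (real (a k) / real m) \<le> N x" "N x \<le> N (real (b k) / real m)"
      using x by (auto intro!: N_mono intro: order_trans[of 0 "real (a k) / real m"])
    ultimately show ?thesis by simp
  qed
  have l_eq: "?l x = - V + real (c (N x)) / real m * indicator {real (a (N x)) / real m..<real (b (N x)) / real m} x"
    if x: "x \<in> {0..1}" for x
  proof -
    have "N x \<le> J" using N_mono[of x 1] NJ x by auto
    have "?l x = - V + (\<Sum>k\<le>J. real (c k) / real m * indicator {real (a k) / real m..<real (b k) / real m} x)"
      by (simp add: bracket_fun_def \<theta>_def)
    also have "(\<Sum>k\<le>J. real (c k) / real m * indicator {real (a k) / real m..<real (b k) / real m} x)
        = (\<Sum>k\<in>{N x}. real (c k) / real m * indicator {real (a k) / real m..<real (b k) / real m} x)"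
      using \<open>N x \<le> J\<close> unique by (intro sum.mono_neutral_right) (auto simp: indicator_def)
    finally show ?thesis by simp
  qed
  define bad where "bad = {i. i < m \<and> N (real i / real m) \<noteq> N (real (Suc i) / real m)}"
  \<comment> \<open>A majorant of the gap: the rounding error of the height, the full range
    \<open>2 * V\<close> on the cells containing a jump, and the point 1, which no half-open cell
    contains and which is a null set.\<close>
  define u where "u x = 1 / real m + 2 * V * (\<Sum>i\<in>bad. indicator {real i / real m..<real (Suc i) / real m} x)
      + 2 * V * indicator {1} x" for x :: real
  have fin_bad: "finite bad" by (rule finite_subset[of _ "{..<m}"]) (auto simp: bad_def)
  have card_bad: "card bad \<le> J"
  proof -
    \<comment> \<open>Every bad cell uses up at least one unit of the total increase of
      \<open>N\<close>, which telescopes to at most \<open>J\<close>.\<close>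
    have "card bad = (\<Sum>i\<in>bad. 1)" by simp
    also have "\<dots> \<le> (\<Sum>i\<in>bad. N (real (Suc i) / real m) - N (real i / real m))"
    proof (rule sum_mono)
      fix i assume "i \<in> bad"
      moreover have "N (real i / real m) \<le> N (real (Suc i) / real m)"
        by (intro N_mono divide_right_mono) auto
      ultimately show "1 \<le> N (real (Suc i) / real m) - N (real i / real m)"
        by (auto simp: bad_def)
    qed
    also have "\<dots> \<le> (\<Sum>i<m. N (real (Suc i) / real m) - N (real i / real m))"
      by (intro sum_mono2) (auto simp: bad_def)
    also have "\<dots> = N (real m / real m) - N (real 0 / real m)"
    proof -
      have "(\<Sum>i<j. N (real (Suc i) / real m) - N (real i / real m)) = N (real j / real m) - N (real 0 / real m)" for j
      proof (induction j)
        case (Suc j)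
        have "N (real 0 / real m) \<le> N (real j / real m)" "N (real j / real m) \<le> N (real (Suc j) / real m)"
          by (intro N_mono divide_right_mono; simp)+
        then show ?case using Suc by simp
      qed simp
      then show ?thesis .
    qed
    also have "\<dots> \<le> J" using NJ mr by simp
    finally show ?thesis .
  qed
  have main: "?l x \<le> \<phi> (N x) \<and> \<phi> (N x) - ?l x \<le> u x" if x: "x \<in> {0..1}" for x
  proof -
    have k: "N x \<le> J" using N_mono[of x 1] NJ x by auto
    have ind: "0 \<le> (\<Sum>i\<in>bad. indicator {real i / real m..<real (Suc i) / real m} x :: real)"
      by (intro sum_nonneg) auto
    have crude: "\<phi> (N x) - ?l x \<le> 2 * V"
    proof -
      have "- V \<le> ?l x" using l_eq[OF x] by (simp add: indicator_def)
      then show ?thesis using V[OF k] by linarith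
    qed
    have "?l x \<le> \<phi> (N x)"
      using l_eq[OF x] c_bounds(1)[OF k] V[OF k] by (auto simp: indicator_def)
    moreover have "\<phi> (N x) - ?l x \<le> u x"
    proof (cases "x = 1")
      case True
      have "0 \<le> 2 * V * (\<Sum>i\<in>bad. indicator {real i / real m..<real (Suc i) / real m} x)"
        using ind V0 by (intro mult_nonneg_nonneg) auto
      moreover have "0 \<le> 1 / real m" by simp
      moreover have "u x = 1 / real m + 2 * V * (\<Sum>i\<in>bad. indicator {real i / real m..<real (Suc i) / real m} x) + 2 * V"
        using True by (simp add: u_def)
      ultimately show ?thesis using crude by linarith
    next
      case False
      define i where "i = nat \<lfloor>real m * x\<rfloor>"
      have ri: "real i = real_of_int \<lfloor>real m * x\<rfloor>" using x by (simp add: i_def)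
      then have "real i \<le> real m * x" "real m * x < real i + 1" by linarith+
      then have ix: "real i / real m \<le> x" "x < real (Suc i) / real m"
        using mr by (simp_all add: field_simps)
      have "real i < real m"
        using \<open>real i \<le> real m * x\<close> False x mr by (smt (verit) atLeastAtMost_iff mult_less_cancel_left2)
      then have im: "i < m" by simp
      show ?thesis
      proof (cases "i \<in> bad")
        case True
        then have "1 \<le> (\<Sum>i\<in>bad. indicator {real i / real m..<real (Suc i) / real m} x :: real)"
          using ix member_le_sum[of i bad "\<lambda>i. indicator {real i / real m..<real (Suc i) / real m} x :: real"] fin_bad
          by auto
        then have "2 * V * 1 \<le> 2 * V * (\<Sum>i\<in>bad. indicator {real i / real m..<real (Suc i) / real m} x)"
          using V0 by (intro mult_left_mono) auto
        moreover have "0 \<le> 1 / real m + 2 * V * indicator {1} x" using V0 by simp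
        ultimately show ?thesis using crude unfolding u_def by linarith
      next
        case False
        have "N (real i / real m) \<le> N x" "N x \<le> N (real (Suc i) / real m)"
          using ix x by (auto intro!: N_mono)
        then have "N (real i / real m) = N x" "N (real (Suc i) / real m) = N x"
          using False im by (auto simp: bad_def)
        then have "i \<in> I (N x)" "Suc i \<in> I (N x)" using im by (auto simp: I_def)
        then have "a (N x) \<le> i" "Suc i \<le> b (N x)"
          using finI by (auto simp: a_def b_def)
        then have "real (a (N x)) / real m \<le> real i / real m" "real (Suc i) / real m \<le> real (b (N x)) / real m"
          by (auto intro!: divide_right_mono)
        then have "x \<in> {real (a (N x)) / real m..<real (b (N x)) / real m}" using ix by auto
        then have "\<phi> (N x) - ?l x \<le> 1 / real m"
          using l_eq[OF x] c_bounds(2)[OF k] by simp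
        moreover have "0 \<le> 2 * V * (\<Sum>i\<in>bad. indicator {real i / real m..<real (Suc i) / real m} x)
            + 2 * V * indicator {1} x"
          using V0 ind by simp
        ultimately show ?thesis unfolding u_def by linarith
      qed
    qed
    ultimately show ?thesis by simp
  qed
  have int_l: "set_integrable lborel {0..1} ?l"
    by (rule bounded_set_integrable01[OF bracket_fun_measurable bracket_fun_bounded[OF \<theta>]])
  have cell: "0 \<le> real i / real m" "real i / real m \<le> real (Suc i) / real m" "real (Suc i) / real m \<le> 1"
    if "i \<in> bad" for i
    using that mr by (auto simp: bad_def divide_right_mono)
  have int_sum: "set_integrable lborel {0..1} (\<lambda>x. \<Sum>i\<in>bad. indicator {real i / real m..<real (Suc i) / real m} x :: real)"
    by (intro set_integral_finite_sum set_integral_indicator_Ico cell)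
  have int_1: "set_integrable lborel {0..1} (\<lambda>x. indicator {1 :: real} x :: real)"
    by (rule bounded_set_integrable01[where B = 1]) (auto simp: indicator_def)
  have int_c: "set_integrable lborel {0..1} (\<lambda>x :: real. k :: real)" for k
    by (rule bounded_set_integrable01[where B = "\<bar>k\<bar>"]) auto
  have int_u: "set_integrable lborel {0..1} u"
    unfolding u_def by (intro set_integral_add set_integrable_mult_right int_sum int_1 int_c)
  have "(LINT x:{0..1}|lborel. \<phi> (N x) - ?l x) \<le> (LINT x:{0..1}|lborel. u x)"
    using main by (intro set_integral_mono set_integral_diff int int_l int_u) auto
  also have "(LINT x:{0..1}|lborel. u x) = 1 / real m + 2 * V * (\<Sum>i\<in>bad. 1 / real m)"
  proof -
    have "(LINT x:{0..1}|lborel. indicator {1 :: real} x :: real) = 0"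
    proof -
      have "(\<lambda>x. indicator {0..1} x *\<^sub>R indicator {1 :: real} x :: real) = indicator {1}"
        by (auto simp: indicator_def)
      then show ?thesis by (simp add: set_lebesgue_integral_def)
    qed
    moreover have "(LINT x:{0..1}|lborel. \<Sum>i\<in>bad. indicator {real i / real m..<real (Suc i) / real m} x :: real)
        = (\<Sum>i\<in>bad. 1 / real m)"
    proof (subst set_integral_finite_sum(2))
      show "(\<Sum>i\<in>bad. LINT x:{0..1}|lborel. indicator {real i / real m..<real (Suc i) / real m} x)
          = (\<Sum>i\<in>bad. 1 / real m)"
        by (intro sum.cong refl, subst set_integral_indicator_Ico(2)[OF cell])
          (auto simp: diff_divide_distrib[symmetric])
    qed (intro set_integral_indicator_Ico cell)
    moreover have "(LINT x:{0..1}|lborel. u x) = (LINT x:{0..1::real}|lborel. 1 / real m)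
      + 2 * V * (LINT x:{0..1}|lborel. \<Sum>i\<in>bad. indicator {real i / real m..<real (Suc i) / real m} x)
      + 2 * V * (LINT x:{0..1}|lborel. indicator {1::real} x)"
      unfolding u_def
      by (simp only: set_integral_add set_integrable_mult_right set_integral_mult_right int_sum int_1 int_c)
    moreover have "(LINT x:{0..1::real}|lborel. 1 / real m) = 1 / real m"
      by (simp add: set_lebesgue_integral_def)
    ultimately show ?thesis by (simp only: mult_zero_right add_0_right)
  qed
  also have "\<dots> \<le> (1 + 2 * V * real J) / real m"
    using card_bad V0 mr by (simp add: add_divide_distrib divide_right_mono mult_left_mono)
  finally show ?thesis
    using \<theta> main by blast
qed

section \<open>Prior mass below the true function\<close>

lemma sets_Collect_nat_diff_eq:
  fixes f g :: "'a \<Rightarrow> nat"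
  assumes [measurable]: "f \<in> measurable M (count_space UNIV)" "g \<in> measurable M (count_space UNIV)"
  shows "{x \<in> space M. f x - g x = k} \<in> sets M"
  by measurable

locale compound_poisson =
  fixes \<Omega> :: "'w measure" and N :: "real \<Rightarrow> 'w \<Rightarrow> nat" and \<Delta> :: "nat \<Rightarrow> 'w \<Rightarrow> real" and lam :: real
  assumes lam: "lam > 0"
    and poisson: "poisson_process \<Omega> lam N"
    and indep: "cpp_independent \<Omega> N \<Delta>"
begin

sublocale prob_space \<Omega> by (rule poisson_processD(1)[OF poisson])

lemmas N_measurable = poisson_processD(2)[OF poisson]
  and N_0 = poisson_processD(3)[OF poisson]
  and N_mono = poisson_processD(4)[OF poisson]

lemma jumps_indep: "indep_vars (\<lambda>_. borel) \<Delta> UNIV"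
  using indep by (simp add: cpp_independent_def)

lemma jump_measurable [measurable]: "\<Delta> i \<in> borel_measurable \<Omega>"
  using jumps_indep by (auto simp: indep_vars_def2)

lemmas path_measurable = cpp_path_measurable[OF poisson jump_measurable]
  and path_joint = cpp_path_joint_measurable[OF poisson jump_measurable]
  and path_cadlag = cpp_path_cadlag01[OF poisson]

section \<open>Joint law of increments and jumps\<close>

lemma prob_increments:
  assumes m: "m > 0"
  shows "prob {\<omega> \<in> space \<Omega>. \<forall>j<m. N (real (Suc j) / real m) \<omega> - N (real j / real m) \<omega> = e j}
    = (\<Prod>j<m. (lam / real m) ^ e j / fact (e j) * exp (- (lam / real m)))"
proof -
  let ?D = "\<lambda>j \<omega>. N (real (Suc j) / real m) \<omega> - N (real j / real m) \<omega>"
  have "incseq (\<lambda>j. real j / real m)"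
    by (intro incseq_SucI divide_right_mono) auto
  then have ind: "indep_vars (\<lambda>_::nat. count_space UNIV) ?D UNIV"
    using poisson_processD(7)[OF poisson, of "\<lambda>j. real j / real m"] by simp
  have "{\<omega> \<in> space \<Omega>. \<forall>j<m. ?D j \<omega> = e j} = (\<Inter>j\<in>{..<m}. ?D j -` {e j} \<inter> space \<Omega>)"
    using m by auto
  also have "prob \<dots> = (\<Prod>j<m. prob (?D j -` {e j} \<inter> space \<Omega>))"
    using m by (intro indep_varsD[OF ind]) auto
  also have "\<dots> = (\<Prod>j<m. (lam / real m) ^ e j / fact (e j) * exp (- (lam / real m)))"
  proof (rule prod.cong[OF refl])
    fix j
    have mD: "?D j \<in> measurable \<Omega> (count_space UNIV)"
      using ind by (auto simp: indep_vars_def2)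
    have "prob (?D j -` {e j} \<inter> space \<Omega>) = measure (distr \<Omega> (count_space UNIV) (?D j)) {e j}"
      by (subst measure_distr[OF mD]) auto
    also have "distr \<Omega> (count_space UNIV) (?D j)
        = measure_pmf (poisson_pmf (lam * (real (Suc j) / real m - real j / real m)))"
      using m by (intro poisson_processD(6)[OF poisson]) (auto simp: divide_strict_right_mono)
    also have "lam * (real (Suc j) / real m - real j / real m) = lam / real m"
      using m by (simp add: diff_divide_distrib[symmetric])
    finally show "prob (?D j -` {e j} \<inter> space \<Omega>) = (lam / real m) ^ e j / fact (e j) * exp (- (lam / real m))"
      using lam m by (simp add: measure_pmf_single)
  qed
  finally show ?thesis .
qed

text \<open>Independence of the counting process and the jumps is given for the \<sigma>-algebras
  generated by the two whole families, so each of the two events is located in its own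
  \<sigma>-algebra before the probability is factorized.\<close>

lemma prob_increments_jumps:
  fixes e :: "nat \<Rightarrow> nat" and q :: nat and I :: "nat \<Rightarrow> real set"
  assumes m: "m > 0" and I: "\<And>k. I k \<in> sets borel"
  defines "E \<equiv> {\<omega> \<in> space \<Omega>. (\<forall>j<m. N (real (Suc j) / real m) \<omega> - N (real j / real m) \<omega> = e j) \<and> (\<forall>k\<le>q. \<Delta> k \<omega> \<in> I k)}"
  shows "E \<in> sets \<Omega>"
    and "prob E = (\<Prod>j<m. (lam / real m) ^ e j / fact (e j) * exp (- (lam / real m))) *
      (\<Prod>k\<le>q. prob {\<omega> \<in> space \<Omega>. \<Delta> k \<omega> \<in> I k})"
proof -
  let ?VN = "vimage_algebra (space \<Omega>) (\<lambda>\<omega>. \<lambda>t\<in>{0..}. N t \<omega>) (Pi\<^sub>M {0..} (\<lambda>_. count_space UNIV))"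
  let ?VD = "vimage_algebra (space \<Omega>) (\<lambda>\<omega> i. \<Delta> i \<omega>) (Pi\<^sub>M UNIV (\<lambda>_. borel :: real measure))"
  define EN where "EN = {\<omega> \<in> space \<Omega>. \<forall>j<m. N (real (Suc j) / real m) \<omega> - N (real j / real m) \<omega> = e j}"
  define ED where "ED = {\<omega> \<in> space \<Omega>. \<forall>k\<le>q. \<Delta> k \<omega> \<in> I k}"
  have "(\<lambda>\<omega>. \<lambda>t\<in>{0..}. N t \<omega>) \<in> measurable ?VN (Pi\<^sub>M {0..} (\<lambda>_. count_space UNIV))"
    by (rule measurable_vimage_algebra1) (auto simp: space_PiM)
  from measurable_compose[OF this measurable_component_singleton]
  have Nt: "N t \<in> measurable ?VN (count_space UNIV)" if "0 \<le> t" for t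
    using that by simp
  have "{\<omega> \<in> space ?VN. \<forall>j\<in>{..<m}. N (real (Suc j) / real m) \<omega> - N (real j / real m) \<omega> = e j} \<in> sets ?VN"
  proof (rule sets.sets_Collect_finite_All)
    fix j
    show "{\<omega> \<in> space ?VN. N (real (Suc j) / real m) \<omega> - N (real j / real m) \<omega> = e j} \<in> sets ?VN"
      by (rule sets_Collect_nat_diff_eq) (rule Nt, simp)+
  qed simp
  then have EN: "EN \<in> sets ?VN" unfolding EN_def by (simp only: space_vimage_algebra lessThan_iff Ball_def)
  have "(\<lambda>\<omega> i. \<Delta> i \<omega>) \<in> measurable ?VD (Pi\<^sub>M UNIV (\<lambda>_. borel))"
    by (rule measurable_vimage_algebra1) (auto simp: space_PiM)
  from measurable_compose[OF this measurable_component_singleton]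
  have Dk: "\<Delta> k \<in> measurable ?VD borel" for k by simp
  have "{\<omega> \<in> space ?VD. \<forall>k\<in>{..q}. \<Delta> k \<omega> \<in> I k} \<in> sets ?VD"
  proof (rule sets.sets_Collect_finite_All)
    fix k
    show "{\<omega> \<in> space ?VD. \<Delta> k \<omega> \<in> I k} \<in> sets ?VD"
      using measurable_sets[OF Dk I] by (simp add: vimage_def Int_def conj_commute)
  qed simp
  then have ED: "ED \<in> sets ?VD" unfolding ED_def by (simp only: space_vimage_algebra atMost_iff Ball_def)
  have E_eq: "E = EN \<inter> ED" by (auto simp: E_def EN_def ED_def)
  have prob_E: "prob E = prob EN * prob ED"
    unfolding E_eq using indep EN ED unfolding cpp_independent_def by (blast intro: indep_setD)
  have "ED = (\<Inter>k\<in>{..q}. \<Delta> k -` I k \<inter> space \<Omega>)" by (auto simp: ED_def)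
  also have "prob \<dots> = (\<Prod>k\<le>q. prob (\<Delta> k -` I k \<inter> space \<Omega>))"
    using I by (intro indep_varsD[OF jumps_indep]) auto
  also have "\<dots> = (\<Prod>k\<le>q. prob {\<omega> \<in> space \<Omega>. \<Delta> k \<omega> \<in> I k})"
    by (intro prod.cong refl arg_cong[where f = prob]) auto
  finally show "prob E = (\<Prod>j<m. (lam / real m) ^ e j / fact (e j) * exp (- (lam / real m))) *
      (\<Prod>k\<le>q. prob {\<omega> \<in> space \<Omega>. \<Delta> k \<omega> \<in> I k})"
    using prob_increments[OF m, of e] prob_E by (simp add: EN_def)
  have "EN \<in> events" "ED \<in> events"
    using indep_setD_ev1 indep_setD_ev2 indep EN ED unfolding cpp_independent_def by blast+
  then show "E \<in> sets \<Omega>" unfolding E_eq by blast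
qed

lemma prob_jump_in_interval:
  assumes D: "distributed \<Omega> lborel (\<Delta> k) (\<lambda>x. ennreal (g x))"
    and a: "0 \<le> a" "\<And>x. x \<in> {l..l + s} \<Longrightarrow> a \<le> g x" and s: "0 \<le> s"
  shows "a * s \<le> prob {\<omega> \<in> space \<Omega>. \<Delta> k \<omega> \<in> {l..l + s}}"
proof -
  have "ennreal (a * s) = (\<integral>\<^sup>+x. ennreal a * indicator {l..l + s} x \<partial>lborel)"
    using a s by (subst nn_integral_cmult_indicator) (auto simp: ennreal_mult')
  also have "\<dots> \<le> (\<integral>\<^sup>+x. ennreal (g x) * indicator {l..l + s} x \<partial>lborel)"
    using a by (intro nn_integral_mono) (auto simp: indicator_def intro!: ennreal_leI)
  also have "\<dots> = emeasure \<Omega> (\<Delta> k -` {l..l + s} \<inter> space \<Omega>)"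
    by (rule distributed_emeasure[OF D, symmetric]) simp
  finally show ?thesis
    by (simp add: emeasure_eq_measure vimage_def Int_def conj_commute)
qed

end

section \<open>Paths following a prescribed staircase\<close>

text \<open>A path is described by a count and by the successive values of its partial sums, whereas
  \<open>w\<close> is indexed by grid points. Here \<open>c i\<close> counts the changes of
  \<open>w\<close> up to \<open>i\<close>, and \<open>u\<close> lists the levels in order. By the
  last fact every step of \<open>u\<close> is a step of \<open>w\<close> between neighbouring grid
  points, so bounds on the latter pass to the jumps.\<close>

lemma staircase_counting:
  fixes w :: "nat \<Rightarrow> real" and m :: nat
  obtains c :: "nat \<Rightarrow> nat" and u :: "nat \<Rightarrow> real" where
    "c 0 = 0" "\<And>i. c (Suc i) = c i + (if w (Suc i) \<noteq> w i then 1 else 0)"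
    "c m = card {i \<in> {1..m}. w i \<noteq> w (i - 1)}"
    "\<And>i. i \<le> m \<Longrightarrow> u (c i) = w i"
    "\<And>k. 1 \<le> k \<Longrightarrow> k \<le> c m \<Longrightarrow> \<exists>i\<in>{1..m}. u k = w i \<and> u (k - 1) = w (i - 1)"
proof -
  define c where "c i = (\<Sum>j<i. if w (Suc j) \<noteq> w j then 1 else 0 :: nat)" for i
  have c0: "c 0 = 0" and cS: "c (Suc i) = c i + (if w (Suc i) \<noteq> w i then 1 else 0)" for i
    by (auto simp: c_def)
  have c_mono: "i \<le> j \<Longrightarrow> c i \<le> c j" for i j
    unfolding c_def by (intro sum_mono2) auto
  have const: "i \<le> j \<Longrightarrow> c i = c j \<Longrightarrow> w i = w j" for i j
  proof (induction j rule: dec_induct)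
    case (step j)
    have "c i \<le> c j" "c j \<le> c (Suc j)" using step.hyps by (simp_all add: c_mono)
    then have "c j = c i" "c (Suc j) = c j" using step.prems by auto
    then have "w i = w j" "w (Suc j) = w j" using step.IH cS[of j] by (simp_all split: if_splits)
    then show ?case by simp
  qed simp
  \<comment> \<open>The first grid index at which \<open>k\<close> changes have occurred; minimality
    places the \<open>k\<close>-th change between \<open>L k - 1\<close> and
    \<open>L k\<close>.\<close>
  define L where "L k = (LEAST i. k \<le> c i)" for k
  define u where "u k = w (L k)" for k
  have card: "c m = card {i \<in> {1..m}. w i \<noteq> w (i - 1)}"
  proof (induction m)
    case 0
    show ?case using c0 by simp
  next
    case (Suc m)
    have "{i \<in> {1..Suc m}. w i \<noteq> w (i - 1)}
        = {i \<in> {1..m}. w i \<noteq> w (i - 1)} \<union> (if w (Suc m) \<noteq> w m then {Suc m} else {})"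
      by (auto simp: le_Suc_eq)
    then show ?case using Suc cS[of m] by auto
  qed
  have L: "k \<le> c (L k)" "L k \<le> i" if "k \<le> c i" for k i
    unfolding L_def using that by (auto intro: LeastI Least_le)
  have before: "c (L k - 1) = k - 1" "L k \<noteq> 0" "c (L k) = k" if "1 \<le> k" "k \<le> c i" for k i
  proof -
    show "L k \<noteq> 0" using L(1)[OF that(2)] that(1) c0 by (metis not_one_le_zero le_trans)
    then obtain l where l: "L k = Suc l" using not0_implies_Suc by blast
    have "\<not> k \<le> c l" using L(2)[of k l] l by auto
    moreover have "k \<le> c (Suc l)" using L(1)[OF that(2)] l by simp
    ultimately have "c l = k - 1" "c (Suc l) = k" using cS[of l] by (auto split: if_splits)
    then show "c (L k - 1) = k - 1" "c (L k) = k" using l by auto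
  qed
  have cL: "c (L k) = k" if "k \<le> c i" for k i
  proof (cases "k = 0")
    case True
    then have "L k = 0" unfolding L_def by (intro Least_equality) auto
    then show ?thesis using True c0 by simp
  qed (use before(3)[of k i] that in auto)
  have uc: "u (c i) = w i" if "i \<le> m" for i
    unfolding u_def using const[OF L(2)[of "c i" i] cL[of "c i" i]] by simp
  have jump: "\<exists>i\<in>{1..m}. u k = w i \<and> u (k - 1) = w (i - 1)" if "1 \<le> k" "k \<le> c m" for k
    using before[OF that] L(2)[OF that(2)] uc[of "L k - 1"] that
    by (intro bexI[of _ "L k"]) (auto simp: u_def)
  show ?thesis
    by (rule that[of c u]) (fact c0 cS card uc jump)+
qed

context compound_poisson
begin

text \<open>The path makes at most one jump per grid cell, exactly in those cells where \<open>w\<close> changes.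
  Wherever these jumps occur, the path then takes at each time a value prescribed for a grid
  point at distance at most \<open>1 / m\<close>.\<close>

lemma prob_staircase:
  fixes w :: "nat \<Rightarrow> real" and m :: nat
  assumes h: "distributed \<Omega> lborel (\<Delta> 0) (\<lambda>x. ennreal (h x))"
    and g: "\<And>k. k \<ge> 1 \<Longrightarrow> distributed \<Omega> lborel (\<Delta> k) (\<lambda>x. ennreal (g x))"
    and m: "m > 0" and d: "0 < d" "d \<le> 1" and a: "0 < a"
    and w: "\<And>i. i \<le> m \<Longrightarrow> \<bar>w i\<bar> \<le> R"
    and jumps: "\<And>i. i \<in> {1..m} \<Longrightarrow> dmin \<le> w i - w (i - 1)"
    and h_ge: "\<And>x. x \<in> {- R - 3..R} \<Longrightarrow> a \<le> h x"
    and g_ge: "\<And>x. x \<in> {dmin..2 * R + 1} \<Longrightarrow> a \<le> g x"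
  defines "q \<equiv> card {i \<in> {1..m}. w i \<noteq> w (i - 1)}"
  shows "\<exists>E\<in>events. exp (- lam) * (lam / real m) ^ q * (a * (d / real (q + 1))) ^ (q + 1) \<le> prob E \<and>
    (\<forall>\<omega>\<in>E. \<forall>t\<in>{0..1}. \<exists>i\<le>m. \<bar>real i / real m - t\<bar> \<le> 1 / real m \<and>
      w i - 3 * d \<le> cpp_path N \<Delta> \<omega> t \<and> cpp_path N \<Delta> \<omega> t \<le> w i - d)"
proof -
  obtain c u where cu: "c 0 = (0::nat)" "\<And>i. c (Suc i) = c i + (if w (Suc i) \<noteq> w i then 1 else 0)"
    "c m = q" "\<And>i. i \<le> m \<Longrightarrow> u (c i) = w i"
    "\<And>k. 1 \<le> k \<Longrightarrow> k \<le> c m \<Longrightarrow> \<exists>i\<in>{1..m}. u k = w i \<and> u (k - 1) = w (i - 1)"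
    unfolding q_def by (rule staircase_counting[where w = w and m = m]) blast
  define e where "e i = (if w (Suc i) \<noteq> w i then 1 else 0 :: nat)" for i
  \<comment> \<open>At most \<open>q\<close> jumps follow the starting value, so errors of at most
    \<open>s\<close> each add up to at most \<open>d\<close>.\<close>
  define s where "s = d / real (q + 1)"
  \<comment> \<open>The start lies between \<open>3 * d\<close> and \<open>2 * d\<close> below the
    first level and all later errors are upward, so the path stays between \<open>3 * d\<close> and
    \<open>d\<close> below its level. Upward errors keep the jumps nonnegative when \<open>w\<close>
    is nondecreasing, where a lower bound for \<open>g\<close> on a part of the half-line has to
    suffice.\<close>
  define l where "l k = (if k = 0 then u 0 - 3 * d else u k - u (k - 1))" for k
  define I where "I k = {l k..l k + (if k = 0 then d else s)}" for k
  define E where "E = {\<omega> \<in> space \<Omega>. (\<forall>j<m. N (real (Suc j) / real m) \<omega> - N (real j / real m) \<omega> = e j) \<and> (\<forall>k\<le>q. \<Delta> k \<omega> \<in> I k)}"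
  have mr: "0 < real m" using m by simp
  have s: "0 < s" "s \<le> d" "real q * s \<le> d"
    using d by (auto simp: s_def field_simps)
  note E = prob_increments_jumps[OF m, of I e q, folded E_def]
  have Im: "I k \<in> sets borel" for k by (simp add: I_def)
  have c_mono: "i \<le> j \<Longrightarrow> c i \<le> c j" for i j
    by (induction j rule: dec_induct) (auto simp: cu(2))
  have u0: "u 0 = w 0" using cu(4)[of 0] cu(1) by simp
  have incr: "(\<Prod>j<m. (lam / real m) ^ e j / fact (e j) * exp (- (lam / real m))) = exp (- lam) * (lam / real m) ^ q"
  proof -
    have "(\<Prod>j<i. (lam / real m) ^ e j / fact (e j) * exp (- (lam / real m)))
        = (lam / real m) ^ c i * exp (- (lam / real m)) ^ i" for i
      by (induction i) (auto simp: cu(1,2) e_def)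
    moreover have "exp (- (lam / real m)) ^ m = exp (- lam)"
      using mr by (simp add: exp_of_nat_mult[symmetric])
    ultimately show ?thesis by (simp add: cu(3))
  qed
  have jump_prob: "a * s \<le> prob {\<omega> \<in> space \<Omega>. \<Delta> k \<omega> \<in> I k}" if k: "k \<le> q" for k
  proof (cases "k = 0")
    case True
    have "a * s \<le> a * d" using a s by simp
    also have "\<dots> \<le> prob {\<omega> \<in> space \<Omega>. \<Delta> 0 \<omega> \<in> {u 0 - 3 * d..u 0 - 3 * d + d}}"
      by (rule prob_jump_in_interval[OF h]) (use a d w[of 0] u0 in \<open>auto intro!: h_ge\<close>)
    finally show ?thesis using True by (simp add: I_def l_def)
  next
    case False
    then obtain i where i: "i \<in> {1..m}" "u k = w i" "u (k - 1) = w (i - 1)"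
      using cu(5)[of k] cu(3) k by auto
    have "\<bar>w i\<bar> \<le> R" "\<bar>w (i - 1)\<bar> \<le> R" using w[of i] w[of "i - 1"] i(1) by auto
    then have "a * s \<le> prob {\<omega> \<in> space \<Omega>. \<Delta> k \<omega> \<in> {u k - u (k - 1)..u k - u (k - 1) + s}}"
      by (intro prob_jump_in_interval[OF g]) (use False a d s i jumps[OF i(1)] in \<open>auto intro!: g_ge\<close>)
    then show ?thesis using False by (simp add: I_def l_def)
  qed
  have "(a * s) ^ (q + 1) = (\<Prod>k\<le>q. a * s)" by simp
  also have "\<dots> \<le> (\<Prod>k\<le>q. prob {\<omega> \<in> space \<Omega>. \<Delta> k \<omega> \<in> I k})"
    using jump_prob a s by (intro prod_mono) auto
  finally have "exp (- lam) * (lam / real m) ^ q * (a * s) ^ (q + 1) \<le> prob E"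
    unfolding E(2)[OF Im] incr using lam by (intro mult_left_mono) auto
  moreover have "E \<in> events" by (rule E(1)[OF Im])
  moreover have "\<exists>i\<le>m. \<bar>real i / real m - t\<bar> \<le> 1 / real m \<and>
      w i - 3 * d \<le> cpp_path N \<Delta> \<omega> t \<and> cpp_path N \<Delta> \<omega> t \<le> w i - d"
    if \<omega>: "\<omega> \<in> E" and t: "t \<in> {0..1}" for \<omega> t
  proof -
    have sp: "\<omega> \<in> space \<Omega>" using \<omega> by (simp add: E_def)
    have mono: "N x \<omega> \<le> N y \<omega>" if "0 \<le> x" "x \<le> y" for x y
      using mono_onD[OF N_mono[OF sp], of x y] that by simp
    have Nc: "i \<le> m \<Longrightarrow> N (real i / real m) \<omega> = c i" for i
    proof (induction i)
      case 0
      then show ?case using N_0[OF sp] cu(1) by simp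
    next
      case (Suc i)
      have "N (real i / real m) \<omega> \<le> N (real (Suc i) / real m) \<omega>"
        by (intro mono divide_right_mono) auto
      moreover have "N (real (Suc i) / real m) \<omega> - N (real i / real m) \<omega> = e i"
        using \<omega> Suc.prems by (auto simp: E_def)
      ultimately show ?case using Suc by (simp add: cu(2) e_def)
    qed
    have sum: "u k - 3 * d \<le> (\<Sum>i=0..k. \<Delta> i \<omega>) \<and> (\<Sum>i=0..k. \<Delta> i \<omega>) \<le> u k - 2 * d + real k * s"
      if "k \<le> q" for k
      using that
    proof (induction k)
      case 0
      have "\<Delta> 0 \<omega> \<in> I 0" using \<omega> by (simp add: E_def)
      then show ?case by (simp add: I_def l_def)
    next
      case (Suc k)
      have "\<Delta> (Suc k) \<omega> \<in> I (Suc k)" using \<omega> Suc.prems by (simp add: E_def)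
      then show ?case using Suc by (auto simp: I_def l_def algebra_simps)
    qed
    define j where "j = (if t = 1 then m - 1 else nat \<lfloor>real m * t\<rfloor>)"
    have "j < m \<and> real j / real m \<le> t \<and> t \<le> real (Suc j) / real m"
    proof (cases "t = 1")
      case True
      then show ?thesis using m by (auto simp: j_def)
    next
      case False
      then have t1: "t < 1" "0 \<le> t" using t by auto
      have "real j = real_of_int \<lfloor>real m * t\<rfloor>" using False t1 by (simp add: j_def)
      then have r: "real j \<le> real m * t" "real m * t < real j + 1" by linarith+
      then have "real j / real m \<le> t" "t \<le> real (Suc j) / real m"
        using mr by (simp_all add: field_simps)
      moreover have "real m * t < real m * 1" using mr t1 by (intro mult_strict_left_mono) auto
      then have "j < m" using r by simp
      ultimately show ?thesis by simp
    qed
    then have j: "j < m" "real j / real m \<le> t" "t \<le> real (Suc j) / real m" by auto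
    have "c j \<le> N t \<omega>" "N t \<omega> \<le> c (Suc j)"
      using mono[of "real j / real m" t] mono[of t "real (Suc j) / real m"] j t Nc[of j] Nc[of "Suc j"] by auto
    \<comment> \<open>The count grows by at most one over a cell, so at any time inside it the path
      has the value belonging to one of the two ends.\<close>
    then have "N t \<omega> = c j \<or> N t \<omega> = c (Suc j)"
      using cu(2)[of j] by (auto split: if_splits)
    then obtain i where i: "i = j \<or> i = Suc j" "N t \<omega> = c i" by blast
    have im: "i \<le> m" using i j by auto
    have close: "\<bar>real i / real m - t\<bar> \<le> 1 / real m"
      using i(1) j(2,3) by (auto simp: add_divide_distrib abs_le_iff)
    have ciq: "c i \<le> q" using c_mono[OF im] cu(3) by simp
    have "real (c i) * s \<le> real q * s" using ciq s by (intro mult_right_mono) auto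
    then have "real (c i) * s \<le> d" using s(3) by linarith
    then show ?thesis
      using sum[OF ciq] cu(4)[OF im] t i(2) im close by (intro exI[of _ i]) (auto simp: cpp_path_def)
  qed
  ultimately show ?thesis
    unfolding s_def by blast
qed

text \<open>The set \<open>G\<close> is a band of functions with a uniform slack in value and in
  time, which makes it open. The path value at \<open>t\<close> belongs to a grid point within
  \<open>1 / m\<close> of \<open>t\<close>, and the slack in time is at most another
  \<open>1 / m\<close>; hence the distance \<open>2 / m\<close> in \<open>near\<close>. The band
  reaches down by \<open>4 * d\<close> because the path may be \<open>3 * d\<close> below its level
  and the slack takes up to another \<open>d\<close>.\<close>

lemma prior_mass_below:
  fixes w :: "nat \<Rightarrow> real" and m :: nat and f0 e :: "real \<Rightarrow> real"
  assumes h: "distributed \<Omega> lborel (\<Delta> 0) (\<lambda>x. ennreal (h x))"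
    and g: "\<And>k. k \<ge> 1 \<Longrightarrow> distributed \<Omega> lborel (\<Delta> k) (\<lambda>x. ennreal (g x))"
    and m: "m > 0" and d: "0 < d" "d \<le> 1" and a: "0 < a"
    and w: "\<And>i. i \<le> m \<Longrightarrow> \<bar>w i\<bar> \<le> R"
    and jumps: "\<And>i. i \<in> {1..m} \<Longrightarrow> dmin \<le> w i - w (i - 1)"
    and h_ge: "\<And>x. x \<in> {- R - 3..R} \<Longrightarrow> a \<le> h x"
    and g_ge: "\<And>x. x \<in> {dmin..2 * R + 1} \<Longrightarrow> a \<le> g x"
    and near: "\<And>i x. i \<le> m \<Longrightarrow> x \<in> {0..1} \<Longrightarrow> \<bar>x - real i / real m\<bar> \<le> 2 / real m \<Longrightarrow>
      w i \<le> f0 x \<and> f0 x - e x \<le> w i"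
    and f0: "set_integrable lborel {0..1} f0" and e: "set_integrable lborel {0..1} e"
  defines "q \<equiv> card {i \<in> {1..m}. w i \<noteq> w (i - 1)}"
  shows "\<exists>G\<in>sets skorokhod_borel.
    exp (- lam) * (lam / real m) ^ q * (a * (d / real (q + 1))) ^ (q + 1)
      \<le> prob {\<omega> \<in> space \<Omega>. cpp_path N \<Delta> \<omega> \<in> G} \<and>
    (\<forall>f\<in>G. (\<forall>x\<in>{0..1}. f x \<le> f0 x) \<and>
      (LINT x:{0..1}|lborel. f0 x) - ((LINT x:{0..1}|lborel. e x) + 4 * d) \<le> (LINT x:{0..1}|lborel. f x))"
proof -
  define G where "G = {f \<in> cadlag01. \<exists>r>0. \<forall>t\<in>{0..1}. \<forall>s\<in>{0..1}. \<bar>s - t\<bar> < r \<longrightarrow>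
    (f0 s - e s - 4 * d) + r \<le> f t \<and> f t \<le> f0 s - r}"
  have "skorokhod_open G"
    unfolding G_def by (rule skorokhod_open_between)
  then have G: "G \<in> sets skorokhod_borel"
    unfolding skorokhod_borel_def
    by (subst sets_measure_of) (unfold skorokhod_open_def, blast, auto intro: sigma_sets.Basic)
  obtain E where E: "E \<in> events"
    "exp (- lam) * (lam / real m) ^ q * (a * (d / real (q + 1))) ^ (q + 1) \<le> prob E"
    "\<And>\<omega> t. \<omega> \<in> E \<Longrightarrow> t \<in> {0..1} \<Longrightarrow> \<exists>i\<le>m. \<bar>real i / real m - t\<bar> \<le> 1 / real m \<and>
      w i - 3 * d \<le> cpp_path N \<Delta> \<omega> t \<and> cpp_path N \<Delta> \<omega> t \<le> w i - d"
  proof -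
    have "\<exists>E\<in>events. exp (- lam) * (lam / real m) ^ q * (a * (d / real (q + 1))) ^ (q + 1) \<le> prob E \<and>
      (\<forall>\<omega>\<in>E. \<forall>t\<in>{0..1}. \<exists>i\<le>m. \<bar>real i / real m - t\<bar> \<le> 1 / real m \<and>
        w i - 3 * d \<le> cpp_path N \<Delta> \<omega> t \<and> cpp_path N \<Delta> \<omega> t \<le> w i - d)"
      unfolding q_def
      by (rule prob_staircase[where h = h and g = g and R = R and dmin = dmin])
        (rule h g m d a w jumps h_ge g_ge, assumption?)+
    then show ?thesis using that by blast
  qed
  have mr: "0 < real m" using m by simp
  have "cpp_path N \<Delta> \<omega> \<in> G" if \<omega>: "\<omega> \<in> E" for \<omega>
  proof -
    have "(f0 s - e s - 4 * d) + min d (1 / real m) \<le> cpp_path N \<Delta> \<omega> t \<and> cpp_path N \<Delta> \<omega> t \<le> f0 s - min d (1 / real m)"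
      if t: "t \<in> {0..1}" and s: "s \<in> {0..1}" and st: "\<bar>s - t\<bar> < min d (1 / real m)" for s t
    proof -
      obtain i where i: "i \<le> m" "\<bar>real i / real m - t\<bar> \<le> 1 / real m"
        "w i - 3 * d \<le> cpp_path N \<Delta> \<omega> t" "cpp_path N \<Delta> \<omega> t \<le> w i - d"
        using E(3)[OF \<omega> t] by blast
      have "\<bar>s - real i / real m\<bar> \<le> 1 / real m + 1 / real m" using i(2) st by linarith
      then have "\<bar>s - real i / real m\<bar> \<le> 2 / real m" by simp
      from near[OF i(1) s this] i(3,4) show ?thesis by auto
    qed
    moreover have "0 < min d (1 / real m)" using d mr by simp
    moreover have "cpp_path N \<Delta> \<omega> \<in> cadlag01"
      using path_cadlag sets.sets_into_space[OF E(1)] \<omega> by blast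
    ultimately show ?thesis unfolding G_def by blast
  qed
  then have "E \<subseteq> {\<omega> \<in> space \<Omega>. cpp_path N \<Delta> \<omega> \<in> G}"
    using sets.sets_into_space[OF E(1)] by blast
  moreover have "{\<omega> \<in> space \<Omega>. cpp_path N \<Delta> \<omega> \<in> G} \<in> events"
    using measurable_sets[OF path_measurable G] by (simp add: vimage_def Int_def conj_commute)
  ultimately have "prob E \<le> prob {\<omega> \<in> space \<Omega>. cpp_path N \<Delta> \<omega> \<in> G}"
    by (rule finite_measure_mono)
  moreover have "(\<forall>x\<in>{0..1}. f x \<le> f0 x) \<and>
      (LINT x:{0..1}|lborel. f0 x) - ((LINT x:{0..1}|lborel. e x) + 4 * d) \<le> (LINT x:{0..1}|lborel. f x)"
    if f: "f \<in> G" for f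
  proof -
    obtain r where r: "r > 0" "\<And>t s. t \<in> {0..1} \<Longrightarrow> s \<in> {0..1} \<Longrightarrow> \<bar>s - t\<bar> < r \<Longrightarrow>
        (f0 s - e s - 4 * d) + r \<le> f t \<and> f t \<le> f0 s - r" and fc: "f \<in> cadlag01"
      using f unfolding G_def by blast
    have le: "f0 x - e x - 4 * d \<le> f x" "f x \<le> f0 x" if "x \<in> {0..1}" for x
      using r(2)[OF that that] r(1) by auto
    obtain B where B: "\<And>x. x \<in> {0..1} \<Longrightarrow> \<bar>f x\<bar> \<le> B" using cadlag01_bounded[OF fc] by metis
    have "set_integrable lborel {0..1} (\<lambda>x. f (clamp01 x))"
      by (rule bounded_set_integrable01[OF cadlag01_clamp01_measurable[OF fc], where B = B]) (use B in auto)
    then have fi: "set_integrable lborel {0..1} f"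
      by (rule set_integrable_cong[THEN iffD1, OF refl refl, rotated]) simp
    have ci: "set_integrable lborel {0..1::real} (\<lambda>x. 4 * d)"
      by (rule bounded_set_integrable01[where B = "\<bar>4 * d\<bar>"]) auto
    have "(LINT x:{0..1}|lborel. f0 x - e x - 4 * d) \<le> (LINT x:{0..1}|lborel. f x)"
      by (intro set_integral_mono set_integral_diff f0 e ci fi le)
    also have "(LINT x:{0..1}|lborel. f0 x - e x - 4 * d)
        = (LINT x:{0..1}|lborel. f0 x) - (LINT x:{0..1}|lborel. e x) - (LINT x:{0..1::real}|lborel. 4 * d)"
      by (simp only: set_integral_diff f0 e ci)
    also have "(LINT x:{0..1::real}|lborel. 4 * d) = 4 * d"
      by (simp add: set_lebesgue_integral_def)
    finally show ?thesis using le(2) by auto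
  qed
  ultimately show ?thesis
    using E(2) G by (intro bexI[of _ G]) (auto intro: order_trans)
qed

end

section \<open>The sieve\<close>

lemma intensity_cong:
  assumes "\<And>x. x \<in> {0..1} \<Longrightarrow> f x = g x"
  shows "intensity n f = intensity n g"
  unfolding intensity_def density_def
  by (intro arg_cong[where f = "measure_of _ _"] ext nn_integral_cong)
    (use assms in \<open>auto simp: space_restrict_space indicator_def\<close>)

lemma L1_far_cong:
  assumes "\<And>x. x \<in> {0..1} \<Longrightarrow> f x = g x"
  shows "L1_far f r = L1_far g r"
  unfolding L1_far_def L1_norm_def
  by (intro Collect_cong conj_cong refl arg_cong[where f = "(\<le>) r"] set_lebesgue_integral_cong) (use assms in auto)

text \<open>The function classes leave \<open>f0\<close> arbitrary outside [0,1], possibly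
  non-measurable. Clamping changes neither the law of the points nor the distance.\<close>

lemma expected_posterior_clamp01:
  "expected_posterior prior n f0 (L1_far f0 r)
    = expected_posterior prior n (\<lambda>x. f0 (clamp01 x)) (L1_far (\<lambda>x. f0 (clamp01 x)) r)"
  using intensity_cong[of f0 "\<lambda>x. f0 (clamp01 x)" n] L1_far_cong[of f0 "\<lambda>x. f0 (clamp01 x)" r]
  unfolding expected_posterior_def by simp

text \<open>Markov's inequality for \<open>z ^ k\<close>, whose mean is the generating function
  \<open>exp (lam * (z - 1))\<close>. The base \<open>z\<close> stays free; taking it as a power of
  \<open>n\<close> makes every additional jump cost a multiple of \<open>ln n\<close> in the
  exponent.\<close>

lemma poisson_pmf_tail:
  assumes lam: "lam > 0" and z: "z \<ge> 1"
  shows "measure (measure_pmf (poisson_pmf lam)) {J<..} \<le> exp (lam * z) / z ^ (J + 1)"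
proof -
  have sums: "(\<lambda>k. pmf (poisson_pmf lam) k * z ^ k) sums (exp (- lam) * exp (lam * z))"
  proof -
    have "(\<lambda>k. (lam * z) ^ k /\<^sub>R fact k) sums exp (lam * z)"
      by (rule exp_converges)
    from sums_mult[OF this, of "exp (- lam)"] show ?thesis
      using lam by (simp add: power_mult_distrib divide_inverse mult_ac)
  qed
  have "emeasure (measure_pmf (poisson_pmf lam)) {J<..} = (\<integral>\<^sup>+k. indicator {J<..} k \<partial>measure_pmf (poisson_pmf lam))"
    by simp
  also have "\<dots> \<le> (\<integral>\<^sup>+k. ennreal (1 / z ^ (J + 1)) * ennreal (z ^ k) \<partial>measure_pmf (poisson_pmf lam))"
  proof (rule nn_integral_mono)
    fix k :: nat
    have "1 \<le> 1 / z ^ (J + 1) * z ^ k" if "J < k"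
      using that z power_increasing[of "J + 1" k z] by (simp add: field_simps)
    then show "indicator {J<..} k \<le> ennreal (1 / z ^ (J + 1)) * ennreal (z ^ k)"
      using z by (auto simp: indicator_def ennreal_mult'[symmetric] simp del: power_Suc)
  qed
  also have "\<dots> = ennreal (1 / z ^ (J + 1)) * (\<integral>\<^sup>+k. ennreal (pmf (poisson_pmf lam) k) * ennreal (z ^ k) \<partial>count_space UNIV)"
    by (subst nn_integral_cmult) (auto simp: nn_integral_measure_pmf)
  also have "(\<integral>\<^sup>+k. ennreal (pmf (poisson_pmf lam) k) * ennreal (z ^ k) \<partial>count_space UNIV)
      = (\<Sum>k. ennreal (pmf (poisson_pmf lam) k * z ^ k))"
    using z by (subst nn_integral_count_space_nat) (simp add: ennreal_mult')
  also have "\<dots> = ennreal (exp (- lam) * exp (lam * z))"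
    by (rule suminf_ennreal_eq[OF _ sums]) (use z in auto)
  also have "ennreal (1 / z ^ (J + 1)) * \<dots> = ennreal (exp (- lam) * (exp (lam * z) / z ^ (J + 1)))"
    using z by (simp add: ennreal_mult'[symmetric] mult_ac)
  also have "\<dots> \<le> ennreal (exp (lam * z) / z ^ (J + 1))"
  proof (rule ennreal_leI)
    have "exp (- lam) * (exp (lam * z) / z ^ (J + 1)) \<le> 1 * (exp (lam * z) / z ^ (J + 1))"
      using lam z by (intro mult_right_mono) auto
    then show "exp (- lam) * (exp (lam * z) / z ^ (J + 1)) \<le> exp (lam * z) / z ^ (J + 1)" by simp
  qed
  finally show ?thesis
    using z by (simp add: measure_pmf.emeasure_eq_measure)
qed

context compound_poisson
begin

lemma prob_many_jumps:
  assumes z: "z \<ge> 1"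
  shows "prob {\<omega> \<in> space \<Omega>. J < N 1 \<omega>} \<le> exp (lam * z) / z ^ (J + 1)"
proof -
  have [measurable]: "N 0 \<in> measurable \<Omega> (count_space UNIV)" "N 1 \<in> measurable \<Omega> (count_space UNIV)"
    by (auto intro: N_measurable)
  have "{\<omega> \<in> space \<Omega>. J < N 1 \<omega>} = (\<lambda>\<omega>. N 1 \<omega> - N 0 \<omega>) -` {J<..} \<inter> space \<Omega>"
    using N_0 by auto
  then have "prob {\<omega> \<in> space \<Omega>. J < N 1 \<omega>} = measure (distr \<Omega> (count_space UNIV) (\<lambda>\<omega>. N 1 \<omega> - N 0 \<omega>)) {J<..}"
    by (subst measure_distr) (simp_all, measurable)
  also have "\<dots> = measure (measure_pmf (poisson_pmf lam)) {J<..}"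
    using poisson_processD(6)[OF poisson, of 0 1] by simp
  finally show ?thesis using poisson_pmf_tail[OF lam z] by simp
qed

text \<open>The sieve consists of the paths with at most \<open>J\<close> jumps for which the
  starting value and the next \<open>J\<close> jumps are at most \<open>s\<close> in modulus. It
  bounds the path by \<open>V = (J + 1) * s\<close>, which fixes the size of the bracket
  family.\<close>

lemma expected_posterior_cpp_le:
  assumes tails: "\<And>k. prob {\<omega> \<in> space \<Omega>. s \<le> \<bar>\<Delta> k \<omega>\<bar>} \<le> p"
    and s: "s \<ge> 0" and z: "z \<ge> 1" and m: "m > 0"
    and mesh: "(1 + 2 * (real (J + 1) * s) * real J) / real m \<le> r / 4"
    and f0: "(\<lambda>x. f0 (clamp01 x)) \<in> borel_measurable borel" "\<And>x. x \<in> {0..1} \<Longrightarrow> \<bar>f0 x\<bar> \<le> R"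
    and G: "G \<in> sets skorokhod_borel"
    and below: "\<And>f x. f \<in> G \<Longrightarrow> x \<in> {0..1} \<Longrightarrow> f x \<le> f0 x"
    and int: "\<And>f. f \<in> G \<Longrightarrow> (LINT x:{0..1}|lborel. f0 x) - e0 \<le> (LINT x:{0..1}|lborel. f x)"
    and q: "0 < q" "q \<le> prob {\<omega> \<in> space \<Omega>. cpp_path N \<Delta> \<omega> \<in> G}"
  shows "expected_posterior (cpp_law \<Omega> N \<Delta>) n f0 (L1_far f0 r)
    \<le> ennreal (real (((m + 1)\<^sup>2 * (nat \<lfloor>2 * (real (J + 1) * s) * real m\<rfloor> + 1)) ^ (J + 1)) * exp (- real n * r / 4)
        + (exp (lam * z) / z ^ (J + 1) + real (J + 1) * p + exp (- real n * r / 2)) * exp (real n * e0) / q)"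
proof -
  define V where "V = real (J + 1) * s"
  define S where "S = {\<omega> \<in> space \<Omega>. N 1 \<omega> \<le> J \<and> (\<forall>k\<le>J. \<bar>\<Delta> k \<omega>\<bar> \<le> s)}"
  define LL where "LL = bracket_fun m J V ` bracket_index m J V"
  let ?F = "\<lambda>x. f0 (clamp01 x)"
  have [measurable]: "N 1 \<in> measurable \<Omega> (count_space UNIV)" by (simp add: N_measurable)
  have S [measurable]: "S \<in> events" unfolding S_def by measurable
  have prob_S: "prob (space \<Omega> - S) \<le> exp (lam * z) / z ^ (J + 1) + real (J + 1) * p"
  proof -
    have "prob (space \<Omega> - S) \<le> prob ({\<omega> \<in> space \<Omega>. J < N 1 \<omega>} \<union> (\<Union>k\<in>{..J}. {\<omega> \<in> space \<Omega>. s \<le> \<bar>\<Delta> k \<omega>\<bar>}))"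
      by (rule finite_measure_mono) (auto simp: S_def not_le intro: less_imp_le)
    also have "\<dots> \<le> prob {\<omega> \<in> space \<Omega>. J < N 1 \<omega>} + prob (\<Union>k\<in>{..J}. {\<omega> \<in> space \<Omega>. s \<le> \<bar>\<Delta> k \<omega>\<bar>})"
      by (rule measure_Un_le) measurable
    finally have 1: "prob (space \<Omega> - S) \<le> prob {\<omega> \<in> space \<Omega>. J < N 1 \<omega>}
      + prob (\<Union>k\<in>{..J}. {\<omega> \<in> space \<Omega>. s \<le> \<bar>\<Delta> k \<omega>\<bar>})" .
    have "prob (\<Union>k\<in>{..J}. {\<omega> \<in> space \<Omega>. s \<le> \<bar>\<Delta> k \<omega>\<bar>}) \<le> (\<Sum>k\<le>J. prob {\<omega> \<in> space \<Omega>. s \<le> \<bar>\<Delta> k \<omega>\<bar>})"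
      by (rule finite_measure_subadditive_finite) auto
    also have "\<dots> \<le> real (card {..J}) * p"
      by (rule sum_bounded_above) (rule tails)
    also have "\<dots> = real (J + 1) * p" by simp
    finally show ?thesis using 1 prob_many_jumps[OF z, of J] by linarith
  qed
  have card_LL: "real (card LL) \<le> real (((m + 1)\<^sup>2 * (nat \<lfloor>2 * V * real m\<rfloor> + 1)) ^ (J + 1))"
    unfolding LL_def card_bracket_index[symmetric] using card_image_le[OF finite_bracket_index] by simp
  have int_F: "(LINT x:{0..1}|lborel. ?F x) = (LINT x:{0..1}|lborel. f0 x)"
    by (intro set_lebesgue_integral_cong) auto
  have bracket: "\<exists>l\<in>LL. (\<forall>x\<in>{0..1}. l x \<le> cpp_path N \<Delta> \<omega> x) \<and> (LINT x:{0..1}|lborel. cpp_path N \<Delta> \<omega> x - l x) \<le> r / 4"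
    if \<omega>: "\<omega> \<in> S" for \<omega>
  proof -
    define \<phi> where "\<phi> k = (\<Sum>i=0..k. \<Delta> i \<omega>)" for k
    have sp: "\<omega> \<in> space \<Omega>" using \<omega> by (simp add: S_def)
    have path: "cpp_path N \<Delta> \<omega> x = \<phi> (N x \<omega>)" if "x \<in> {0..1}" for x
      using that by (simp add: cpp_path_def \<phi>_def)
    have V: "\<bar>\<phi> k\<bar> \<le> V" if "k \<le> J" for k
    proof -
      have "\<bar>\<phi> k\<bar> \<le> (\<Sum>i=0..k. \<bar>\<Delta> i \<omega>\<bar>)" unfolding \<phi>_def by (rule sum_abs)
      also have "\<dots> \<le> real (card {0..k}) * s"
        using \<omega> that by (intro sum_bounded_above) (auto simp: S_def)
      also have "\<dots> \<le> V" using that s by (auto simp: V_def intro!: mult_right_mono)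
      finally show ?thesis .
    qed
    obtain B where B: "\<And>t. t \<in> {0..1} \<Longrightarrow> \<bar>cpp_path N \<Delta> \<omega> t\<bar> \<le> B"
      using cadlag01_bounded[OF path_cadlag[OF sp]] by metis
    have "set_integrable lborel {0..1} (\<lambda>x. cpp_path N \<Delta> \<omega> (clamp01 x))"
      by (rule bounded_set_integrable01[OF cadlag01_clamp01_measurable[OF path_cadlag[OF sp]], where B = B])
        (use B in auto)
    then have "set_integrable lborel {0..1} (\<lambda>x. \<phi> (N x \<omega>))"
      by (rule set_integrable_cong[THEN iffD1, OF refl refl, rotated]) (simp add: path)
    then obtain \<theta> where \<theta>: "\<theta> \<in> bracket_index m J V" "\<And>x. x \<in> {0..1} \<Longrightarrow> bracket_fun m J V \<theta> x \<le> \<phi> (N x \<omega>)"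
        "(LINT x:{0..1}|lborel. \<phi> (N x \<omega>) - bracket_fun m J V \<theta> x) \<le> (1 + 2 * V * real J) / real m"
      using step_function_bracket[OF N_mono[OF sp], of J \<phi> V m] V m \<omega> by (auto simp: S_def)
    have int_eq: "(LINT x:{0..1}|lborel. cpp_path N \<Delta> \<omega> x - bracket_fun m J V \<theta> x)
        = (LINT x:{0..1}|lborel. \<phi> (N x \<omega>) - bracket_fun m J V \<theta> x)"
      by (intro set_lebesgue_integral_cong) (auto simp: path)
    show ?thesis
    proof (intro bexI conjI ballI)
      show "bracket_fun m J V \<theta> \<in> LL" using \<theta>(1) by (simp add: LL_def)
      show "bracket_fun m J V \<theta> x \<le> cpp_path N \<Delta> \<omega> x" if "x \<in> {0..1}" for x
        using \<theta>(2)[OF that] path[OF that] by simp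
      show "(LINT x:{0..1}|lborel. cpp_path N \<Delta> \<omega> x - bracket_fun m J V \<theta> x) \<le> r / 4"
        using \<theta>(3) int_eq mesh[folded V_def] by linarith
    qed
  qed
  have "expected_posterior (cpp_law \<Omega> N \<Delta>) n ?F (L1_far ?F r)
    \<le> ennreal (real (card LL) * exp (- real n * r / 4)
        + (prob (space \<Omega> - S) + exp (- real n * r / 2)) * exp (real n * e0) / q)"
    unfolding expected_posterior_def cpp_law_def
  proof (rule SUP_least)
    fix P assume "P \<in> {P. poisson_points_law (intensity n ?F) P}"
    then have P: "poisson_points_law (intensity n ?F) P" by simp
    show "(\<integral>\<^sup>+p. posterior (distr \<Omega> skorokhod_borel (cpp_path N \<Delta>)) n p (L1_far ?F r) \<partial>P)
      \<le> ennreal (real (card LL) * exp (- real n * r / 4)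
          + (prob (space \<Omega> - S) + exp (- real n * r / 2)) * exp (real n * e0) / q)"
    proof (rule expected_posterior_le[OF prob_space_axioms path_measurable path_cadlag path_joint f0(1) _ P S, where G = G])
      show "\<bar>?F x\<bar> \<le> R" for x using f0(2)[of "clamp01 x"] by simp
      show "finite LL" by (simp add: LL_def finite_bracket_index)
      show "l \<in> borel_measurable borel" if "l \<in> LL" for l
        using that bracket_fun_measurable by (auto simp: LL_def)
      show "\<bar>l x\<bar> \<le> \<bar>V\<bar> + real (J + 1) * (real (nat \<lfloor>2 * V * real m\<rfloor>) / real m)" if "l \<in> LL" for l x
        using that bracket_fun_bounded by (auto simp: LL_def)
    qed (use bracket G below int q int_F in auto)
  qed
  also have "\<dots> \<le> ennreal (real (((m + 1)\<^sup>2 * (nat \<lfloor>2 * V * real m\<rfloor> + 1)) ^ (J + 1)) * exp (- real n * r / 4)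
        + (exp (lam * z) / z ^ (J + 1) + real (J + 1) * p + exp (- real n * r / 2)) * exp (real n * e0) / q)"
    using card_LL prob_S q(1)
    by (intro ennreal_leI add_mono mult_right_mono divide_right_mono) auto
  finally show ?thesis
    unfolding expected_posterior_clamp01[of _ n f0] V_def .
qed

end

section \<open>Contraction rates from prior mass\<close>

text \<open>Each factor is bounded by a fixed power of \<open>1 / n\<close>: \<open>1 / n\<close>
  for \<open>exp (- lam)\<close>, \<open>1 / n ^ 2\<close> for a jump in a prescribed cell and
  \<open>1 / n ^ 4\<close> for a value in a prescribed interval. The exponents add up to
  \<open>6 * q + 5\<close>.\<close>

lemma staircase_mass_lower_bound:
  fixes n m q :: nat and a lam kap cc :: real
  assumes n: "n \<ge> 3" and lam: "1 / real n \<le> lam" "lam \<le> ln (real n)" and a: "1 / real n \<le> a"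
    and m: "0 < m" "m \<le> n" and q: "q \<le> m" "real q \<le> cc * kap" and kap: "1 \<le> kap"
  shows "exp (- (6 * cc + 5) * (kap * ln (real n)))
    \<le> exp (- lam) * (lam / real m) ^ q * (a * (1 / real n / real (q + 1))) ^ (q + 1)"
proof -
  let ?x = "ln (real n)"
  have n0: "real n > 0" using n by simp
  have x0: "0 \<le> ?x" using n by simp
  have "0 < 1 / real n" using n0 by simp
  then have pos: "0 < lam" "0 < a" using lam(1) a by linarith+
  have ex: "exp (- real k * ?x) = 1 / real n ^ k" for k
    using n0 by (simp add: exp_minus exp_of_nat_mult inverse_eq_divide)
  have 1: "exp (- 2 * ?x) \<le> lam / real m"
  proof -
    have "exp (- 2 * ?x) = (1 / real n) / real n" using ex[of 2] by (simp add: power2_eq_square)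
    also have "\<dots> \<le> lam / real m" using lam(1) m n0 pos by (intro frac_le) auto
    finally show ?thesis .
  qed
  have 2: "exp (- 4 * ?x) \<le> a * (1 / real n / real (q + 1))"
  proof -
    have "real (q + 1) \<le> real n * real n"
    proof -
      have "real (q + 1) \<le> real n + 1" using m q by simp
      also have "\<dots> \<le> 2 * real n" using n by simp
      also have "\<dots> \<le> real n * real n" using n by (intro mult_right_mono) auto
      finally show ?thesis .
    qed
    then have "1 / real n / (real n * real n) \<le> 1 / real n / real (q + 1)"
      using n0 by (intro divide_left_mono) auto
    then have "(1 / real n) * (1 / real n / (real n * real n)) \<le> a * (1 / real n / real (q + 1))"
      using a n0 by (intro mult_mono) (auto intro: order_trans[rotated])
    then show ?thesis using ex[of 4] by (simp add: power4_eq_xxxx mult.assoc)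
  qed
  have "- (6 * cc + 5) * (kap * ?x) \<le> - ?x + real q * (- 2 * ?x) + real (q + 1) * (- 4 * ?x)"
  proof -
    have "(6 * real q + 5) * ?x \<le> (6 * (cc * kap) + 5 * kap) * ?x"
      using q(2) kap x0 by (intro mult_right_mono) auto
    then show ?thesis by (simp add: algebra_simps)
  qed
  then have "exp (- (6 * cc + 5) * (kap * ?x)) \<le> exp (- ?x) * exp (- 2 * ?x) ^ q * exp (- 4 * ?x) ^ (q + 1)"
    by (simp only: exp_of_nat_mult[symmetric] exp_add[symmetric] exp_le_cancel_iff)
  also have "\<dots> \<le> exp (- lam) * (lam / real m) ^ q * (a * (1 / real n / real (q + 1))) ^ (q + 1)"
    using lam(2) 1 2 by (intro mult_mono power_mono mult_nonneg_nonneg zero_le_power)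
      (auto intro: order_trans[OF exp_ge_zero])
  finally show ?thesis .
qed

text \<open>The bracket width is at most \<open>3 * n ^ (p + 4) / m\<close> and has to be at most
  \<open>1 / (4 * n)\<close>; of the six extra powers in \<open>m\<close>, the last one absorbs the
  constant 12. One entry of an index then has at most \<open>12 * n ^ (4 * p + 20)\<close> values,
  where again one more power absorbs the constant.\<close>

lemma sieve_constants_bound:
  fixes n J p :: nat and s r :: real
  assumes n: "n \<ge> 12" and J: "real (J + 1) \<le> real n ^ 2" and s: "0 \<le> s" "s \<le> real n ^ p"
    and r: "1 / real n \<le> r"
  defines "m \<equiv> n ^ (p + 6)"
  shows "(1 + 2 * (real (J + 1) * s) * real J) / real m \<le> r / 4"
    and "real (((m + 1)\<^sup>2 * (nat \<lfloor>2 * (real (J + 1) * s) * real m\<rfloor> + 1)) ^ (J + 1))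
      \<le> exp (real (4 * p + 21) * (real (J + 1) * ln (real n)))"
proof -
  let ?n = "real n"
  have n0: "?n > 0" and n1: "1 \<le> ?n" and n12: "12 \<le> ?n" using n by auto
  have "real (J + 1) * s \<le> ?n ^ 2 * ?n ^ p"
    using J s by (intro mult_mono) auto
  also have "?n ^ 2 * ?n ^ p = ?n ^ (p + 2)"
    by (simp only: power_add mult.commute)
  finally have V: "real (J + 1) * s \<le> ?n ^ (p + 2)" .
  have V0: "0 \<le> real (J + 1) * s" using s by simp
  have mn: "real m = ?n ^ (p + 6)" by (simp add: m_def)
  have "1 + 2 * (real (J + 1) * s) * real J \<le> 3 * ?n ^ (p + 4)"
  proof -
    have "(real (J + 1) * s) * real J \<le> ?n ^ (p + 2) * ?n ^ 2"
    proof (rule mult_mono[OF V])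
      have "real J \<le> real (J + 1)" by simp
      then show "real J \<le> ?n ^ 2" using J by linarith
    qed (use n0 in auto)
    moreover have "1 \<le> ?n ^ (p + 4)" using n1 by simp
    moreover have "?n ^ (p + 2) * ?n ^ 2 = ?n ^ (p + 4)"
    proof -
      have "p + 2 + 2 = p + 4" by simp
      then show ?thesis by (simp only: power_add[symmetric])
    qed
    ultimately show ?thesis by linarith
  qed
  also have "3 * ?n ^ (p + 4) \<le> (1 / ?n) / 4 * real m"
  proof -
    have "12 * ?n ^ (p + 5) \<le> ?n * ?n ^ (p + 5)" using n12 n0 by (intro mult_right_mono) auto
    moreover have "Suc (p + 5) = p + 6" "Suc (p + 4) = p + 5" by simp_all
    then have "?n * ?n ^ (p + 5) = real m" "?n * ?n ^ (p + 4) = ?n ^ (p + 5)"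
      by (simp_all only: mn power_Suc[symmetric])
    ultimately have "12 * (?n * ?n ^ (p + 4)) \<le> real m" by linarith
    then show ?thesis using n0 by (simp add: pos_le_divide_eq mult_ac)
  qed
  also have "\<dots> \<le> r / 4 * real m" using r by (intro mult_right_mono divide_right_mono) auto
  finally show "(1 + 2 * (real (J + 1) * s) * real J) / real m \<le> r / 4"
    using n0 mn by (simp add: pos_divide_le_eq)
  have m1: "1 \<le> real m" using n1 by (simp add: mn)
  have A: "real (m + 1) \<le> 2 * ?n ^ (p + 6)" using m1 mn by simp
  have B: "real (nat \<lfloor>2 * (real (J + 1) * s) * real m\<rfloor> + 1) \<le> 3 * ?n ^ (2 * p + 8)"
  proof -
    have "0 \<le> 2 * (real (J + 1) * s) * real m" using V0 by simp
    from of_nat_floor[OF this]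
    have "real (nat \<lfloor>2 * (real (J + 1) * s) * real m\<rfloor>) \<le> 2 * ((real (J + 1) * s) * real m)"
      by (simp only: mult.assoc)
    also have "\<dots> \<le> 2 * (?n ^ (p + 2) * ?n ^ (p + 6))"
      unfolding mn using V V0 n0 by (intro mult_left_mono mult_right_mono) auto
    also have "?n ^ (p + 2) * ?n ^ (p + 6) = ?n ^ (2 * p + 8)"
    proof -
      have "p + 2 + (p + 6) = 2 * p + 8" by simp
      then show ?thesis by (simp only: power_add[symmetric])
    qed
    finally have "real (nat \<lfloor>2 * (real (J + 1) * s) * real m\<rfloor>) \<le> 2 * ?n ^ (2 * p + 8)" .
    moreover have "1 \<le> ?n ^ (2 * p + 8)" using n1 by simp
    ultimately show ?thesis by simp
  qed
  have "real ((m + 1)\<^sup>2 * (nat \<lfloor>2 * (real (J + 1) * s) * real m\<rfloor> + 1))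
      = real (m + 1) ^ 2 * real (nat \<lfloor>2 * (real (J + 1) * s) * real m\<rfloor> + 1)"
    by (simp only: of_nat_mult of_nat_power)
  also have "\<dots> \<le> (2 * ?n ^ (p + 6)) ^ 2 * (3 * ?n ^ (2 * p + 8))"
    using A B by (intro mult_mono power_mono) auto
  also have "\<dots> = 12 * ?n ^ (4 * p + 20)"
  proof -
    have "(p + 6) * 2 + (2 * p + 8) = 4 * p + 20" by simp
    then have "?n ^ (4 * p + 20) = (?n ^ (p + 6)) ^ 2 * ?n ^ (2 * p + 8)"
      by (simp only: power_mult[symmetric] power_add[symmetric])
    then show ?thesis by (simp only: power_mult_distrib) simp
  qed
  also have "\<dots> \<le> ?n * ?n ^ (4 * p + 20)"
    using n12 n0 by (intro mult_right_mono) auto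
  also have "\<dots> = exp (real (4 * p + 21) * ln ?n)"
  proof -
    have "4 * p + 21 = Suc (4 * p + 20)" by simp
    then show ?thesis unfolding exp_of_nat_mult using n0 by (simp only: exp_ln power_Suc)
  qed
  finally have "real ((m + 1)\<^sup>2 * (nat \<lfloor>2 * (real (J + 1) * s) * real m\<rfloor> + 1)) \<le> exp (real (4 * p + 21) * ln ?n)" .
  then have "real ((m + 1)\<^sup>2 * (nat \<lfloor>2 * (real (J + 1) * s) * real m\<rfloor> + 1)) ^ (J + 1)
      \<le> exp (real (4 * p + 21) * ln ?n) ^ (J + 1)"
    by (intro power_mono) auto
  then show "real (((m + 1)\<^sup>2 * (nat \<lfloor>2 * (real (J + 1) * s) * real m\<rfloor> + 1)) ^ (J + 1))
      \<le> exp (real (4 * p + 21) * (real (J + 1) * ln ?n))"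
    by (simp only: of_nat_power exp_of_nat_mult[symmetric] mult_ac)
qed

text \<open>\<open>w i\<close> is the level of a staircase at the grid point \<open>i / m\<close>, and \<open>e\<close> bounds the oscillation of \<open>f\<close>
  on a neighbourhood of two cells. At most \<open>q\<close> jumps are needed, none of them below \<open>dmin\<close>.\<close>

definition staircase_below :: "nat \<Rightarrow> real \<Rightarrow> real \<Rightarrow> real \<Rightarrow> real \<Rightarrow> (real \<Rightarrow> real) \<Rightarrow> bool" where
  "staircase_below m B dmin loss q f \<longleftrightarrow> (\<exists>w e. (\<forall>i\<le>m. \<bar>w i\<bar> \<le> B) \<and>
    (\<forall>i\<in>{1..m}. dmin \<le> w i - w (i - 1)) \<and>
    (\<forall>i\<le>m. \<forall>x\<in>{0..1}. \<bar>x - real i / real m\<bar> \<le> 2 / real m \<longrightarrow> w i \<le> f x \<and> f x - e x \<le> w i) \<and>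
    set_integrable lborel {0..1} e \<and> (LINT x:{0..1}|lborel. e x) \<le> loss \<and>
    real (card {i \<in> {1..m}. w i \<noteq> w (i - 1)}) \<le> q)"

lemma staircase_belowI:
  assumes "\<And>i. i \<le> m \<Longrightarrow> \<bar>w i\<bar> \<le> B" "\<And>i. i \<in> {1..m} \<Longrightarrow> dmin \<le> w i - w (i - 1)"
    "\<And>i x. i \<le> m \<Longrightarrow> x \<in> {0..1} \<Longrightarrow> \<bar>x - real i / real m\<bar> \<le> 2 / real m \<Longrightarrow> w i \<le> f x \<and> f x - e x \<le> w i"
    "set_integrable lborel {0..1} e" "(LINT x:{0..1}|lborel. e x) \<le> loss"
    "real (card {i \<in> {1..m}. w i \<noteq> w (i - 1)}) \<le> q"
  shows "staircase_below m B dmin loss q f"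
proof -
  have "\<forall>i\<le>m. \<bar>w i\<bar> \<le> B" "\<forall>i\<in>{1..m}. dmin \<le> w i - w (i - 1)"
    "\<forall>i\<le>m. \<forall>x\<in>{0..1}. \<bar>x - real i / real m\<bar> \<le> 2 / real m \<longrightarrow> w i \<le> f x \<and> f x - e x \<le> w i"
    using assms(1-3) by blast+
  with assms(4-) show ?thesis
    unfolding staircase_below_def by (intro exI[of _ w] exI[of _ e] conjI)
qed

lemma staircase_belowE:
  assumes "staircase_below m B dmin loss q f"
  obtains w e where "\<And>i. i \<le> m \<Longrightarrow> \<bar>w i\<bar> \<le> B" "\<And>i. i \<in> {1..m} \<Longrightarrow> dmin \<le> w i - w (i - 1)"
    "\<And>i x. i \<le> m \<Longrightarrow> x \<in> {0..1} \<Longrightarrow> \<bar>x - real i / real m\<bar> \<le> 2 / real m \<Longrightarrow> w i \<le> f x \<and> f x - e x \<le> w i"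
    "set_integrable lborel {0..1} e" "(LINT x:{0..1}|lborel. e x) \<le> loss"
    "real (card {i \<in> {1..m}. w i \<noteq> w (i - 1)}) \<le> q"
proof -
  note st = assms[unfolded staircase_below_def]
  show ?thesis
  proof (rule exE[OF st], erule exE, elim conjE)
    fix w e
    assume "\<forall>i\<le>m. \<bar>w i\<bar> \<le> B" "\<forall>i\<in>{1..m}. dmin \<le> w i - w (i - 1)"
      "\<forall>i\<le>m. \<forall>x\<in>{0..1}. \<bar>x - real i / real m\<bar> \<le> 2 / real m \<longrightarrow> w i \<le> f x \<and> f x - e x \<le> w i"
      "set_integrable lborel {0..1} e" "(LINT x:{0..1}|lborel. e x) \<le> loss"
      "real (card {i \<in> {1..m}. w i \<noteq> w (i - 1)}) \<le> q"
    then show ?thesis by (intro that[of w e]) blast+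
  qed
qed

lemma staircase_below_mono:
  assumes "staircase_below m B dmin loss q f" "loss \<le> loss'" "q \<le> q'"
  shows "staircase_below m B dmin loss' q' f"
proof -
  from assms(1) obtain w e where "\<And>i. i \<le> m \<Longrightarrow> \<bar>w i\<bar> \<le> B" "\<And>i. i \<in> {1..m} \<Longrightarrow> dmin \<le> w i - w (i - 1)"
    "\<And>i x. i \<le> m \<Longrightarrow> x \<in> {0..1} \<Longrightarrow> \<bar>x - real i / real m\<bar> \<le> 2 / real m \<Longrightarrow> w i \<le> f x \<and> f x - e x \<le> w i"
    "set_integrable lborel {0..1} e" "(LINT x:{0..1}|lborel. e x) \<le> loss"
    "real (card {i \<in> {1..m}. w i \<noteq> w (i - 1)}) \<le> q"
    by (rule staircase_belowE) blast
  with assms(2,3) show ?thesis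
    by (intro staircase_belowI[of m w B dmin f e]) (assumption | linarith)+
qed

context compound_poisson
begin

text \<open>With \<open>T = kap n * ln n\<close>, the prior mass and the loss of integral in the
  evidence cost a factor \<open>exp (- C * T)\<close> each, so every term of the numerator has to
  beat \<open>exp (- 2 * C * T)\<close>. The separation \<open>M\<close> is fixed last, after the
  size of the bracket family is known. The bound covers all large \<open>M\<close>, so that a single
  \<open>M\<close> can serve several classes.\<close>

lemma contraction_rate:
  fixes kap :: "nat \<Rightarrow> real" and F :: "nat \<Rightarrow> (real \<Rightarrow> real) set"
    and g h :: "real \<Rightarrow> real" and a b rho gam L R dmin cc :: real
  assumes h: "distributed \<Omega> lborel (\<Delta> 0) (\<lambda>x. ennreal (h x))"
    and g: "\<And>k. k \<ge> 1 \<Longrightarrow> distributed \<Omega> lborel (\<Delta> k) (\<lambda>x. ennreal (g x))"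
    and tails: "\<And>k s. s \<ge> 0 \<Longrightarrow> prob {\<omega> \<in> space \<Omega>. s \<le> \<bar>\<Delta> k \<omega>\<bar>} \<le> inverse L * exp (- L * s powr gam)"
    and pos: "0 < gam" "0 < L" "0 < a" "0 < rho" "0 < b" "0 < cc"
    and h_ge: "\<And>x. x \<in> {- R - 3..R} \<Longrightarrow> a \<le> h x"
    and g_ge: "\<And>x. x \<in> {dmin..2 * R + 1} \<Longrightarrow> a \<le> g x"
    and kap_ge: "\<forall>\<^sub>F n in sequentially. b * real n powr rho \<le> kap n"
    and kap_le: "\<forall>\<^sub>F n in sequentially. kap n * ln (real n) \<le> real n"
    and approx: "\<forall>\<^sub>F n in sequentially. \<forall>f0\<in>F n.
      (\<lambda>x. f0 (clamp01 x)) \<in> borel_measurable borel \<and> (\<forall>x\<in>{0..1}. \<bar>f0 x\<bar> \<le> R) \<and>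
      (\<exists>m. 0 < m \<and> m \<le> n \<and> staircase_below m R dmin (cc * (kap n * ln (real n) / real n)) (cc * kap n) f0)"
  shows "\<exists>M0. \<forall>M\<ge>M0. \<forall>\<^sub>F n in sequentially. \<forall>f0\<in>F n.
    expected_posterior (cpp_law \<Omega> N \<Delta>) n f0 (L1_far f0 (M * (kap n * ln (real n) / real n)))
      \<le> ennreal (exp (- (kap n * ln (real n))))"
proof -
  define C where "C = 6 * cc + 5"
  \<comment> \<open>Solves \<open>A * rho / 2 = C1\<close>: with base
    \<open>n powr (rho / 2)\<close>, the power in the tail bound for more than
    \<open>A * kap n\<close> jumps is at least \<open>exp (C1 * T)\<close>.\<close>
  define A where "A = (4 * C + 6) / rho"
  \<comment> \<open>An exponent with \<open>n powr (2 / gam) \<le> n ^ p\<close>, so that the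
    truncation level of the jumps is polynomial in \<open>n\<close>.\<close>
  define p where "p = nat \<lceil>2 / gam\<rceil>"
  \<comment> \<open>One more than the required \<open>2 * C + 2\<close>. The surplus absorbs
    \<open>exp (lam * z)\<close> in the bound on the number of jumps and the factor
    \<open>(J + 1) / L\<close> in the bound on their sizes.\<close>
  define C1 where "C1 = 2 * C + 3"
  define K0 where "K0 = real (4 * p + 21) * (A + 1)"
  \<comment> \<open>\<open>K0 * T\<close> bounds the logarithm of the number of brackets, which
    \<open>M / 4\<close> has to exceed with a margin; \<open>M / 2\<close> has to reach
    \<open>2 * C + 2\<close> for the paths far below \<open>f0\<close>.\<close>
  define M0 where "M0 = 4 * (K0 + 2) + (4 * C + 4)"
  have C: "C > 0" "cc + 4 \<le> C" using pos by (auto simp: C_def)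
  have A: "A > 0" using C pos by (simp add: A_def)
  have C1: "C1 > 0" using C by (simp add: C1_def)
  have rho2: "0 < rho / 2" using pos by simp
  have to_inf: "\<forall>\<^sub>F n in sequentially. c \<le> real n" for c
    using filterlim_real_sequentially by (simp add: filterlim_at_top)
  have ln_inf: "\<forall>\<^sub>F n in sequentially. c \<le> ln (real n)" for c
    using filterlim_compose[OF ln_at_top filterlim_real_sequentially] by (simp add: filterlim_at_top)
  have powr_inf: "\<forall>\<^sub>F n in sequentially. c \<le> real n powr e" if "e > 0" for c e
    using ln_inf[of "c / e"] eventually_gt_at_top[of 0]
  proof eventually_elim
    case (elim n)
    have "c \<le> e * ln (real n)" using elim that by (simp add: pos_divide_le_eq mult.commute)
    also have "\<dots> \<le> exp (e * ln (real n))"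
      using exp_ge_add_one_self[of "e * ln (real n)"] by linarith
    also have "\<dots> = real n powr e" using elim by (simp add: powr_def)
    finally show ?case .
  qed
  show ?thesis
  proof (intro exI[of _ M0] allI impI)
    fix M assume M: "M \<ge> M0"
    have M_ge: "real (4 * p + 21) * (A + 1) + 2 \<le> M / 4" "2 * C + 2 \<le> M / 2" "1 \<le> M"
    proof -
      have "0 \<le> K0" using A by (simp add: K0_def)
      then have "K0 + 2 \<le> M / 4 \<and> 2 * C + 2 \<le> M / 2 \<and> 1 \<le> M"
        using M C pos unfolding M0_def by auto
      then show "real (4 * p + 21) * (A + 1) + 2 \<le> M / 4" "2 * C + 2 \<le> M / 2" "1 \<le> M"
        unfolding K0_def by blast+
    qed
    show "\<forall>\<^sub>F n in sequentially. \<forall>f0\<in>F n.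
      expected_posterior (cpp_law \<Omega> N \<Delta>) n f0 (L1_far f0 (M * (kap n * ln (real n) / real n)))
        \<le> ennreal (exp (- (kap n * ln (real n))))"
      using approx kap_ge kap_le to_inf[of 12] to_inf[of "1 / lam"] to_inf[of "1 / a"] ln_inf[of lam]
        ln_inf[of 1] powr_inf[OF pos(4), of "2 / b"] powr_inf[OF rho2, of "lam / b"]
        to_inf[of "A + 2"] to_inf[of "(A + 2) / L"] to_inf[of "C1 / L"]
    proof eventually_elim
      case (elim n)
      let ?n = "real n"
      define x where "x = ln ?n"
      define k where "k = kap n"
      define T where "T = k * x"
      have n12: "12 \<le> ?n" and n0: "0 < ?n" and x1: "1 \<le> x" using elim by (auto simp: x_def)
      have k2: "2 \<le> k"
      proof -
        have "2 \<le> b * ?n powr rho" using elim pos by (simp add: field_simps)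
        then show ?thesis using elim by (simp add: k_def)
      qed
      have Tn: "T \<le> ?n" using elim by (simp add: T_def k_def x_def)
      have kT: "k \<le> T" using k2 x1 by (simp add: T_def mult_le_cancel_left1)
      have T2: "2 \<le> T" using kT k2 by simp
      have xT: "x \<le> T" using k2 x1 by (simp add: T_def mult_le_cancel_right1)
      show ?case
      proof
        fix f0 assume "f0 \<in> F n"
        note F = bspec[OF elim(1) this]
        have f0: "(\<lambda>x. f0 (clamp01 x)) \<in> borel_measurable borel" "\<And>x. x \<in> {0..1} \<Longrightarrow> \<bar>f0 x\<bar> \<le> R"
          using F by blast+
        obtain m where m: "0 < m" "m \<le> n" and st: "staircase_below m R dmin (cc * (T / ?n)) (cc * k) f0"
          using F unfolding T_def k_def x_def by blast
        from st obtain w e where w: "\<And>i. i \<le> m \<Longrightarrow> \<bar>w i\<bar> \<le> R"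
          "\<And>i. i \<in> {1..m} \<Longrightarrow> dmin \<le> w i - w (i - 1)"
          and near: "\<And>i x. i \<le> m \<Longrightarrow> x \<in> {0..1} \<Longrightarrow> \<bar>x - real i / real m\<bar> \<le> 2 / real m \<Longrightarrow>
            w i \<le> f0 x \<and> f0 x - e x \<le> w i"
          and e: "set_integrable lborel {0..1} e" "(LINT x:{0..1}|lborel. e x) \<le> cc * (T / ?n)"
          and card: "real (card {i \<in> {1..m}. w i \<noteq> w (i - 1)}) \<le> cc * k"
          by (rule staircase_belowE) blast
        define q where "q = card {i \<in> {1..m}. w i \<noteq> w (i - 1)}"
        have f0_int: "set_integrable lborel {0..1} f0"
        proof -
          have "set_integrable lborel {0..1} (\<lambda>x. f0 (clamp01 x))"
            by (rule bounded_set_integrable01[OF f0(1), where B = R]) (use f0(2) in auto)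
          then show ?thesis by (rule set_integrable_cong[THEN iffD1, OF refl refl, rotated]) simp
        qed
        have "\<exists>G\<in>sets skorokhod_borel.
          exp (- lam) * (lam / real m) ^ q * (a * (1 / ?n / real (q + 1))) ^ (q + 1)
            \<le> prob {\<omega> \<in> space \<Omega>. cpp_path N \<Delta> \<omega> \<in> G} \<and>
          (\<forall>f\<in>G. (\<forall>x\<in>{0..1}. f x \<le> f0 x) \<and>
            (LINT x:{0..1}|lborel. f0 x) - ((LINT x:{0..1}|lborel. e x) + 4 * (1 / ?n)) \<le> (LINT x:{0..1}|lborel. f x))"
          unfolding q_def
        proof (rule prior_mass_below[where h = h and g = g and R = R and dmin = dmin])
          show "0 < 1 / ?n" "1 / ?n \<le> 1" using n12 by auto
        qed (rule f0_int e(1) h g m(1) pos(3) w h_ge g_ge near; assumption)+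
        then obtain G where G: "G \<in> sets skorokhod_borel"
          "exp (- lam) * (lam / real m) ^ q * (a * (1 / ?n / real (q + 1))) ^ (q + 1)
            \<le> prob {\<omega> \<in> space \<Omega>. cpp_path N \<Delta> \<omega> \<in> G}"
          "\<And>f x. f \<in> G \<Longrightarrow> x \<in> {0..1} \<Longrightarrow> f x \<le> f0 x"
          "\<And>f. f \<in> G \<Longrightarrow> (LINT x:{0..1}|lborel. f0 x) - ((LINT x:{0..1}|lborel. e x) + 4 * (1 / ?n)) \<le> (LINT x:{0..1}|lborel. f x)"
          by blast
        have mass: "exp (- C * T) \<le> prob {\<omega> \<in> space \<Omega>. cpp_path N \<Delta> \<omega> \<in> G}"
        proof -
          have "q \<le> card {1..m}" unfolding q_def by (intro card_mono) auto
          then have "q \<le> m" by simp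
          moreover have "1 / ?n \<le> lam" "1 / ?n \<le> a" using elim lam pos n0 by (simp_all add: field_simps)
          ultimately have "exp (- C * T)
              \<le> exp (- lam) * (lam / real m) ^ q * (a * (1 / ?n / real (q + 1))) ^ (q + 1)"
            unfolding C_def T_def x_def
            using staircase_mass_lower_bound[of n lam a m q cc k] elim m card k2 n12
            by (simp add: q_def)
          with G(2) show ?thesis by linarith
        qed
        have int: "(LINT x:{0..1}|lborel. f0 x) - C * T / ?n \<le> (LINT x:{0..1}|lborel. f x)" if "f \<in> G" for f
        proof -
          have "(cc + 4) * T \<le> C * T" using C T2 by (intro mult_right_mono) auto
          then have "cc * T + 4 \<le> C * T" using T2 by (simp add: algebra_simps)
          then have "(cc * T + 4) / ?n \<le> C * T / ?n"
            by (rule divide_right_mono) simp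
          then have "cc * (T / ?n) + 4 * (1 / ?n) \<le> C * T / ?n"
            by (simp add: add_divide_distrib)
          then show ?thesis using G(4)[OF that] e(2) by linarith
        qed
        define J where "J = nat \<lceil>A * k\<rceil>"
        \<comment> \<open>Solves \<open>L * s powr gam = C1 * n\<close>. Since
          \<open>T \<le> n\<close>, the exponential tail at \<open>s\<close> is at most
          \<open>exp (- C1 * T)\<close>.\<close>
        define s where "s = (C1 * ?n / L) powr (1 / gam)"
        \<comment> \<open>Half the growth exponent of \<open>kap n\<close>: then
          \<open>b * z * z \<le> kap n\<close>, which gives \<open>lam * z \<le> kap n\<close> for
          large \<open>n\<close>, while \<open>ln z\<close> is still a multiple of
          \<open>ln n\<close>.\<close>
        define z where "z = ?n powr (rho / 2)"
        define r where "r = M * (T / ?n)"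
        have J: "A * k \<le> real (J + 1)" "real (J + 1) \<le> A * k + 2"
          using A k2 by (auto simp: J_def) linarith+
        have J2: "real (J + 1) \<le> (A + 1) * k" using J(2) k2 by (simp add: algebra_simps)
        have An: "A * k + 2 \<le> (A + 2) * ?n"
        proof -
          have "A * k \<le> A * ?n" using kT Tn A by (intro mult_left_mono) auto
          then show ?thesis using n12 by (simp add: algebra_simps)
        qed
        have Jn: "real (J + 1) \<le> ?n ^ 2"
        proof -
          have "(A + 2) * ?n \<le> ?n * ?n" using elim n0 by (intro mult_right_mono) auto
          then show ?thesis using J(2) An by (simp add: power2_eq_square)
        qed
        have s0: "0 \<le> s" by (simp add: s_def)
        have s_le: "s \<le> ?n ^ p"
        proof -
          have "C1 * ?n / L \<le> ?n * ?n" using elim pos n0 by (simp add: field_simps)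
          then have "s \<le> (?n * ?n) powr (1 / gam)"
            unfolding s_def using C1 pos n0 by (intro powr_mono2) auto
          also have "\<dots> = ?n powr (2 / gam)"
            using n0 by (simp add: powr_mult powr_add[symmetric] add_divide_distrib[symmetric])
          also have "\<dots> \<le> ?n powr real p"
            using n12 by (intro powr_mono) (auto simp: p_def, linarith)
          finally show ?thesis using n0 by (simp add: powr_realpow)
        qed
        have Ls: "L * s powr gam = C1 * ?n"
          unfolding s_def using pos C1 n0 by (simp add: powr_powr)
        have z1: "1 \<le> z" unfolding z_def using n12 pos by (intro ge_one_powr_ge_zero) auto
        have r_ge: "1 / ?n \<le> r"
        proof -
          have "1 * 1 \<le> M * T" using M_ge(3) T2 by (intro mult_mono) auto
          then show ?thesis using n0 by (simp add: r_def divide_right_mono)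
        qed
        have n12': "12 \<le> n" using n12 by simp
        note sc = sieve_constants_bound[OF n12' Jn s0 s_le r_ge]
        have m0: "0 < n ^ (p + 6)" using n12' by simp
        have nr: "?n * r = M * T" using n0 by (simp add: r_def)
        let ?card = "real (((n ^ (p + 6) + 1)\<^sup>2 * (nat \<lfloor>2 * (real (J + 1) * s) * real (n ^ (p + 6))\<rfloor> + 1)) ^ (J + 1))"
        let ?tail = "exp (lam * z) / z ^ (J + 1)"
        let ?jump = "real (J + 1) * (inverse L * exp (- L * s powr gam))"
        let ?rest = "(?tail + ?jump + exp (- ?n * r / 2)) * exp (?n * (C * T / ?n)) / exp (- C * T)"
        have "expected_posterior (cpp_law \<Omega> N \<Delta>) n f0 (L1_far f0 r)
          \<le> ennreal (?card * exp (- ?n * r / 4) + ?rest)"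
          by (rule expected_posterior_cpp_le[where G = G and R = R])
            (rule tails[OF s0] s0 z1 m0 sc(1) f0 G(1,3) int mass exp_gt_zero; assumption)+
        also have "\<dots> \<le> ennreal (exp (- T))"
        proof (rule ennreal_leI)
          have t1: "?card * exp (- ?n * r / 4) \<le> exp (- 2 * T)"
          proof -
            have "real (J + 1) * x \<le> (A + 1) * T"
              using mult_right_mono[OF J2, of x] x1 by (simp add: T_def mult.assoc)
            then have "real (4 * p + 21) * (real (J + 1) * x) \<le> real (4 * p + 21) * ((A + 1) * T)"
              by (intro mult_left_mono) auto
            moreover have "(real (4 * p + 21) * (A + 1) + 2) * T \<le> M / 4 * T"
              using M_ge(1) T2 by (intro mult_right_mono) auto
            ultimately have "real (4 * p + 21) * (real (J + 1) * x) + - (M * T) / 4 \<le> - 2 * T"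
              by (simp add: algebra_simps)
            then have "exp (real (4 * p + 21) * (real (J + 1) * x)) * exp (- ?n * r / 4) \<le> exp (- 2 * T)"
              using nr by (simp add: exp_add[symmetric])
            moreover have "?card * exp (- ?n * r / 4)
              \<le> exp (real (4 * p + 21) * (real (J + 1) * x)) * exp (- ?n * r / 4)"
              using sc(2) unfolding x_def by (intro mult_right_mono) auto
            ultimately show ?thesis by linarith
          qed
          have t2: "?tail \<le> exp (- (2 * C + 2) * T)"
          proof -
            have "lam * z \<le> k"
            proof -
              have "lam \<le> b * z" using elim pos by (simp add: z_def field_simps)
              then have "lam * z \<le> b * z * z" using z1 by (intro mult_right_mono) auto
              also have "\<dots> = b * ?n powr rho" by (simp add: z_def powr_add[symmetric])
              also have "\<dots> \<le> k" using elim by (simp add: k_def)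
              finally show ?thesis .
            qed
            then have "lam * z \<le> T" using kT by simp
            moreover have zJ: "z ^ (J + 1) = exp (real (J + 1) * (rho / 2 * x))"
              using n0 by (simp only: exp_of_nat_mult) (simp add: z_def powr_def x_def)
            moreover have "C1 * T \<le> real (J + 1) * (rho / 2 * x)"
            proof -
              have "C1 * T = A * k * (rho / 2 * x)"
                using pos by (simp add: C1_def A_def T_def field_simps)
              also have "\<dots> \<le> real (J + 1) * (rho / 2 * x)"
                using J(1) pos x1 by (intro mult_right_mono) auto
              finally show ?thesis .
            qed
            moreover have "C1 * T - T = (2 * C + 2) * T"
              by (simp add: C1_def algebra_simps)
            ultimately have "lam * z - real (J + 1) * (rho / 2 * x) \<le> - (2 * C + 2) * T"
              by linarith
            then show ?thesis
              unfolding zJ exp_diff[symmetric] by (simp only: exp_le_cancel_iff)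
          qed
          have t3: "?jump \<le> exp (- (2 * C + 2) * T)"
          proof -
            have "real (J + 1) * inverse L \<le> exp T"
            proof -
              have "real (J + 1) * inverse L \<le> (A + 2) * ?n * inverse L"
                using J(2) An pos by (intro mult_right_mono) auto
              also have "\<dots> = (A + 2) / L * ?n" by (simp add: field_simps)
              also have "\<dots> \<le> ?n * ?n" using elim n0 by (intro mult_right_mono) auto
              also have "\<dots> = exp (2 * x)" using n0 by (simp only: x_def mult_2 exp_add exp_ln)
              also have "\<dots> \<le> exp T" using k2 x1 by (simp add: T_def mult_right_mono)
              finally show ?thesis .
            qed
            moreover have "exp (- L * s powr gam) \<le> exp (- C1 * T)"
              using Ls Tn C1 by simp
            ultimately have "(real (J + 1) * inverse L) * exp (- L * s powr gam) \<le> exp T * exp (- C1 * T)"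
              by (intro mult_mono) auto
            also have "\<dots> = exp (- (2 * C + 2) * T)"
              by (simp add: exp_add[symmetric] C1_def algebra_simps)
            finally show ?thesis by (simp add: mult.assoc)
          qed
          have t4: "exp (- ?n * r / 2) \<le> exp (- (2 * C + 2) * T)"
          proof -
            have "(2 * C + 2) * T \<le> M / 2 * T" using M_ge(2) T2 by (intro mult_right_mono) auto
            then have "- ?n * r / 2 \<le> - (2 * C + 2) * T" using nr by (simp only: minus_mult_left[symmetric])
            then show ?thesis by (simp only: exp_le_cancel_iff)
          qed
          have t5: "exp (?n * (C * T / ?n)) / exp (- C * T) = exp (2 * C * T)"
            using n0 by (simp add: exp_diff[symmetric])
          have "?rest = (?tail + ?jump + exp (- ?n * r / 2)) * (exp (?n * (C * T / ?n)) / exp (- C * T))"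
            by (rule times_divide_eq_right[symmetric])
          also have "\<dots> \<le> (3 * exp (- (2 * C + 2) * T)) * exp (2 * C * T)"
            unfolding t5
          proof (rule mult_right_mono)
            show "?tail + ?jump + exp (- ?n * r / 2) \<le> 3 * exp (- (2 * C + 2) * T)"
              using t2 t3 t4 by linarith
          qed simp
          also have "\<dots> = 3 * exp (- 2 * T)"
            by (simp add: exp_add[symmetric] algebra_simps)
          finally have "?card * exp (- ?n * r / 4) + ?rest \<le> 4 * exp (- 2 * T)"
            using t1 by linarith
          \<comment> \<open>The four terms cost a factor of at most \<open>exp 2\<close>, which
            \<open>T \<ge> 2\<close> absorbs.\<close>
          also have "\<dots> \<le> exp 2 * exp (- 2 * T)"
          proof -
            have "2 \<le> exp (1 :: real)" using exp_ge_add_one_self[of 1] by simp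
            then have "2 * 2 \<le> exp (1 :: real) * exp 1" by (intro mult_mono) auto
            then have "4 \<le> exp (2 :: real)" by (simp add: exp_add[symmetric])
            then show ?thesis by (intro mult_right_mono) auto
          qed
          also have "\<dots> \<le> exp (- T)" using T2 by (simp add: exp_add[symmetric])
          finally show "?card * exp (- ?n * r / 4) + ?rest \<le> exp (- T)" .
        qed
        finally show "expected_posterior (cpp_law \<Omega> N \<Delta>) n f0 (L1_far f0 (M * (kap n * ln ?n / ?n)))
          \<le> ennreal (exp (- (kap n * ln ?n)))"
          by (simp only: r_def T_def k_def x_def)
      qed
    qed
  qed
qed

end

section \<open>Staircases below the function classes\<close>

lemma clamp01_mono: "x \<le> y \<Longrightarrow> clamp01 x \<le> clamp01 y"
  by (auto simp: clamp01_def)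

lemma clamp01_continuous: "continuous_on UNIV clamp01"
  unfolding clamp01_def by (intro continuous_intros)

section \<open>Monotone functions\<close>

text \<open>After a translation of the variable the two integrals cancel except on intervals of
  length \<open>s\<close> at both ends. For monotone functions this bounds the oscillation over
  small neighbourhoods in the mean, although single jumps can be large.\<close>

lemma shifted_integral_difference_le:
  fixes F :: "real \<Rightarrow> real"
  assumes [measurable]: "F \<in> borel_measurable borel" and F: "\<And>x. \<bar>F x\<bar> \<le> R" and s: "0 \<le> s"
  shows "(LINT x:{0..1}|lborel. F x - F (x - s)) \<le> 2 * R * s"
proof -
  have int: "integrable lborel (\<lambda>x. indicator {c..d} x * F (x + u))" for c d u :: real
  proof -
    have "integrable lborel (\<lambda>x. indicator {c..d} x *\<^sub>R F (x + u))"
      by (rule integrableI_bounded_set_indicator[where B = R])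
        (use F in \<open>auto intro!: AE_I2 simp: emeasure_lborel_Icc_eq\<close>)
    then show ?thesis by simp
  qed
  have int0: "integrable lborel (\<lambda>x. indicator {c..d} x * F x)" for c d :: real
    using int[of c d 0] by simp
  have "(LINT x:{0..1}|lborel. F x - F (x - s))
      = (LINT x|lborel. indicator {0..1} x * F x) - (LINT x|lborel. indicator {0..1} x * F (x + (- s)))"
    unfolding set_lebesgue_integral_def using int[of 0 1 "- s"] int0
    by (simp add: right_diff_distrib)
  also have "(LINT x|lborel. indicator {0..1} x * F (x + (- s))) = (LINT x|lborel. indicator {- s..1 - s} x * F x)"
    by (subst lborel_integral_real_affine[where c = 1 and t = s])
      (auto simp: indicator_def intro!: Bochner_Integration.integral_cong)
  also have "(LINT x|lborel. indicator {0..1} x * F x) - (LINT x|lborel. indicator {- s..1 - s} x * F x)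
      = (LINT x|lborel. indicator {0..1} x * F x - indicator {- s..1 - s} x * F x)"
    by (intro Bochner_Integration.integral_diff[symmetric] int0)
  also have "\<dots> \<le> (LINT x|lborel. R * (indicator {- s..0} x + indicator {1 - s..1} x))"
  proof (rule integral_mono)
    have "0 \<le> R" using F[of 0] by simp
    then show "indicator {0..1} x * F x - indicator {- s..1 - s} x * F x \<le> R * (indicator {- s..0} x + indicator {1 - s..1} x)" for x
      using F[of x] s by (auto simp: indicator_def)
  qed (use s in \<open>auto intro!: int0 integrable_mult_right Bochner_Integration.integrable_add integrable_diff
      simp: integrable_indicator_iff\<close>)
  also have "\<dots> = 2 * R * s"
    using s by (subst integral_mult_right_zero, subst Bochner_Integration.integral_add) (auto simp: integrable_indicator_iff)
  finally show ?thesis .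
qed

lemma card_changes_le: "card {i \<in> {1..m}. P i} \<le> m"
proof -
  have "card {i \<in> {1..m}. P i} \<le> card {1..m}" by (intro card_mono) auto
  then show ?thesis by simp
qed

text \<open>The level at a grid point is the value two cells to its left, hence below
  \<open>f\<close> on the whole neighbourhood, and monotonicity keeps all steps nonnegative. The
  oscillation is a difference over a shift of \<open>4 / m\<close>, so its integral is at most
  \<open>2 * R * (4 / m)\<close>.\<close>

lemma monotone_class_staircase:
  assumes f: "f \<in> monotone_class R" and m: "m > 0"
  shows "(\<lambda>x. f (clamp01 x)) \<in> borel_measurable borel" "\<And>x. x \<in> {0..1} \<Longrightarrow> \<bar>f x\<bar> \<le> R"
    "staircase_below m R 0 (8 * R / real m) (real m) f"
proof -
  define w where "w i = f (clamp01 ((real i - 2) / real m))" for i :: nat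
  define e where "e x = f (clamp01 x) - f (clamp01 (x - 4 / real m))" for x
  have mono: "f (clamp01 x) \<le> f (clamp01 y)" if "x \<le> y" for x y
    using f clamp01_mono[OF that] by (auto simp: monotone_class_def intro!: mono_onD[of "{0..1}" f])
  show meas: "(\<lambda>x. f (clamp01 x)) \<in> borel_measurable borel"
    by (rule borel_measurable_mono) (auto intro!: monoI mono)
  have bnd: "\<bar>f x\<bar> \<le> R" if "x \<in> {0..1}" for x
  proof -
    have "mono_on {0..1} f" using f by (simp add: monotone_class_def)
    then have "f 0 \<le> f x" "f x \<le> f 1" using that by (auto intro!: mono_onD[of "{0..1}" f])
    then show ?thesis using f by (auto simp: monotone_class_def)
  qed
  then show "\<And>x. x \<in> {0..1} \<Longrightarrow> \<bar>f x\<bar> \<le> R" .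
  have bnd': "\<bar>f (clamp01 x)\<bar> \<le> R" for x by (intro bnd) simp
  have mr: "real m > 0" using m by simp
  show "staircase_below m R 0 (8 * R / real m) (real m) f"
  proof (rule staircase_belowI[where w = w and e = e])
    show "\<bar>w i\<bar> \<le> R" for i unfolding w_def by (rule bnd')
    have "w (i - 1) \<le> w i" for i unfolding w_def by (intro mono divide_right_mono) auto
    then show "0 \<le> w i - w (i - 1)" for i by simp
    show "w i \<le> f x \<and> f x - e x \<le> w i" if x: "x \<in> {0..1}" and near: "\<bar>x - real i / real m\<bar> \<le> 2 / real m" for i x
    proof -
      have "(real i - 2) / real m \<le> x" "x - 4 / real m \<le> (real i - 2) / real m"
        using near by (auto simp: abs_le_iff diff_divide_distrib)
      from mono[OF this(1)] mono[OF this(2)] show ?thesis using x by (simp add: w_def e_def)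
    qed
    show "set_integrable lborel {0..1} e"
    proof (rule bounded_set_integrable01)
      show "e \<in> borel_measurable borel"
        unfolding e_def using meas measurable_compose[OF _ meas, of "\<lambda>x. x - 4 / real m"] by measurable
      show "\<bar>e x\<bar> \<le> 2 * R" for x using bnd'[of x] bnd'[of "x - 4 / real m"] by (simp add: e_def)
    qed
    show "(LINT x:{0..1}|lborel. e x) \<le> 8 * R / real m"
      unfolding e_def using shifted_integral_difference_le[OF meas bnd', of "4 / real m"] mr by simp
  qed (simp only: of_nat_le_iff card_changes_le)
qed

section \<open>Hoelder functions\<close>

lemma holder_ballD:
  assumes f: "f \<in> holder_ball \<beta> R" and R: "R > 0" and x: "x \<in> {0..1}"
  shows "\<bar>f x\<bar> \<le> R" and "y \<in> {0..1} \<Longrightarrow> \<bar>f x - f y\<bar> \<le> R * \<bar>x - y\<bar> powr \<beta>"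
proof -
  have le: "(SUP x\<in>{0..1}. ennreal \<bar>f x\<bar>) \<le> ennreal R"
    "(SUP x\<in>{0..1}. SUP y\<in>{0..1} - {x}. ennreal (\<bar>f x - f y\<bar> / \<bar>x - y\<bar> powr \<beta>)) \<le> ennreal R"
    using f unfolding holder_ball_def holder_norm_def by (auto intro: order_trans[rotated])
  have "ennreal \<bar>f x\<bar> \<le> ennreal R"
    by (rule order_trans[OF SUP_upper le(1)]) (use x in auto)
  then show "\<bar>f x\<bar> \<le> R" using R by simp
  show "\<bar>f x - f y\<bar> \<le> R * \<bar>x - y\<bar> powr \<beta>" if y: "y \<in> {0..1}"
  proof (cases "x = y")
    case False
    have "ennreal (\<bar>f x - f y\<bar> / \<bar>x - y\<bar> powr \<beta>) \<le> (SUP y\<in>{0..1} - {x}. ennreal (\<bar>f x - f y\<bar> / \<bar>x - y\<bar> powr \<beta>))"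
      by (rule SUP_upper) (use y False in auto)
    also have "\<dots> \<le> ennreal R"
      by (rule order_trans[OF SUP_upper[of x "{0..1}"] le(2)]) (use x in auto)
    finally have "\<bar>f x - f y\<bar> / \<bar>x - y\<bar> powr \<beta> \<le> R" using R by simp
    moreover have "0 < \<bar>x - y\<bar> powr \<beta>" using False by simp
    ultimately show ?thesis by (simp add: pos_divide_le_eq)
  qed simp
qed

text \<open>The value at the grid point is lowered by the largest possible oscillation over two
  cells. This can leave the range allowed for \<open>f\<close>; since
  \<open>(2 / m) powr \<beta> \<le> 2\<close>, levels are bounded by \<open>3 * R\<close> and steps
  by \<open>6 * R\<close>.\<close>

lemma holder_ball_staircase:
  assumes f: "f \<in> holder_ball \<beta> R" and R: "R > 0" and \<beta>: "0 < \<beta>" "\<beta> \<le> 1" and m: "m > 0"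
  shows "(\<lambda>x. f (clamp01 x)) \<in> borel_measurable borel"
    "staircase_below m (3 * R) (- (6 * R)) (4 * R * (1 / real m) powr \<beta>) (real m) f"
proof -
  define w where "w i = f (real i / real m) - R * (2 / real m) powr \<beta>" for i :: nat
  define e where "e x = 2 * R * (2 / real m) powr \<beta>" for x :: real
  note D = holder_ballD[OF f R]
  have mr: "real m > 0" using m by simp
  have "continuous_on {0..1} f"
    unfolding continuous_on_def
  proof
    fix x :: real assume x: "x \<in> {0..1}"
    have "((\<lambda>y. R * \<bar>y - x\<bar> powr \<beta>) \<longlongrightarrow> R * 0) (at x within {0..1})"
    proof (intro tendsto_mult tendsto_const tendsto_zero_powrI)
      show "((\<lambda>y. \<bar>y - x\<bar>) \<longlongrightarrow> 0) (at x within {0..1})"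
        using tendsto_rabs[OF tendsto_diff[OF tendsto_ident_at[of x "{0..1}"] tendsto_const[of x]]] by simp
    qed (use \<beta> in auto)
    then have lim: "((\<lambda>y. R * \<bar>y - x\<bar> powr \<beta>) \<longlongrightarrow> 0) (at x within {0..1})" by simp
    have "((\<lambda>y. f y - f x) \<longlongrightarrow> 0) (at x within {0..1})"
    proof (rule Lim_null_comparison[OF _ lim])
      show "\<forall>\<^sub>F y in at x within {0..1}. norm (f y - f x) \<le> R * \<bar>y - x\<bar> powr \<beta>"
        using D(2)[OF _ x] by (auto simp: eventually_at_filter)
    qed
    then show "(f \<longlongrightarrow> f x) (at x within {0..1})" by (simp add: LIM_zero_iff)
  qed
  then have "continuous_on UNIV (\<lambda>x. f (clamp01 x))"
    by (rule continuous_on_compose2[OF _ clamp01_continuous]) auto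
  then show "(\<lambda>x. f (clamp01 x)) \<in> borel_measurable borel"
    by (rule borel_measurable_continuous_onI)
  have im: "real i / real m \<in> {0..1}" if "i \<le> m" for i using that mr by simp
  have two: "(2 :: real) powr \<beta> \<le> 2" using \<beta> powr_mono[of \<beta> 1 "2 :: real"] by simp
  have pw: "(2 / real m) powr \<beta> = 2 powr \<beta> * (1 / real m) powr \<beta>"
    using mr by (simp add: powr_mult[symmetric])
  have one: "(1 / real m) powr \<beta> \<le> 1" using m \<beta> by (intro powr_le1) auto
  have pw2: "(2 / real m) powr \<beta> \<le> 2 * (1 / real m) powr \<beta>"
    unfolding pw using two by (intro mult_right_mono) auto
  then have pw2': "(2 / real m) powr \<beta> \<le> 2" using one by linarith
  have w: "\<bar>w i\<bar> \<le> 3 * R" if "i \<le> m" for i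
  proof -
    have "R * (2 / real m) powr \<beta> \<le> R * 2" using pw2' R by (intro mult_left_mono) auto
    moreover have "0 \<le> R * (2 / real m) powr \<beta>" using R by simp
    ultimately show ?thesis using D(1)[OF im[OF that]] unfolding w_def by linarith
  qed
  have near: "w i \<le> f x \<and> f x - e x \<le> w i"
    if "i \<le> m" and x: "x \<in> {0..1}" and near: "\<bar>x - real i / real m\<bar> \<le> 2 / real m" for i x
  proof -
    have "\<bar>f x - f (real i / real m)\<bar> \<le> R * \<bar>x - real i / real m\<bar> powr \<beta>"
      by (rule D(2)[OF x im[OF that(1)]])
    also have "\<dots> \<le> R * (2 / real m) powr \<beta>"
      using near R \<beta> by (intro mult_left_mono powr_mono2) auto
    finally show ?thesis unfolding w_def e_def by linarith
  qed
  have int: "set_integrable lborel {0..1} e"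
    unfolding e_def by (rule bounded_set_integrable01) auto
  have "(LINT x:{0..1}|lborel. e x) = 2 * R * (2 / real m) powr \<beta>"
    by (simp add: e_def set_lebesgue_integral_def)
  also have "\<dots> \<le> 2 * R * (2 * (1 / real m) powr \<beta>)"
    using pw2 R by (intro mult_left_mono) auto
  finally have loss: "(LINT x:{0..1}|lborel. e x) \<le> 4 * R * (1 / real m) powr \<beta>" by simp
  show "staircase_below m (3 * R) (- (6 * R)) (4 * R * (1 / real m) powr \<beta>) (real m) f"
  proof (rule staircase_belowI[OF w _ near int loss])
    fix i assume "i \<in> {1..m}"
    then have "i \<le> m" "i - 1 \<le> m" by auto
    from w[OF this(1)] w[OF this(2)] show "- (6 * R) \<le> w i - w (i - 1)" by linarith
  qed (simp_all only: of_nat_le_iff card_changes_le)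
qed

section \<open>Piecewise constant functions\<close>

lemma card_nat_near_le: "card {i :: nat. \<bar>y - real i\<bar> \<le> 3} \<le> 7"
proof -
  have "{i :: nat. \<bar>y - real i\<bar> \<le> 3} \<subseteq> {nat \<lceil>y - 3\<rceil>..nat \<lceil>y - 3\<rceil> + 6}"
  proof
    fix i assume "i \<in> {i :: nat. \<bar>y - real i\<bar> \<le> 3}"
    then have i: "y - 3 \<le> real i" "real i \<le> y + 3" by auto
    have "\<lceil>y - 3\<rceil> \<le> int i" using i(1) by linarith
    moreover have "int i \<le> \<lceil>y - 3\<rceil> + 6" using i(2) by linarith
    ultimately show "i \<in> {nat \<lceil>y - 3\<rceil>..nat \<lceil>y - 3\<rceil> + 6}" by auto
  qed
  from card_mono[OF _ this] show ?thesis by simp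
qed

lemma finite_nat_near: "finite {i :: nat. \<bar>y - real i\<bar> \<le> 3}"
proof (rule finite_subset)
  show "{i :: nat. \<bar>y - real i\<bar> \<le> 3} \<subseteq> {..nat \<lceil>y + 3\<rceil>}"
    by (auto simp: abs_le_iff) linarith
qed simp

text \<open>The breakpoints are unrelated to the grid. Near a breakpoint the level drops to
  \<open>- R\<close>, which is below \<open>f\<close> in any case and costs \<open>2 * R\<close> on
  an interval of length \<open>8 / m\<close>. Levels change only within \<open>3 / m\<close> of a
  breakpoint, so at most 7 times for each.\<close>

lemma piecewise_constant_staircase:
  assumes f: "f \<in> piecewise_constant K R" and R: "R > 0" and m: "m > 0"
  shows "(\<lambda>x. f (clamp01 x)) \<in> borel_measurable borel" "\<And>x. x \<in> {0..1} \<Longrightarrow> \<bar>f x\<bar> \<le> R"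
    "staircase_below m R (- (2 * R)) (16 * R * real K / real m) (7 * real K) f"
proof -
  obtain t b :: "nat \<Rightarrow> real" where t: "t 0 = 0" "t K = 1" "\<And>j. j \<in> {1..K} \<Longrightarrow> t (j - 1) < t j"
    and b: "\<And>j. j \<in> {1..K} \<Longrightarrow> \<bar>b j\<bar> \<le> R"
    and fx: "\<And>x. x \<in> {0..1} \<Longrightarrow> f x = (\<Sum>j=1..K. b j * indicator {t (j - 1)..<t j} x)"
    using f unfolding piecewise_constant_def by blast
  have mr: "real m > 0" using m by simp
  have [measurable]: "clamp01 \<in> borel_measurable borel"
    by (rule borel_measurable_continuous_onI[OF clamp01_continuous])
  have "(\<lambda>x. \<Sum>j=1..K. b j * indicator {t (j - 1)..<t j} (clamp01 x)) \<in> borel_measurable borel"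
    by measurable
  then show "(\<lambda>x. f (clamp01 x)) \<in> borel_measurable borel"
    by (simp add: fx)
  have ind_sum: "k \<le> K \<Longrightarrow> t 0 \<le> t k \<and> (\<Sum>j=1..k. indicator {t (j - 1)..<t j} x :: real) = indicator {t 0..<t k} x" for k x
  proof (induction k)
    case (Suc k)
    then have "t k < t (Suc k)" using t(3)[of "Suc k"] by simp
    with Suc show ?case by (auto simp: indicator_def)
  qed simp
  have bnd: "\<bar>f x\<bar> \<le> R" if x: "x \<in> {0..1}" for x
  proof -
    have "\<bar>f x\<bar> \<le> (\<Sum>j=1..K. \<bar>b j * indicator {t (j - 1)..<t j} x\<bar>)"
      unfolding fx[OF x] by (rule sum_abs)
    also have "\<dots> \<le> (\<Sum>j=1..K. R * indicator {t (j - 1)..<t j} x)"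
      using b by (intro sum_mono) (auto simp: indicator_def)
    also have "\<dots> = R * indicator {t 0..<t K} x"
      using ind_sum[of K x] by (simp add: sum_distrib_left[symmetric])
    also have "\<dots> \<le> R" using R by (auto simp: indicator_def)
    finally show ?thesis .
  qed
  then show "\<And>x. x \<in> {0..1} \<Longrightarrow> \<bar>f x\<bar> \<le> R" .
  have const: "f x = f y" if x: "x \<in> {0..1}" and y: "y \<in> {0..1}" and no: "\<And>j. j \<in> {1..K} \<Longrightarrow> \<not> (min x y \<le> t j \<and> t j \<le> max x y)" for x y
    unfolding fx[OF x] fx[OF y]
  proof (intro sum.cong refl)
    fix j assume j: "j \<in> {1..K}"
    have "x < t j \<longleftrightarrow> y < t j" using no[OF j] by auto
    moreover have "t (j - 1) \<le> x \<longleftrightarrow> t (j - 1) \<le> y"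
    proof (cases "j = 1")
      case True
      then show ?thesis using t(1) x y by simp
    next
      case False
      then have "j - 1 \<in> {1..K}" using j by auto
      from no[OF this] show ?thesis by auto
    qed
    ultimately show "b j * indicator {t (j - 1)..<t j} x = b j * indicator {t (j - 1)..<t j} y"
      by (simp add: indicator_def)
  qed
  \<comment> \<open>The right end \<open>t K = 1\<close> counts as a breakpoint because
    \<open>f\<close> takes the value 0 there, all intervals being half-open.\<close>
  define near where "near i \<longleftrightarrow> (\<exists>j\<in>{1..K}. \<bar>t j - real i / real m\<bar> \<le> 2 / real m)" for i
  define w where "w i = (if near i then - R else f (real i / real m))" for i
  define e where "e x = 2 * R * (\<Sum>j=1..K. indicator {t j - 4 / real m..t j + 4 / real m} x)" for x
  have im: "real i / real m \<in> {0..1}" if "i \<le> m" for i using that mr by simp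
  have e0: "0 \<le> e x" for x using R by (auto simp: e_def intro!: mult_nonneg_nonneg sum_nonneg)
  have w_bnd: "\<bar>w i\<bar> \<le> R" if "i \<le> m" for i using bnd[OF im[OF that]] R by (auto simp: w_def)
  have w_near: "w i \<le> f x \<and> f x - e x \<le> w i"
    if i: "i \<le> m" and x: "x \<in> {0..1}" and xi: "\<bar>x - real i / real m\<bar> \<le> 2 / real m" for i x
  proof (cases "near i")
    case True
    then obtain j where j: "j \<in> {1..K}" "\<bar>t j - real i / real m\<bar> \<le> 2 / real m" by (auto simp: near_def)
    have "\<bar>t j - x\<bar> \<le> 2 / real m + 2 / real m" using j(2) xi by linarith
    then have "indicator {t j - 4 / real m..t j + 4 / real m} x = (1 :: real)"
      by (auto simp: indicator_def abs_le_iff)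
    then have "1 \<le> (\<Sum>j=1..K. indicator {t j - 4 / real m..t j + 4 / real m} x :: real)"
      using member_le_sum[OF j(1), of "\<lambda>j. indicator {t j - 4 / real m..t j + 4 / real m} x :: real"] by simp
    then have "2 * R * 1 \<le> e x" unfolding e_def using R by (intro mult_left_mono) auto
    then show ?thesis using True bnd[OF x] by (auto simp: w_def)
  next
    case False
    have "f x = f (real i / real m)"
    proof (rule const[OF x im[OF i]])
      fix j assume "j \<in> {1..K}"
      then have "\<not> \<bar>t j - real i / real m\<bar> \<le> 2 / real m" using False by (auto simp: near_def)
      then show "\<not> (min x (real i / real m) \<le> t j \<and> t j \<le> max x (real i / real m))"
        using xi by (auto simp: min_def max_def abs_le_iff split: if_splits)
    qed
    then show ?thesis using False e0[of x] by (simp add: w_def)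
  qed
  have int_e: "set_integrable lborel {0..1} e" "(LINT x:{0..1}|lborel. e x) \<le> 16 * R * real K / real m"
  proof -
    have i: "set_integrable lborel {0..1} (\<lambda>x. indicator {t j - 4 / real m..t j + 4 / real m} x :: real)" for j
      by (rule bounded_set_integrable01[where B = 1]) auto
    have s: "set_integrable lborel {0..1} (\<lambda>x. \<Sum>j=1..K. indicator {t j - 4 / real m..t j + 4 / real m} x :: real)"
      by (intro set_integral_finite_sum i)
    show "set_integrable lborel {0..1} e" unfolding e_def by (intro set_integrable_mult_right s)
    have "(LINT x:{0..1}|lborel. e x) = 2 * R * (\<Sum>j=1..K. LINT x:{0..1}|lborel. indicator {t j - 4 / real m..t j + 4 / real m} x)"
      unfolding e_def by (simp only: set_integral_mult_right set_integral_finite_sum[OF i])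
    also have "\<dots> \<le> 2 * R * (\<Sum>j=1..K. 8 / real m)"
    proof (intro mult_left_mono sum_mono)
      fix j
      have "(LINT x:{0..1}|lborel. indicator {t j - 4 / real m..t j + 4 / real m} x :: real)
          \<le> (LINT x|lborel. indicator {t j - 4 / real m..t j + 4 / real m} x)"
        unfolding set_lebesgue_integral_def
      proof (rule integral_mono)
        show "integrable lborel (\<lambda>x. indicator {0..1} x *\<^sub>R (indicator {t j - 4 / real m..t j + 4 / real m} x :: real))"
          using i[of j] by (simp add: set_integrable_def)
        show "integrable lborel (\<lambda>x. indicator {t j - 4 / real m..t j + 4 / real m} x :: real)"
          by (simp add: integrable_indicator_iff emeasure_lborel_Icc_eq)
      qed (simp add: indicator_def)
      also have "\<dots> = 8 / real m" using mr by simp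
      finally show "(LINT x:{0..1}|lborel. indicator {t j - 4 / real m..t j + 4 / real m} x :: real) \<le> 8 / real m" .
    qed (use R in auto)
    also have "\<dots> = 16 * R * real K / real m" by simp
    finally show "(LINT x:{0..1}|lborel. e x) \<le> 16 * R * real K / real m" .
  qed
  have card: "card {i \<in> {1..m}. w i \<noteq> w (i - 1)} \<le> 7 * K"
  proof -
    have "{i \<in> {1..m}. w i \<noteq> w (i - 1)} \<subseteq> (\<Union>j\<in>{1..K}. {i. \<bar>real m * t j - real i\<bar> \<le> 3})"
    proof
      fix i assume "i \<in> {i \<in> {1..m}. w i \<noteq> w (i - 1)}"
      then have i: "1 \<le> i" "i \<le> m" and ne: "w i \<noteq> w (i - 1)" by auto
      have step: "real (i - 1) / real m = real i / real m - 1 / real m"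
        using i by (simp add: of_nat_diff diff_divide_distrib)
      \<comment> \<open>If all breakpoints were farther than \<open>3 / m\<close> from
        \<open>i / m\<close>, neither \<open>i\<close> nor \<open>i - 1\<close> would be near one
        and none would lie between the two grid points, so the levels would agree.\<close>
      have "\<exists>j\<in>{1..K}. \<bar>t j - real i / real m\<bar> \<le> 3 / real m"
      proof (rule ccontr)
        assume no: "\<not> (\<exists>j\<in>{1..K}. \<bar>t j - real i / real m\<bar> \<le> 3 / real m)"
        have far: "3 / real m < \<bar>t j - real i / real m\<bar>" if "j \<in> {1..K}" for j
          using no that by (meson not_le)
        have three: "3 / real m = 2 / real m + 1 / real m" "0 < 1 / real m" "2 / real m = 1 / real m + 1 / real m"
          using mr by (auto simp: add_divide_distrib[symmetric])
        have "\<not> near i"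
        proof
          assume "near i"
          then obtain j where "j \<in> {1..K}" "\<bar>t j - real i / real m\<bar> \<le> 2 / real m" unfolding near_def by blast
          then show False using far[of j] three by linarith
        qed
        moreover have "\<not> near (i - 1)"
        proof
          assume "near (i - 1)"
          then obtain j where "j \<in> {1..K}" "\<bar>t j - (real i / real m - 1 / real m)\<bar> \<le> 2 / real m"
            unfolding near_def step by blast
          then show False using far[of j] three by linarith
        qed
        moreover have "f (real i / real m) = f (real (i - 1) / real m)"
        proof (rule const[OF im[OF i(2)] im])
          fix j assume "j \<in> {1..K}"
          from far[OF this] three show "\<not> (min (real i / real m) (real (i - 1) / real m) \<le> t j \<and> t j \<le> max (real i / real m) (real (i - 1) / real m))"
            unfolding step by linarith
        qed (use i in simp)
        ultimately show False using ne by (simp add: w_def)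
      qed
      then obtain j where j: "j \<in> {1..K}" "\<bar>t j - real i / real m\<bar> \<le> 3 / real m" by blast
      have "\<bar>real m * t j - real i\<bar> = real m * \<bar>t j - real i / real m\<bar>"
      proof -
        have "real m * t j - real i = real m * (t j - real i / real m)" using mr by (simp add: right_diff_distrib)
        then show ?thesis by (simp add: abs_mult)
      qed
      also have "\<dots> \<le> real m * (3 / real m)" using j(2) by (intro mult_left_mono) auto
      finally have "\<bar>real m * t j - real i\<bar> \<le> 3" using mr by simp
      then show "i \<in> (\<Union>j\<in>{1..K}. {i. \<bar>real m * t j - real i\<bar> \<le> 3})" using j(1) by blast
    qed
    then have "card {i \<in> {1..m}. w i \<noteq> w (i - 1)} \<le> card (\<Union>j\<in>{1..K}. {i. \<bar>real m * t j - real i\<bar> \<le> 3})"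
      by (intro card_mono) (auto intro: finite_nat_near)
    also have "\<dots> \<le> (\<Sum>j\<in>{1..K}. card {i. \<bar>real m * t j - real i\<bar> \<le> 3})"
      by (rule card_UN_le) simp
    also have "\<dots> \<le> (\<Sum>j\<in>{1..K}. 7)" by (intro sum_mono card_nat_near_le)
    finally show ?thesis by simp
  qed
  show "staircase_below m R (- (2 * R)) (16 * R * real K / real m) (7 * real K) f"
  proof (rule staircase_belowI[OF w_bnd _ w_near int_e])
    fix i assume "i \<in> {1..m}"
    then have "i \<le> m" "i - 1 \<le> m" by auto
    from w_bnd[OF this(1)] w_bnd[OF this(2)] show "- (2 * R) \<le> w i - w (i - 1)" by linarith
  next
    show "real (card {i \<in> {1..m}. w i \<noteq> w (i - 1)}) \<le> 7 * real K" using card by linarith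
  qed
qed

section \<open>The three rates\<close>

lemma ln_le_two_sqrt: "x > 0 \<Longrightarrow> ln x \<le> 2 * sqrt (x :: real)"
  using ln_le_minus_one[of "sqrt x"] by (simp add: ln_sqrt)

text \<open>By \<open>ln n \<le> 2 * sqrt n\<close> the quotient \<open>n / ln n\<close> is at least
  \<open>sqrt n / 2\<close>, so half of the exponent \<open>th\<close> survives as polynomial
  growth, which is what \<open>contraction_rate\<close> asks of \<open>kap\<close>.\<close>

lemma div_ln_powr_rate:
  assumes th: "0 < th" "th \<le> 1"
  defines "kap \<equiv> \<lambda>n :: nat. (real n / ln (real n)) powr th"
  shows "\<forall>\<^sub>F n in sequentially. (1 / 2) powr th * real n powr (th / 2) \<le> kap n"
    "\<forall>\<^sub>F n in sequentially. kap n * ln (real n) \<le> real n"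
    "\<forall>\<^sub>F n in sequentially. 1 \<le> kap n \<and> kap n \<le> real n"
proof -
  have ev: "\<forall>\<^sub>F n in sequentially. 3 \<le> n" by (rule eventually_ge_at_top)
  have basic: "1 \<le> ln (real n)" "1 \<le> real n / ln (real n)" "0 < ln (real n)" if "3 \<le> n" for n
  proof -
    show 1: "1 \<le> ln (real n)"
      using that exp_le by (subst ln_ge_iff) auto
    then show 0: "0 < ln (real n)" by linarith
    have "ln (real n) \<le> real n" using ln_le_minus_one[of "real n"] that by simp
    then show "1 \<le> real n / ln (real n)" using 0 by (simp add: pos_le_divide_eq)
  qed
  have le: "kap n \<le> real n / ln (real n)" if "3 \<le> n" for n
    unfolding kap_def using powr_mono[OF th(2) basic(2)[OF that]] basic(2)[OF that] by simp
  show "\<forall>\<^sub>F n in sequentially. (1 / 2) powr th * real n powr (th / 2) \<le> kap n"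
    using ev
  proof eventually_elim
    case (elim n)
    have n0: "0 < real n" using elim by simp
    have "1 / 2 * sqrt (real n) \<le> real n / ln (real n)"
    proof -
      have "sqrt (real n) * ln (real n) \<le> sqrt (real n) * (2 * sqrt (real n))"
        using ln_le_two_sqrt[OF n0] by (intro mult_left_mono) auto
      also have "\<dots> = 2 * real n" by simp
      finally show ?thesis using basic(3)[OF elim] by (simp add: pos_le_divide_eq)
    qed
    then have "(1 / 2 * sqrt (real n)) powr th \<le> kap n"
      unfolding kap_def using th n0 by (intro powr_mono2) auto
    moreover have "(1 / 2 * sqrt (real n)) powr th = (1 / 2) powr th * real n powr (th / 2)"
    proof -
      have "(1 / 2 * sqrt (real n)) powr th = (1 / 2) powr th * sqrt (real n) powr th"
        by (rule powr_mult)
      also have "sqrt (real n) powr th = real n powr (th / 2)"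
        using n0 by (simp add: powr_half_sqrt[symmetric] powr_powr)
      finally show ?thesis .
    qed
    ultimately show ?case by simp
  qed
  show "\<forall>\<^sub>F n in sequentially. kap n * ln (real n) \<le> real n"
    using ev
  proof eventually_elim
    case (elim n)
    then show ?case using le[OF elim] basic[OF elim] by (simp add: pos_le_divide_eq)
  qed
  show "\<forall>\<^sub>F n in sequentially. 1 \<le> kap n \<and> kap n \<le> real n"
    using ev
  proof eventually_elim
    case (elim n)
    have "kap n \<le> real n / 1"
      by (rule order_trans[OF le[OF elim]]) (use basic[OF elim] in \<open>intro divide_left_mono, auto\<close>)
    moreover have "1 \<le> kap n" unfolding kap_def using basic(2)[OF elim] th by (intro ge_one_powr_ge_zero) auto
    ultimately show ?case by simp
  qed
qed

lemma ceiling_mesh: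
  assumes "1 \<le> k" "k \<le> real n"
  shows "0 < nat \<lceil>k\<rceil>" "nat \<lceil>k\<rceil> \<le> n" "k \<le> real (nat \<lceil>k\<rceil>)" "real (nat \<lceil>k\<rceil>) \<le> 2 * k"
  using assms by linarith+

lemma positive_continuous_lower_bound:
  fixes f :: "real \<Rightarrow> real"
  assumes "continuous_on {l..u} f" "\<And>x. x \<in> {l..u} \<Longrightarrow> 0 < f x" "l \<le> u"
  obtains a where "0 < a" "\<And>x. x \<in> {l..u} \<Longrightarrow> a \<le> f x"
  using continuous_attains_inf[of "{l..u}" f] assms by (metis atLeastatMost_empty_iff compact_Icc)

locale compound_poisson_prior = compound_poisson +
  fixes g h :: "real \<Rightarrow> real" and gam L :: real
  assumes h: "distributed \<Omega> lborel (\<Delta> 0) (\<lambda>x. ennreal (h x))" "\<And>x. h x > 0" "continuous_on UNIV h"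
    and g: "\<And>k. k \<ge> 1 \<Longrightarrow> distributed \<Omega> lborel (\<Delta> k) (\<lambda>x. ennreal (g x))"
    and gam: "0 < gam" and L: "0 < L"
    and tails: "\<And>k s. s \<ge> 0 \<Longrightarrow> prob {\<omega> \<in> space \<Omega>. s \<le> \<bar>\<Delta> k \<omega>\<bar>} \<le> inverse L * exp (- L * s powr gam)"
begin

text \<open>Both intervals are compact. The bound \<open>dmin\<close> records how far down the jumps
  have to reach; for \<open>dmin = 0\<close>, positivity of \<open>g\<close> on the half-line is
  enough.\<close>

lemma densities_lower_bound:
  assumes R: "0 < R" and g': "continuous_on {dmin..2 * R + 1} g" "\<And>x. x \<in> {dmin..2 * R + 1} \<Longrightarrow> 0 < g x" "dmin \<le> 0"
  obtains a where "0 < a" "\<And>x. x \<in> {- R - 3..R} \<Longrightarrow> a \<le> h x" "\<And>x. x \<in> {dmin..2 * R + 1} \<Longrightarrow> a \<le> g x"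
proof -
  obtain a where a: "0 < a" "\<And>x. x \<in> {- R - 3..R} \<Longrightarrow> a \<le> h x"
    by (rule positive_continuous_lower_bound[of "- R - 3" R h])
      (use R h in \<open>auto intro: continuous_on_subset\<close>)
  obtain b where b: "0 < b" "\<And>x. x \<in> {dmin..2 * R + 1} \<Longrightarrow> b \<le> g x"
    by (rule positive_continuous_lower_bound[OF g'(1,2)]) (use R g'(3) in auto)
  show ?thesis
    using a b by (intro that[of "min a b"]) (auto intro: min.coboundedI1 min.coboundedI2)
qed

text \<open>With about \<open>kap n\<close> cells the loss is of order \<open>1 / kap n\<close>.
  Equating this with the rate \<open>kap n * ln n / n\<close> makes \<open>kap n\<close> the square
  root of \<open>n / ln n\<close>.\<close>

lemma monotone_class_rate:
  assumes R: "R > 0" and g': "\<And>x. x \<ge> 0 \<Longrightarrow> g x > 0" "continuous_on {0..} g"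
  defines "kap \<equiv> \<lambda>n :: nat. (real n / ln (real n)) powr (1 / 2)"
  shows "\<exists>M0. \<forall>M\<ge>M0. \<forall>\<^sub>F n in sequentially. \<forall>f0\<in>monotone_class R.
    expected_posterior (cpp_law \<Omega> N \<Delta>) n f0 (L1_far f0 (M * (kap n * ln (real n) / real n)))
      \<le> ennreal (exp (- (kap n * ln (real n))))"
proof -
  obtain a where a: "0 < a" "\<And>x. x \<in> {- R - 3..R} \<Longrightarrow> a \<le> h x" "\<And>x. x \<in> {0..2 * R + 1} \<Longrightarrow> a \<le> g x"
    by (rule densities_lower_bound[OF R, of 0]) (use g' in \<open>auto intro: continuous_on_subset\<close>)
  have th: "0 < (1 / 2 :: real)" "(1 / 2 :: real) \<le> 1" by auto
  have rate: "\<forall>\<^sub>F n in sequentially. (1 / 2) powr (1 / 2) * real n powr (1 / 2 / 2) \<le> kap n"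
    "\<forall>\<^sub>F n in sequentially. kap n * ln (real n) \<le> real n"
    "\<forall>\<^sub>F n in sequentially. 1 \<le> kap n \<and> kap n \<le> real n"
    unfolding kap_def by (rule div_ln_powr_rate[OF th])+
  show ?thesis
  proof (rule contraction_rate[where h = h and g = g and R = R and dmin = 0 and a = a and cc = "8 * R + 2"
        and b = "(1 / 2) powr (1 / 2)" and rho = "1 / 4" and gam = gam and L = L])
    show "\<forall>\<^sub>F n in sequentially. (1 / 2) powr (1 / 2) * real n powr (1 / 4) \<le> kap n" using rate(1) by simp
    show "\<forall>\<^sub>F n in sequentially. kap n * ln (real n) \<le> real n" by (rule rate(2))
    show "\<forall>\<^sub>F n in sequentially. \<forall>f0\<in>monotone_class R.
      (\<lambda>x. f0 (clamp01 x)) \<in> borel_measurable borel \<and> (\<forall>x\<in>{0..1}. \<bar>f0 x\<bar> \<le> R) \<and>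
      (\<exists>m. 0 < m \<and> m \<le> n \<and> staircase_below m R 0
        ((8 * R + 2) * (kap n * ln (real n) / real n)) ((8 * R + 2) * kap n) f0)"
      using rate(3) eventually_ge_at_top[of 2]
    proof eventually_elim
      case (elim n)
      define m where "m = nat \<lceil>kap n\<rceil>"
      note m = ceiling_mesh[of "kap n" n, folded m_def, OF conjunct1[OF elim(1)] conjunct2[OF elim(1)]]
      have ln0: "0 < ln (real n)" using elim by simp
      have "kap n * kap n = real n / ln (real n)"
        unfolding kap_def using ln0 elim(2) by (simp add: powr_add[symmetric])
      then have "kap n * ln (real n) / real n = 1 / kap n"
        using elim ln0 by (simp add: field_simps)
      moreover have "1 / real m \<le> 1 / kap n" using m elim by (intro divide_left_mono) auto
      ultimately have "8 * R * (1 / real m) \<le> 8 * R * (kap n * ln (real n) / real n)"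
        using R by (intro mult_left_mono) auto
      moreover have "0 \<le> 2 * (kap n * ln (real n) / real n)" using elim ln0 by simp
      ultimately have loss: "8 * R / real m \<le> (8 * R + 2) * (kap n * ln (real n) / real n)"
        by (simp only: distrib_right) simp
      have count: "real m \<le> (8 * R + 2) * kap n"
      proof -
        have "2 * kap n \<le> (8 * R + 2) * kap n" using R elim by (intro mult_right_mono) auto
        then show ?thesis using m(4) by linarith
      qed
      show ?case
      proof (intro ballI conjI)
        fix f0 assume f0: "f0 \<in> monotone_class R"
        note S = monotone_class_staircase[OF f0 m(1)]
        show "(\<lambda>x. f0 (clamp01 x)) \<in> borel_measurable borel" by (rule S(1))
        show "\<bar>f0 x\<bar> \<le> R" if "x \<in> {0..1}" for x using S(2)[OF that] .
        from staircase_below_mono[OF S(3) loss count]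
        show "\<exists>m. 0 < m \<and> m \<le> n \<and> staircase_below m R 0 ((8 * R + 2) * (kap n * ln (real n) / real n)) ((8 * R + 2) * kap n) f0"
          using m(1,2) by blast
      qed
    qed
  qed ((rule h(1) g tails gam L a; assumption)+, use a R in auto)
qed

text \<open>With about \<open>kap n\<close> cells the loss is of order
  \<open>kap n powr (- \<beta>)\<close>; equating it with \<open>kap n * ln n / n\<close> gives the
  exponent \<open>1 / (1 + \<beta>)\<close>. The radius is tripled because the staircase is lowered
  out of the range of the class.\<close>

lemma holder_ball_rate:
  assumes R: "R > 0" and g': "\<And>x. g x > 0" "continuous_on UNIV g" and \<beta>: "0 < \<beta>" "\<beta> \<le> 1"
  defines "kap \<equiv> \<lambda>n :: nat. (real n / ln (real n)) powr (1 / (1 + \<beta>))"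
  shows "\<exists>M0. \<forall>M\<ge>M0. \<forall>\<^sub>F n in sequentially. \<forall>f0\<in>holder_ball \<beta> R.
    expected_posterior (cpp_law \<Omega> N \<Delta>) n f0 (L1_far f0 (M * (kap n * ln (real n) / real n)))
      \<le> ennreal (exp (- (kap n * ln (real n))))"
proof -
  have R3: "0 < 3 * R" using R by simp
  obtain a where a: "0 < a" "\<And>x. x \<in> {- (3 * R) - 3..3 * R} \<Longrightarrow> a \<le> h x"
    "\<And>x. x \<in> {- (6 * R)..2 * (3 * R) + 1} \<Longrightarrow> a \<le> g x"
    by (rule densities_lower_bound[OF R3, of "- (6 * R)"]) (use g' R in \<open>auto intro: continuous_on_subset\<close>)
  have th: "0 < 1 / (1 + \<beta>)" "1 / (1 + \<beta>) \<le> 1" using \<beta> by auto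
  have rate: "\<forall>\<^sub>F n in sequentially. (1 / 2) powr (1 / (1 + \<beta>)) * real n powr (1 / (1 + \<beta>) / 2) \<le> kap n"
    "\<forall>\<^sub>F n in sequentially. kap n * ln (real n) \<le> real n"
    "\<forall>\<^sub>F n in sequentially. 1 \<le> kap n \<and> kap n \<le> real n"
    unfolding kap_def by (rule div_ln_powr_rate[OF th])+
  show ?thesis
  proof (rule contraction_rate[where h = h and g = g and R = "3 * R" and dmin = "- (6 * R)" and a = a and cc = "4 * R + 2"
        and b = "(1 / 2) powr (1 / (1 + \<beta>))" and rho = "1 / (1 + \<beta>) / 2" and gam = gam and L = L])
    show "\<forall>\<^sub>F n in sequentially. (1 / 2) powr (1 / (1 + \<beta>)) * real n powr (1 / (1 + \<beta>) / 2) \<le> kap n" by (rule rate(1))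
    show "\<forall>\<^sub>F n in sequentially. kap n * ln (real n) \<le> real n" by (rule rate(2))
    show "\<forall>\<^sub>F n in sequentially. \<forall>f0\<in>holder_ball \<beta> R.
      (\<lambda>x. f0 (clamp01 x)) \<in> borel_measurable borel \<and> (\<forall>x\<in>{0..1}. \<bar>f0 x\<bar> \<le> 3 * R) \<and>
      (\<exists>m. 0 < m \<and> m \<le> n \<and> staircase_below m (3 * R) (- (6 * R))
        ((4 * R + 2) * (kap n * ln (real n) / real n)) ((4 * R + 2) * kap n) f0)"
      using rate(3) eventually_ge_at_top[of 2]
    proof eventually_elim
      case (elim n)
      define m where "m = nat \<lceil>kap n\<rceil>"
      note m = ceiling_mesh[of "kap n" n, folded m_def, OF conjunct1[OF elim(1)] conjunct2[OF elim(1)]]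
      have ln0: "0 < ln (real n)" and n0: "0 < real n" using elim by auto
      have k0: "0 < kap n" using elim by simp
      define y where "y = real n / ln (real n)"
      have y0: "0 < y" using ln0 n0 by (simp add: y_def)
      have pow: "(1 / kap n) powr \<beta> = kap n * ln (real n) / real n"
      proof -
        have "(1 / kap n) powr \<beta> = (y powr (- (1 / (1 + \<beta>)))) powr \<beta>"
          by (simp add: kap_def y_def powr_minus_divide)
        also have "\<dots> = y powr (1 / (1 + \<beta>) - 1)"
          using \<beta> by (simp add: powr_powr) (simp add: field_simps)
        also have "\<dots> = y powr (1 / (1 + \<beta>)) / y" using y0 by (simp add: powr_diff)
        finally show ?thesis by (simp add: kap_def y_def)
      qed
      have "(1 / real m) powr \<beta> \<le> (1 / kap n) powr \<beta>"
        using m k0 \<beta> by (intro powr_mono2 divide_left_mono) auto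
      then have "4 * R * (1 / real m) powr \<beta> \<le> 4 * R * (kap n * ln (real n) / real n)"
        unfolding pow using R by (intro mult_left_mono) auto
      moreover have "0 \<le> 2 * (kap n * ln (real n) / real n)" using k0 ln0 by simp
      ultimately have loss: "4 * R * (1 / real m) powr \<beta> \<le> (4 * R + 2) * (kap n * ln (real n) / real n)"
        by (simp only: distrib_right)
      have count: "real m \<le> (4 * R + 2) * kap n"
      proof -
        have "2 * kap n \<le> (4 * R + 2) * kap n" using R k0 by (intro mult_right_mono) auto
        then show ?thesis using m(4) by linarith
      qed
      show ?case
      proof (intro ballI conjI)
        fix f0 assume f0: "f0 \<in> holder_ball \<beta> R"
        note S = holder_ball_staircase[OF f0 R \<beta> m(1)]
        show "(\<lambda>x. f0 (clamp01 x)) \<in> borel_measurable borel" by (rule S(1))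
        show "\<bar>f0 x\<bar> \<le> 3 * R" if "x \<in> {0..1}" for x using holder_ballD(1)[OF f0 R that] R by simp
        from staircase_below_mono[OF S(2) loss count]
        show "\<exists>m. 0 < m \<and> m \<le> n \<and> staircase_below m (3 * R) (- (6 * R)) ((4 * R + 2) * (kap n * ln (real n) / real n)) ((4 * R + 2) * kap n) f0"
          using m(1,2) by blast
      qed
    qed
  qed ((rule h(1) g tails gam L a; assumption)+, use a R \<beta> in auto)
qed

text \<open>The number of jumps is governed by \<open>K n\<close> for every mesh, so the finest
  admissible mesh \<open>m = n\<close> is taken; the loss of order \<open>K n / n\<close> is then
  below the rate by a logarithm.\<close>

lemma piecewise_constant_rate:
  fixes K :: "nat \<Rightarrow> nat"
  assumes R: "R > 0" and g': "\<And>x. g x > 0" "continuous_on UNIV g"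
    and K: "\<And>n. K n > 0" and rho: "0 < rho" "\<And>n. real n powr rho \<le> C * real (K n)"
    and small: "(\<lambda>n. real (K n)) \<in> o(\<lambda>n. real n / ln (real n))"
  shows "\<exists>M0. \<forall>M\<ge>M0. \<forall>\<^sub>F n in sequentially. \<forall>f0\<in>piecewise_constant (K n) R.
    expected_posterior (cpp_law \<Omega> N \<Delta>) n f0 (L1_far f0 (M * (real (K n) * ln (real n) / real n)))
      \<le> ennreal (exp (- (real (K n) * ln (real n))))"
proof -
  obtain a where a: "0 < a" "\<And>x. x \<in> {- R - 3..R} \<Longrightarrow> a \<le> h x" "\<And>x. x \<in> {- (2 * R)..2 * R + 1} \<Longrightarrow> a \<le> g x"
    by (rule densities_lower_bound[OF R, of "- (2 * R)"]) (use g' R in \<open>auto intro: continuous_on_subset\<close>)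
  have C: "0 < C"
  proof -
    have "1 \<le> C * real (K 1)" using rho(2)[of 1] by simp
    then show ?thesis using K[of 1] by (cases "0 < C") (auto simp: not_less dest: mult_nonpos_nonneg[of C "real (K 1)"])
  qed
  show ?thesis
  proof (rule contraction_rate[where h = h and g = g and R = R and dmin = "- (2 * R)" and a = a and cc = "16 * R + 7"
        and b = "1 / C" and rho = rho and gam = gam and L = L])
    show "\<forall>\<^sub>F n in sequentially. 1 / C * real n powr rho \<le> real (K n)"
      using rho(2) C by (intro always_eventually allI) (simp add: pos_divide_le_eq mult.commute)
    have "\<forall>\<^sub>F n in sequentially. norm (real (K n)) \<le> 1 * norm (real n / ln (real n))"
      by (rule landau_o.smallD[OF small]) simp
    then show "\<forall>\<^sub>F n in sequentially. real (K n) * ln (real n) \<le> real n"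
      using eventually_ge_at_top[of 2]
    proof eventually_elim
      case (elim n)
      then have "0 < ln (real n)" by simp
      then show ?case using elim by (simp add: pos_le_divide_eq)
    qed
    show "\<forall>\<^sub>F n in sequentially. \<forall>f0\<in>piecewise_constant (K n) R.
      (\<lambda>x. f0 (clamp01 x)) \<in> borel_measurable borel \<and> (\<forall>x\<in>{0..1}. \<bar>f0 x\<bar> \<le> R) \<and>
      (\<exists>m. 0 < m \<and> m \<le> n \<and> staircase_below m R (- (2 * R))
        ((16 * R + 7) * (real (K n) * ln (real n) / real n)) ((16 * R + 7) * real (K n)) f0)"
      using eventually_ge_at_top[of 3]
    proof eventually_elim
      case (elim n)
      have n0: "0 < n" using elim by simp
      have ln1: "1 \<le> ln (real n)" using elim exp_le by (subst ln_ge_iff) auto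
      have loss: "16 * R * real (K n) / real n \<le> (16 * R + 7) * (real (K n) * ln (real n) / real n)"
      proof -
        have "16 * R * real (K n) \<le> (16 * R + 7) * (real (K n) * ln (real n))"
        proof -
          have "16 * R * real (K n) \<le> (16 * R + 7) * real (K n)" by (intro mult_right_mono) auto
          also have "\<dots> = (16 * R + 7) * (real (K n) * 1)" by simp
          also have "\<dots> \<le> (16 * R + 7) * (real (K n) * ln (real n))"
            using R ln1 by (intro mult_left_mono) auto
          finally show ?thesis .
        qed
        from divide_right_mono[OF this, of "real n"] show ?thesis by simp
      qed
      have count: "7 * real (K n) \<le> (16 * R + 7) * real (K n)"
        using R by (intro mult_right_mono) auto
      show ?case
      proof (intro ballI conjI)
        fix f0 assume f0: "f0 \<in> piecewise_constant (K n) R"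
        note S = piecewise_constant_staircase[OF f0 R n0]
        show "(\<lambda>x. f0 (clamp01 x)) \<in> borel_measurable borel" by (rule S(1))
        show "\<bar>f0 x\<bar> \<le> R" if "x \<in> {0..1}" for x by (rule S(2)[OF that])
        from staircase_below_mono[OF S(3) loss count]
        show "\<exists>m. 0 < m \<and> m \<le> n \<and> staircase_below m R (- (2 * R)) ((16 * R + 7) * (real (K n) * ln (real n) / real n)) ((16 * R + 7) * real (K n)) f0"
          using n0 by blast
      qed
    qed
  qed ((rule h(1) g tails gam L a; assumption)+, use a R rho C in auto)
qed

end

lemma sqrt_rate_eq:
  assumes "0 < n" "0 < l"
  shows "(n / l) powr (1 / 2) * l / n = sqrt (l / n)" "(n / l) powr (1 / 2) * l = sqrt (n * l)"
proof -
  define a b where "a = sqrt n" and "b = sqrt l"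
  have ab: "0 < a" "0 < b" "n = a * a" "l = b * b" using assms by (auto simp: a_def b_def)
  have "(n / l) powr (1 / 2) = a / b"
    using assms by (simp add: powr_half_sqrt real_sqrt_divide a_def b_def)
  moreover have "sqrt (l / n) = b / a" "sqrt (n * l) = a * b"
    using assms by (simp_all add: real_sqrt_divide real_sqrt_mult a_def b_def)
  ultimately show "(n / l) powr (1 / 2) * l / n = sqrt (l / n)" "(n / l) powr (1 / 2) * l = sqrt (n * l)"
    using ab by (simp_all add: ab(3,4))
qed

lemma powr_rate_eq:
  fixes n l \<beta> :: real
  assumes "0 < n" "0 < l" "0 < \<beta>"
  shows "(n / l) powr (1 / (1 + \<beta>)) * l / n = (l / n) powr (\<beta> / (1 + \<beta>))"
proof -
  have y: "0 < n / l" using assms by simp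
  have "(n / l) powr (1 / (1 + \<beta>)) * l / n = (n / l) powr (1 / (1 + \<beta>)) / (n / l) powr 1"
    using assms by simp
  also have "\<dots> = (n / l) powr (1 / (1 + \<beta>) - 1)" by (rule powr_diff[symmetric])
  also have "1 / (1 + \<beta>) - 1 = - (\<beta> / (1 + \<beta>))" using assms by (simp add: field_simps)
  also have "(n / l) powr (- (\<beta> / (1 + \<beta>))) = (l / n) powr (\<beta> / (1 + \<beta>))"
    using assms by (simp add: powr_minus powr_divide)
  finally show ?thesis .
qed

theorem theorem2p1:
  fixes \<Omega> :: "'w measure"
    and N :: "real \<Rightarrow> 'w \<Rightarrow> nat"
    and \<Delta> :: "nat \<Rightarrow> 'w \<Rightarrow> real"
    and g h :: "real \<Rightarrow> real"
    and R lam \<gamma> L \<beta> :: real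
    and K :: "nat \<Rightarrow> nat"
    and prior :: "(real \<Rightarrow> real) measure"
  assumes "R > 0" and "lam > 0"
    and "poisson_process \<Omega> lam N"
    and "cpp_independent \<Omega> N \<Delta>"
    and "distributed \<Omega> lborel (\<Delta> 0) (\<lambda>x. ennreal (h x))"
    and "\<forall>x. h x > 0" and "continuous_on UNIV h"
    and "\<forall>i\<ge>1. distributed \<Omega> lborel (\<Delta> i) (\<lambda>x. ennreal (g x))"
    and "\<forall>x. g x \<ge> 0"
    and "\<gamma> > 0" and "L > 0"
    and "\<forall>i. \<forall>s\<ge>0. measure \<Omega> {\<omega>\<in>space \<Omega>. \<bar>\<Delta> i \<omega>\<bar> \<ge> s} \<le> inverse L * exp (- L * s powr \<gamma>)"
    and "prior = cpp_law \<Omega> N \<Delta>"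
  shows "\<exists>M>0. \<exists>c>0. \<forall>\<^sub>F n in sequentially.
    ((\<forall>x\<ge>0. g x > 0) \<and> continuous_on {0..} g \<longrightarrow>
       (SUP f0\<in>monotone_class R.
          expected_posterior prior n f0 (L1_far f0 (M * sqrt (ln (real n) / real n))))
       \<le> ennreal (exp (- c * sqrt (real n * ln (real n))))) \<and>
    ((\<forall>x. g x > 0) \<and> continuous_on UNIV g \<and> 0 < \<beta> \<and> \<beta> \<le> 1 \<longrightarrow>
       (SUP f0\<in>holder_ball \<beta> R.
          expected_posterior prior n f0 (L1_far f0 (M * (ln (real n) / real n) powr (\<beta> / (1 + \<beta>)))))
       \<le> ennreal (exp (- c * real n * (ln (real n) / real n) powr (\<beta> / (1 + \<beta>))))) \<and>
    ((\<forall>x. g x > 0) \<and> continuous_on UNIV g \<and> (\<forall>m. K m > 0) \<and>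
       (\<exists>\<rho>>0. \<exists>C. \<forall>m. real m powr \<rho> \<le> C * real (K m)) \<and>
       (\<lambda>m. real (K m)) \<in> o(\<lambda>m. real m / ln (real m)) \<longrightarrow>
       (SUP f0\<in>piecewise_constant (K n) R.
          expected_posterior prior n f0 (L1_far f0 (M * (real (K n) / real n) * ln (real n))))
       \<le> ennreal (real n powr (- c * real (K n))))"
proof -
  interpret compound_poisson_prior \<Omega> N \<Delta> lam g h \<gamma> L
    by unfold_locales (use assms in auto)
  \<comment> \<open>\<open>M\<close> and \<open>c\<close> are chosen before the three implications,
    whose premises may fail independently. Each rate is therefore stated as an eventual implication
    for all large \<open>M\<close>, trivial when its premise fails.\<close>
  define A1 where "A1 \<longleftrightarrow> (\<forall>x\<ge>0. g x > 0) \<and> continuous_on {0..} g"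
  define A2 where "A2 \<longleftrightarrow> (\<forall>x. g x > 0) \<and> continuous_on UNIV g \<and> 0 < \<beta> \<and> \<beta> \<le> 1"
  define A3 where "A3 \<longleftrightarrow> (\<forall>x. g x > 0) \<and> continuous_on UNIV g \<and> (\<forall>m. K m > 0) \<and>
    (\<exists>\<rho>>0. \<exists>C. \<forall>m. real m powr \<rho> \<le> C * real (K m)) \<and> (\<lambda>m. real (K m)) \<in> o(\<lambda>m. real m / ln (real m))"
  define B where "B F kap M n \<longleftrightarrow> (\<forall>f0\<in>F n. expected_posterior prior n f0
      (L1_far f0 (M * (kap n * ln (real n) / real n))) \<le> ennreal (exp (- (kap n * ln (real n)))))"
    for F :: "nat \<Rightarrow> (real \<Rightarrow> real) set" and kap :: "nat \<Rightarrow> real" and M n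
  have 1: "\<exists>M0. \<forall>M\<ge>M0. \<forall>\<^sub>F n in sequentially. A1 \<longrightarrow> B (\<lambda>_. monotone_class R) (\<lambda>n. (real n / ln (real n)) powr (1 / 2)) M n"
  proof (cases A1)
    case True
    then show ?thesis
      using monotone_class_rate[OF assms(1)] assms(13) by (simp add: A1_def B_def)
  qed simp
  have 2: "\<exists>M0. \<forall>M\<ge>M0. \<forall>\<^sub>F n in sequentially. A2 \<longrightarrow> B (\<lambda>_. holder_ball \<beta> R) (\<lambda>n. (real n / ln (real n)) powr (1 / (1 + \<beta>))) M n"
  proof (cases A2)
    case True
    then show ?thesis
      using holder_ball_rate[OF assms(1)] assms(13) by (simp add: A2_def B_def)
  qed simp
  have 3: "\<exists>M0. \<forall>M\<ge>M0. \<forall>\<^sub>F n in sequentially. A3 \<longrightarrow> B (\<lambda>n. piecewise_constant (K n) R) (\<lambda>n. real (K n)) M n"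
  proof (cases A3)
    case True
    then obtain \<rho> C where "\<rho> > 0" "\<And>m. real m powr \<rho> \<le> C * real (K m)" unfolding A3_def by blast
    with True show ?thesis
      using piecewise_constant_rate[OF assms(1), of K \<rho> C] assms(13) by (simp add: A3_def B_def)
  qed simp
  obtain M1 M2 M3 where M:
    "\<And>M. M \<ge> M1 \<Longrightarrow> \<forall>\<^sub>F n in sequentially. A1 \<longrightarrow> B (\<lambda>_. monotone_class R) (\<lambda>n. (real n / ln (real n)) powr (1 / 2)) M n"
    "\<And>M. M \<ge> M2 \<Longrightarrow> \<forall>\<^sub>F n in sequentially. A2 \<longrightarrow> B (\<lambda>_. holder_ball \<beta> R) (\<lambda>n. (real n / ln (real n)) powr (1 / (1 + \<beta>))) M n"
    "\<And>M. M \<ge> M3 \<Longrightarrow> \<forall>\<^sub>F n in sequentially. A3 \<longrightarrow> B (\<lambda>n. piecewise_constant (K n) R) (\<lambda>n. real (K n)) M n"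
    using 1 2 3 by blast
  \<comment> \<open>Each rate persists for larger \<open>M\<close>, so a maximum serves all three;
    the entry 1 ensures positivity.\<close>
  define M where "M = max (max M1 M2) (max M3 1)"
  have ge: "M1 \<le> M" "M2 \<le> M" "M3 \<le> M" "0 < M" by (auto simp: M_def)
  have main: "\<forall>\<^sub>F n in sequentially.
    (A1 \<longrightarrow> (SUP f0\<in>monotone_class R.
          expected_posterior prior n f0 (L1_far f0 (M * sqrt (ln (real n) / real n))))
       \<le> ennreal (exp (- 1 * sqrt (real n * ln (real n))))) \<and>
    (A2 \<longrightarrow> (SUP f0\<in>holder_ball \<beta> R.
          expected_posterior prior n f0 (L1_far f0 (M * (ln (real n) / real n) powr (\<beta> / (1 + \<beta>)))))
       \<le> ennreal (exp (- 1 * real n * (ln (real n) / real n) powr (\<beta> / (1 + \<beta>))))) \<and>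
    (A3 \<longrightarrow> (SUP f0\<in>piecewise_constant (K n) R.
          expected_posterior prior n f0 (L1_far f0 (M * (real (K n) / real n) * ln (real n))))
       \<le> ennreal (real n powr (- 1 * real (K n))))"
    using M(1)[OF ge(1)] M(2)[OF ge(2)] M(3)[OF ge(3)] eventually_ge_at_top[of 2]
  proof eventually_elim
    case (elim n)
    have n0: "0 < real n" "0 < ln (real n)" using elim by auto
    show ?case
    proof (intro conjI impI SUP_least)
      fix f0 assume "A1" "f0 \<in> monotone_class R"
      with elim(1) have "expected_posterior prior n f0 (L1_far f0 (M * ((real n / ln (real n)) powr (1 / 2) * ln (real n) / real n)))
          \<le> ennreal (exp (- ((real n / ln (real n)) powr (1 / 2) * ln (real n))))"
        unfolding B_def by blast
      then have "expected_posterior prior n f0 (L1_far f0 (M * sqrt (ln (real n) / real n)))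
          \<le> ennreal (exp (- ((real n / ln (real n)) powr (1 / 2) * ln (real n))))"
        by (simp only: sqrt_rate_eq(1)[OF n0])
      then show "expected_posterior prior n f0 (L1_far f0 (M * sqrt (ln (real n) / real n)))
          \<le> ennreal (exp (- 1 * sqrt (real n * ln (real n))))"
        by (simp only: sqrt_rate_eq(2)[OF n0] mult_minus1)
    next
      fix f0 assume "A2" and f0: "f0 \<in> holder_ball \<beta> R"
      then have "0 < \<beta>" by (simp add: A2_def)
      note eq = powr_rate_eq[OF n0 this]
      have eq': "(real n / ln (real n)) powr (1 / (1 + \<beta>)) * ln (real n) = real n * (ln (real n) / real n) powr (\<beta> / (1 + \<beta>))"
        unfolding eq[symmetric] using n0 by simp
      have "expected_posterior prior n f0 (L1_far f0 (M * ((real n / ln (real n)) powr (1 / (1 + \<beta>)) * ln (real n) / real n)))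
          \<le> ennreal (exp (- ((real n / ln (real n)) powr (1 / (1 + \<beta>)) * ln (real n))))"
        using elim(2) \<open>A2\<close> f0 unfolding B_def by blast
      then have "expected_posterior prior n f0 (L1_far f0 (M * (ln (real n) / real n) powr (\<beta> / (1 + \<beta>))))
          \<le> ennreal (exp (- ((real n / ln (real n)) powr (1 / (1 + \<beta>)) * ln (real n))))"
        by (simp only: eq)
      then show "expected_posterior prior n f0 (L1_far f0 (M * (ln (real n) / real n) powr (\<beta> / (1 + \<beta>))))
          \<le> ennreal (exp (- 1 * real n * (ln (real n) / real n) powr (\<beta> / (1 + \<beta>))))"
        by (simp only: eq' mult_minus1 mult_minus_left mult_1_left)
    next
      fix f0 assume "A3" "f0 \<in> piecewise_constant (K n) R"
      with elim(3) have "expected_posterior prior n f0 (L1_far f0 (M * (real (K n) * ln (real n) / real n)))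
          \<le> ennreal (exp (- (real (K n) * ln (real n))))"
        unfolding B_def by blast
      moreover have "M * (real (K n) * ln (real n) / real n) = M * (real (K n) / real n) * ln (real n)"
        by simp
      moreover have "exp (- (real (K n) * ln (real n))) = real n powr (- 1 * real (K n))"
        using n0 by (simp add: powr_def)
      ultimately show "expected_posterior prior n f0 (L1_far f0 (M * (real (K n) / real n) * ln (real n)))
          \<le> ennreal (real n powr (- 1 * real (K n)))"
        by (simp only:)
    qed
  qed
  then show ?thesis
    unfolding A1_def A2_def A3_def using ge(4) by (intro exI[of _ M] exI[of _ 1] conjI) auto
qed

end
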